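(* Let $M$ be a smooth $n$-dimensional manifold, $\Phi\to M$ a smooth fibre bundle, $1\le l\le k$, $\mathcal{L}=L\,d^nx$ a $k$-th order Lagrangian density on $J^k\Phi$, and $F=F^\lambda\,\partial_\lambda\lrcorner\, d^nx$ a $\Lambda^{n-1}M$-valued function on $J^{l-1}\Phi$. Put $\widetilde{\mathcal{L}}:=\mathcal{L}+\mathrm{d}F$, where $\mathrm{d}F=(\partial_\lambda F^\lambda)\,d^nx$ is the total divergence. Consider the shift of momenta $$\mathcal{F}:\quad p^{\mu_1\dots\mu_m\lambda}\longmapsto p^{\mu_1\dots\mu_m\lambda}+\frac{\partial F^\lambda}{\partial\varphi_{\mu_1\dots\mu_m}},\qquad 0\le m\le k-1,$$ on the phase bundle $\mathcal{P}=V^*(J^{k-1}\Phi)\otimes\Lambda^{n-1}M$, which generates a symplectomorphism (also denoted $\mathcal{F}$) of the infinitesimal phase bundle $\mathcal{P}^I$. A section $\sigma$ of $\mathcal{P}$ satisfies the Euler--Lagrange equations generated by $\mathcal{L}$ if and only if $\mathcal{F}\circ\sigma$ satisfies the Euler--Lagrange equations generated by $\widetilde{\mathcal{L}}$.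
   Context: $\Lambda^iM:=\bigwedge^iT^*M$; $V^*B$ is the dual of the vertical tangent bundle of $B\to M$; $\delta$ is the vertical differential (exterior derivative along fibres over $M$). Coordinates on $\Phi$: $(x^\mu,\varphi)$, field index suppressed; on $J^{m}\Phi$: $\varphi_{\mu_1\dots\mu_i}$, $0\le i\le m$, symmetric. $F$ is pulled back to $J^{k-1}\Phi$, so $\partial F^\lambda/\partial\varphi_{\mu_1\dots\mu_m}=0$ for $m\ge l$. $\partial_\lambda F^\lambda=\frac{\partial F^\lambda}{\partial x^\lambda}+\sum_{m}\frac{\partial F^\lambda}{\partial\varphi_{\mu_1\dots\mu_m}}\varphi_{\mu_1\dots\mu_m\lambda}$. Partial derivatives with respect to symmetric jet coordinates are the totally symmetric coefficients for which $\delta G=\sum_m\frac{\partial G}{\partial\varphi_{\mu_1\dots\mu_m}}\delta\varphi_{\mu_1\dots\mu_m}$ (sum over all index values). A point of $\mathcal{P}$ is $p=\sum_{m=0}^{k-1}p^{\mu_1\dots\mu_m\lambda}\,\delta\varphi_{\mu_1\dots\mu_m}\otimes(\partial_\lambda\lrcorner\, d^nx)$, with $p^{\mu_1\dots\mu_m\lambda}$ symmetric in $\mu_1,\dots,\mu_m$ only. A section $\sigma$ of $\mathcal{P}\to M$ satisfies the Euler--Lagrange equations generated by a density $L\,d^nx$ on $J^k\Phi$ if its $J^{k-1}\Phi$-component is $j^{k-1}f$ for a section $f$ of $\Phi$ and, along $j^kf$, $$p^{(\mu_1\dots\mu_k)}=\frac{\partial L}{\partial\varphi_{\mu_1\dots\mu_k}},\qquad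 p^{(\mu_1\dots\mu_m)}=\frac{\partial L}{\partial\varphi_{\mu_1\dots\mu_m}}-\partial_\lambda p^{\mu_1\dots\mu_m\lambda}\ \ (1\le m\le k-1),\qquad 0=\frac{\partial L}{\partial\varphi}-\partial_\lambda p^\lambda,$$ where $(\ )$ is total symmetrisation. Infinitesimal phase bundle: $\widetilde{\mathcal{P}}^I$ is the restriction of $J^1\mathcal{P}\to J^1(J^{k-1}\Phi)$ to $J^k\Phi$ (holonomic constraints $\varphi_{\mu_1\dots\mu_m,\lambda}=\varphi_{\mu_1\dots\mu_m\lambda}$), with the $\Lambda^nM$-valued vertical two-form $\widetilde\omega^I$ obtained by restricting $\sum_{m=0}^{k-1}(\delta p^{\mu_1\dots\mu_m\lambda}{}_{,\lambda}\wedge\delta\varphi_{\mu_1\dots\mu_m}+\delta p^{\mu_1\dots\mu_m\lambda}\wedge\delta\varphi_{\mu_1\dots\mu_m,\lambda})\otimes d^nx$. $\mathcal{P}^I$ is the space of degeneracy leaves of $\widetilde\omega^I$ (in the fibres over $M$), with the induced symplectic form $\omega^I$. The map $\mathcal{F}$ on $\mathcal{P}^I$ is the one induced by the first jet prolongation of the shift on $\mathcal{P}$. *)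

theory Defs
  imports "HOL-Analysis.Analysis" "HOL-Combinatorics.Combinatorics"
begin

section \<open>Smooth functions, manifolds and fibre bundles\<close>

text \<open>All smoothness notions below are meant for \<^emph>\<open>open\<close> sets S.\<close>

primrec Ck_on :: "nat \<Rightarrow> 'a::real_normed_vector set \<Rightarrow> ('a \<Rightarrow> 'b::real_normed_vector) \<Rightarrow> bool" where
  "Ck_on 0 S f \<longleftrightarrow> continuous_on S f"
| "Ck_on (Suc j) S f \<longleftrightarrow>
     (\<forall>x\<in>S. f differentiable (at x)) \<and> (\<forall>v. Ck_on j S (\<lambda>x. frechet_derivative f (at x) v))"

definition smooth_on :: "'a::real_normed_vector set \<Rightarrow> ('a \<Rightarrow> 'b::real_normed_vector) \<Rightarrow> bool" where
  "smooth_on S f \<longleftrightarrow> (\<forall>j. Ck_on j S f)"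

text \<open>A chart is a pair of its domain and its coordinate map. A manifold is an open subset (the
  union of the chart domains) of a Hausdorff, second countable type, with a smooth atlas; its
  dimension is that of the model space.\<close>

type_synonym ('p, 'v) chart = "'p set \<times> ('p \<Rightarrow> 'v)"

definition is_chart :: "('p::topological_space, 'v::real_normed_vector) chart \<Rightarrow> bool" where
  "is_chart c \<longleftrightarrow> open (fst c) \<and> open (snd c ` fst c) \<and>
     (\<exists>g. homeomorphism (fst c) (snd c ` fst c) (snd c) g)"

definition chart_inv :: "('p, 'v) chart \<Rightarrow> 'v \<Rightarrow> 'p" where
  "chart_inv c = inv_into (fst c) (snd c)"

definition compatible ::
  "('p, 'v::real_normed_vector) chart \<Rightarrow> ('p, 'v) chart \<Rightarrow> bool" where
  "compatible c d \<longleftrightarrow>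
     smooth_on (snd c ` (fst c \<inter> fst d)) (\<lambda>y. snd d (chart_inv c y)) \<and>
     smooth_on (snd d ` (fst c \<inter> fst d)) (\<lambda>y. snd c (chart_inv d y))"

definition smooth_atlas ::
  "('p::{t2_space,second_countable_topology}, 'v::real_normed_vector) chart set \<Rightarrow> bool" where
  "smooth_atlas A \<longleftrightarrow> (\<forall>c\<in>A. is_chart c) \<and> (\<forall>c\<in>A. \<forall>d\<in>A. compatible c d)"

definition carrier :: "('p, 'v) chart set \<Rightarrow> 'p set" where
  "carrier A = (\<Union>c\<in>A. fst c)"

text \<open>The maximal atlas.\<close>
definition charts ::
  "('p::topological_space, 'v::real_normed_vector) chart set \<Rightarrow> ('p, 'v) chart set" where
  "charts A = {c. is_chart c \<and> fst c \<subseteq> carrier A \<and> (\<forall>d\<in>A. compatible c d)}"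

definition restrict_atlas :: "'p set \<Rightarrow> ('p, 'v) chart set \<Rightarrow> ('p, 'v) chart set" where
  "restrict_atlas U A = (\<lambda>c. (fst c \<inter> U, snd c)) ` A"

definition prod_atlas ::
  "('p, 'v) chart set \<Rightarrow> ('q, 'w) chart set \<Rightarrow> ('p \<times> 'q, 'v \<times> 'w) chart set" where
  "prod_atlas A B = {(fst c \<times> fst d, map_prod (snd c) (snd d)) | c d. c \<in> A \<and> d \<in> B}"

definition smooth_map ::
  "('p::topological_space, 'v::real_normed_vector) chart set \<Rightarrow>
   ('q::topological_space, 'w::real_normed_vector) chart set \<Rightarrow> ('p \<Rightarrow> 'q) \<Rightarrow> bool" where
  "smooth_map A B f \<longleftrightarrow> f ` carrier A \<subseteq> carrier B \<and> continuous_on (carrier A) f \<and>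
     (\<forall>c\<in>A. \<forall>d\<in>B.
        smooth_on (snd c ` (fst c \<inter> f -` fst d)) (\<lambda>y. snd d (f (chart_inv c y))))"

definition diffeomorphism ::
  "('p::topological_space, 'v::real_normed_vector) chart set \<Rightarrow>
   ('q::topological_space, 'w::real_normed_vector) chart set \<Rightarrow> ('p \<Rightarrow> 'q) \<Rightarrow> bool" where
  "diffeomorphism A B f \<longleftrightarrow> bij_betw f (carrier A) (carrier B) \<and>
     smooth_map A B f \<and> smooth_map B A (inv_into (carrier A) f)"

record ('m, 'e, 'n::finite, 'r::finite) fib_bundle =
  base_atlas :: "('m, real^'n) chart set"
  total_atlas :: "('e, (real^'n) \<times> (real^'r)) chart set"
  proj :: "'e \<Rightarrow> 'm"

text \<open>Smooth fibre bundle with typical fibre (the manifold given by) Q.\<close>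

definition fibre_bundle ::
  "('m::{t2_space,second_countable_topology}, 'e::{t2_space,second_countable_topology},
    'n::finite, 'r::finite) fib_bundle \<Rightarrow>
   ('q::{t2_space,second_countable_topology}, real^'r) chart set \<Rightarrow> bool" where
  "fibre_bundle \<Phi> Q \<longleftrightarrow>
     smooth_atlas (base_atlas \<Phi>) \<and> smooth_atlas (total_atlas \<Phi>) \<and> smooth_atlas Q \<and>
     smooth_map (total_atlas \<Phi>) (base_atlas \<Phi>) (proj \<Phi>) \<and>
     proj \<Phi> ` carrier (total_atlas \<Phi>) = carrier (base_atlas \<Phi>) \<and>
     (\<forall>x\<in>carrier (base_atlas \<Phi>). \<exists>U \<Theta>. open U \<and> x \<in> U \<and> U \<subseteq> carrier (base_atlas \<Phi>) \<and>
        diffeomorphism (restrict_atlas (proj \<Phi> -` U) (total_atlas \<Phi>))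
          (prod_atlas (restrict_atlas U (base_atlas \<Phi>)) Q) \<Theta> \<and>
        (\<forall>e\<in>carrier (total_atlas \<Phi>) \<inter> proj \<Phi> -` U. fst (\<Theta> e) = proj \<Phi> e))"

text \<open>Adapted charts: a chart x of the base together with a chart (x, \<phi>) of the total space.\<close>

type_synonym ('m, 'e, 'n, 'r) achart =
  "('m, real^'n) chart \<times> ('e, (real^'n) \<times> (real^'r)) chart"

definition adapted ::
  "('m::topological_space, 'e::topological_space, 'n::finite, 'r::finite) fib_bundle \<Rightarrow>
   ('m, 'e, 'n, 'r) achart set" where
  "adapted \<Phi> = {(b, c). b \<in> charts (base_atlas \<Phi>) \<and> c \<in> charts (total_atlas \<Phi>) \<and>
     (\<forall>e\<in>fst c. proj \<Phi> e \<in> fst b \<and> fst (snd c e) = snd b (proj \<Phi> e))}"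

definition adapted_at ::
  "('m::topological_space, 'e::topological_space, 'n::finite, 'r::finite) fib_bundle \<Rightarrow> 'e \<Rightarrow>
   ('m, 'e, 'n, 'r) achart set" where
  "adapted_at \<Phi> e = {C \<in> adapted \<Phi>. e \<in> fst (snd C)}"

definition smooth_section ::
  "('m::topological_space, 'e::topological_space, 'n::finite, 'r::finite) fib_bundle \<Rightarrow>
   'm set \<Rightarrow> ('m \<Rightarrow> 'e) \<Rightarrow> bool" where
  "smooth_section \<Phi> U f \<longleftrightarrow> open U \<and> U \<subseteq> carrier (base_atlas \<Phi>) \<and>
     (\<forall>x\<in>U. proj \<Phi> (f x) = x) \<and>
     smooth_map (restrict_atlas U (base_atlas \<Phi>)) (total_atlas \<Phi>) f"

definition partial :: "'n::finite \<Rightarrow> (real^'n \<Rightarrow> real) \<Rightarrow> real^'n \<Rightarrow> real" where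
  "partial \<mu> g y = frechet_derivative g (at y) (axis \<mu> 1)"

definition partials :: "'n::finite list \<Rightarrow> (real^'n \<Rightarrow> real) \<Rightarrow> real^'n \<Rightarrow> real" where
  "partials \<mu>s g = foldr partial \<mu>s g"


section \<open>Bundles over the total space, given by their coordinates\<close>

text \<open>Names of coordinates. With a, b, ... for the (usually suppressed) field index and
  \<^term>\<open>ms\<close> = [\<mu>1, ..., \<mu>m]:

  Base \<mu>: the coordinate of the base with index \<mu>;
  Fld a ms: the jet coordinate \<phi> with lower indices \<mu>1 ... \<mu>m;
  Mom a ms \<lambda>: the momentum p with upper indices \<mu>1 ... \<mu>m \<lambda>;
  DFld a ms \<nu> and DMom a ms \<lambda> \<nu>: the coordinates of first jets belonging to the derivatives of
  Fld a ms and Mom a ms \<lambda> in the direction \<nu> (written with a comma in index notation).\<close>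

datatype ('n, 'r) coord =
    Base 'n
  | Fld 'r "'n list"
  | Mom 'r "'n list" 'n
  | DFld 'r "'n list" 'n
  | DMom 'r "'n list" 'n 'n

type_synonym ('n, 'r) coords = "('n, 'r) coord \<Rightarrow> real"

text \<open>Every bundle needed (jet bundles, phase bundle, its first jets) is a set of points z, where
  \<^term>\<open>fst z\<close> is the underlying point of \<Phi> and \<^term>\<open>snd z\<close> is the family of the coordinates of z
  with respect to all adapted charts around \<^term>\<open>fst z\<close>. For other charts, and for coordinates
  that the bundle in question does not have, the value is 0 by convention, so that equality of
  points is equality of all coordinates in all charts. Vertical tangent vectors are likewise
  families of components, of type \<open>achart \<Rightarrow> coords\<close>.\<close>

type_synonym ('m, 'e, 'n, 'r) point = "'e \<times> (('m, 'e, 'n, 'r) achart \<Rightarrow> ('n, 'r) coords)"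

definition base_pt ::
  "('m, 'e, 'n::finite, 'r::finite) fib_bundle \<Rightarrow> ('m, 'e, 'n, 'r) point \<Rightarrow> 'm" where
  "base_pt \<Phi> z = proj \<Phi> (fst z)"

text \<open>Smooth sections over U, and smooth curves within a fibre over the base, of such a bundle B.\<close>

definition bundle_section ::
  "('m::topological_space, 'e::topological_space, 'n::finite, 'r::finite) fib_bundle \<Rightarrow>
   ('m, 'e, 'n, 'r) point set \<Rightarrow> 'm set \<Rightarrow> ('m \<Rightarrow> ('m, 'e, 'n, 'r) point) \<Rightarrow> bool" where
  "bundle_section \<Phi> B U \<sigma> \<longleftrightarrow> open U \<and> U \<subseteq> carrier (base_atlas \<Phi>) \<and>
     (\<forall>x\<in>U. \<sigma> x \<in> B \<and> base_pt \<Phi> (\<sigma> x) = x) \<and> continuous_on U (\<lambda>x. fst (\<sigma> x)) \<and>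
     (\<forall>C\<in>adapted \<Phi>. \<forall>\<iota>. smooth_on (snd (fst C) ` {x\<in>U. fst (\<sigma> x) \<in> fst (snd C)})
        (\<lambda>y. snd (\<sigma> (chart_inv (fst C) y)) C \<iota>))"

definition fibre_curve ::
  "('m::topological_space, 'e::topological_space, 'n::finite, 'r::finite) fib_bundle \<Rightarrow>
   ('m, 'e, 'n, 'r) point set \<Rightarrow> (real \<Rightarrow> ('m, 'e, 'n, 'r) point) \<Rightarrow> bool" where
  "fibre_curve \<Phi> B \<gamma> \<longleftrightarrow>
     (\<forall>t. \<gamma> t \<in> B \<and> base_pt \<Phi> (\<gamma> t) = base_pt \<Phi> (\<gamma> 0)) \<and> continuous_on UNIV (\<lambda>t. fst (\<gamma> t)) \<and>
     (\<forall>C\<in>adapted \<Phi>. \<forall>\<iota>. smooth_on {t. fst (\<gamma> t) \<in> fst (snd C)} (\<lambda>t. snd (\<gamma> t) C \<iota>))"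

definition velocity ::
  "('m::topological_space, 'e::topological_space, 'n::finite, 'r::finite) fib_bundle \<Rightarrow>
   (real \<Rightarrow> ('m, 'e, 'n, 'r) point) \<Rightarrow> real \<Rightarrow> ('m, 'e, 'n, 'r) achart \<Rightarrow> ('n, 'r) coords" where
  "velocity \<Phi> \<gamma> t = (\<lambda>C \<iota>.
     if C \<in> adapted_at \<Phi> (fst (\<gamma> t)) then deriv (\<lambda>s. snd (\<gamma> s) C \<iota>) t else 0)"

definition tangent_vectors ::
  "('m::topological_space, 'e::topological_space, 'n::finite, 'r::finite) fib_bundle \<Rightarrow>
   ('m, 'e, 'n, 'r) point set \<Rightarrow> ('m, 'e, 'n, 'r) point \<Rightarrow>
   (('m, 'e, 'n, 'r) achart \<Rightarrow> ('n, 'r) coords) set" where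
  "tangent_vectors \<Phi> B z = {velocity \<Phi> \<gamma> 0 | \<gamma>. fibre_curve \<Phi> B \<gamma> \<and> \<gamma> 0 = z}"


section \<open>Jets and functions of jet coordinates\<close>

text \<open>The k-jet of f at x. Two sections through the same point have the same k-jet iff all their
  partial derivatives of order at most k agree (in all adapted charts, equivalently in one).\<close>

definition jet ::
  "('m::topological_space, 'e::topological_space, 'n::finite, 'r::finite) fib_bundle \<Rightarrow> nat \<Rightarrow>
   ('m \<Rightarrow> 'e) \<Rightarrow> 'm \<Rightarrow> ('m, 'e, 'n, 'r) point" where
  "jet \<Phi> k f x = (f x, \<lambda>C \<iota>. if C \<in> adapted_at \<Phi> (f x) then
     (case \<iota> of
        Base \<mu> \<Rightarrow> snd (fst C) x $ \<mu>
      | Fld a ms \<Rightarrow> if length ms \<le> k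
          then partials ms (\<lambda>y. snd (snd (snd C) (f (chart_inv (fst C) y))) $ a) (snd (fst C) x)
          else 0
      | _ \<Rightarrow> 0) else 0)"

definition jet_bundle ::
  "('m::topological_space, 'e::topological_space, 'n::finite, 'r::finite) fib_bundle \<Rightarrow> nat \<Rightarrow>
   ('m, 'e, 'n, 'r) point set" where
  "jet_bundle \<Phi> k = {jet \<Phi> k f x | f U x. smooth_section \<Phi> U f \<and> x \<in> U}"

text \<open>The linear space of symmetric jet coordinates of order at most k, and the open subset of a
  linear space V of coordinates belonging to the domain of an adapted chart.\<close>

definition jet_coords :: "nat \<Rightarrow> ('n, 'r) coords set" where
  "jet_coords k = {\<xi>.
     (\<forall>a ms ns. mset ms = mset ns \<longrightarrow> \<xi> (Fld a ms) = \<xi> (Fld a ns)) \<and>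
     (\<forall>a ms. length ms > k \<longrightarrow> \<xi> (Fld a ms) = 0) \<and>
     (\<forall>a ms l. \<xi> (Mom a ms l) = 0) \<and> (\<forall>a ms n. \<xi> (DFld a ms n) = 0) \<and>
     (\<forall>a ms l n. \<xi> (DMom a ms l n) = 0)}"

definition coord_domain ::
  "('n::finite, 'r::finite) coords set \<Rightarrow> ('m, 'e, 'n, 'r) achart \<Rightarrow> ('n, 'r) coords set" where
  "coord_domain V C =
     {\<xi>\<in>V. (\<chi> \<mu>. \<xi> (Base \<mu>), \<chi> a. \<xi> (Fld a [])) \<in> snd (snd C) ` fst (snd C)}"

definition dir_deriv :: "('i \<Rightarrow> real) \<Rightarrow> (('i \<Rightarrow> real) \<Rightarrow> real) \<Rightarrow> ('i \<Rightarrow> real) \<Rightarrow> real" where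
  "dir_deriv v G \<xi> = deriv (\<lambda>t. G (\<lambda>\<iota>. \<xi> \<iota> + t * v \<iota>)) 0"

text \<open>Smoothness on an open subset S of a finite-dimensional linear space V of coordinate tuples:
  all iterated directional derivatives exist and are continuous.\<close>

primrec Ck_coords ::
  "nat \<Rightarrow> ('i \<Rightarrow> real) set \<Rightarrow> ('i \<Rightarrow> real) set \<Rightarrow> (('i \<Rightarrow> real) \<Rightarrow> real) \<Rightarrow> bool" where
  "Ck_coords 0 V S G \<longleftrightarrow> continuous_on S G"
| "Ck_coords (Suc j) V S G \<longleftrightarrow> (\<forall>v\<in>V.
     (\<forall>\<xi>\<in>S. (\<lambda>t::real. G (\<lambda>\<iota>. \<xi> \<iota> + t * v \<iota>)) differentiable (at 0)) \<and>
     Ck_coords j V S (dir_deriv v G))"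

definition smooth_coords ::
  "('i \<Rightarrow> real) set \<Rightarrow> ('i \<Rightarrow> real) set \<Rightarrow> (('i \<Rightarrow> real) \<Rightarrow> real) \<Rightarrow> bool" where
  "smooth_coords V S G \<longleftrightarrow> (\<forall>j. Ck_coords j V S G)"

definition base_partial :: "'n \<Rightarrow> (('n, 'r) coords \<Rightarrow> real) \<Rightarrow> ('n, 'r) coords \<Rightarrow> real" where
  "base_partial \<mu> = dir_deriv (\<lambda>\<iota>. if \<iota> = Base \<mu> then 1 else 0)"

text \<open>The partial derivative of G with respect to the symmetric coordinate Fld a ms is the derivative
  in the direction of the symmetrised unit vector. The lemma below shows that it is the totally
  symmetric coefficient of \<delta>(Fld a ms) in \<delta>G, where \<delta>G is a sum over all index values.\<close>

definition sym_unit :: "'r \<Rightarrow> 'n list \<Rightarrow> ('n, 'r) coords" where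
  "sym_unit a ms = (\<lambda>\<iota>. case \<iota> of
     Fld b ns \<Rightarrow> if b = a \<and> mset ns = mset ms then 1 / real (card {ks. mset ks = mset ms}) else 0
   | _ \<Rightarrow> 0)"

definition fld_partial ::
  "'r \<Rightarrow> 'n list \<Rightarrow> (('n, 'r) coords \<Rightarrow> real) \<Rightarrow> ('n, 'r) coords \<Rightarrow> real" where
  "fld_partial a ms = dir_deriv (sym_unit a ms)"

lemma finite_mset_eq_lists: "finite {ks :: 'n list. mset ks = M}"
proof -
  have "{ks. mset ks = M} \<subseteq> {ks. set ks \<subseteq> set_mset M \<and> length ks = size M}"
    by auto
  then show ?thesis
    using finite_lists_length_eq[of "set_mset M" "size M"] finite_subset by auto
qed

lemma fld_partial_coefficient:
  fixes c :: "'r::finite \<Rightarrow> 'n::finite list \<Rightarrow> real" and \<xi> :: "('n, 'r) coords"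
  assumes \<delta>G: "\<And>v. v \<in> jet_coords k \<Longrightarrow> (\<And>\<mu>. v (Base \<mu>) = 0) \<Longrightarrow>
      dir_deriv v G \<xi> = (\<Sum>b\<in>UNIV. \<Sum>ns | length ns \<le> k. c b ns * v (Fld b ns))"
    and sym: "\<And>b ns ks. mset ns = mset ks \<Longrightarrow> c b ns = c b ks"
    and len: "length ms \<le> k"
  shows "fld_partial a ms G \<xi> = c a ms"
proof -
  let ?P = "{ks. mset ks = mset ms}"
  have fin: "finite ?P" by (rule finite_mset_eq_lists)
  have ne: "card ?P \<noteq> 0" using fin by auto
  have fl: "finite {ns :: 'n list. length ns \<le> k}"
    using finite_lists_length_le[of "UNIV :: 'n set" k] by simp
  have sub: "?P \<subseteq> {ns. length ns \<le> k}"
    using len by (auto dest: mset_eq_length)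
  have mem: "sym_unit a ms \<in> jet_coords k"
    using len by (auto simp: jet_coords_def sym_unit_def dest: mset_eq_length)
  have "fld_partial a ms G \<xi> =
      (\<Sum>b\<in>UNIV. \<Sum>ns | length ns \<le> k. c b ns * sym_unit a ms (Fld b ns))"
    unfolding fld_partial_def by (rule \<delta>G[OF mem]) (simp add: sym_unit_def)
  also have "\<dots> = (\<Sum>b\<in>UNIV. if b = a then c a ms else 0)"
  proof (rule sum.cong[OF refl])
    fix b :: 'r
    have "(\<Sum>ns | length ns \<le> k. c a ns * sym_unit a ms (Fld a ns)) =
        (\<Sum>ns\<in>?P. c a ns * sym_unit a ms (Fld a ns))"
      by (rule sum.mono_neutral_right[OF fl sub]) (auto simp: sym_unit_def)
    also have "\<dots> = (\<Sum>ns\<in>?P. c a ms / real (card ?P))"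
    proof (rule sum.cong[OF refl])
      fix ns assume ns: "ns \<in> ?P"
      then have "c a ns = c a ms" by (intro sym) simp
      with ns show "c a ns * sym_unit a ms (Fld a ns) = c a ms / real (card ?P)"
        by (simp add: sym_unit_def)
    qed
    also have "\<dots> = c a ms" using ne by simp
    finally show "(\<Sum>ns | length ns \<le> k. c b ns * sym_unit a ms (Fld b ns)) =
        (if b = a then c a ms else 0)"
      by (auto simp: sym_unit_def)
  qed
  finally show ?thesis by simp
qed


section \<open>Lagrangian densities and currents\<close>

text \<open>Jacobian at x of the coordinates of C' with respect to those of C.\<close>

definition base_jacobian ::
  "('m, 'e, 'n::finite, 'r::finite) achart \<Rightarrow> ('m, 'e, 'n, 'r) achart \<Rightarrow> 'm \<Rightarrow> real^'n^'n" where
  "base_jacobian C C' x =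
     matrix (frechet_derivative (\<lambda>y. snd (fst C') (chart_inv (fst C) y)) (at (snd (fst C) x)))"

text \<open>An n-form at the base point of e has one component (the coefficient of \<open>d\<^sup>nx\<close>), an (n-1)-form
  the components with respect to \<open>\<partial>\<^sub>\<lambda> \<lrcorner> d\<^sup>nx\<close>. Families of components indexed by the
  adapted charts around e define a form iff they transform as follows.\<close>

definition n_form_at ::
  "('m::topological_space, 'e::topological_space, 'n::finite, 'r::finite) fib_bundle \<Rightarrow> 'e \<Rightarrow>
   (('m, 'e, 'n, 'r) achart \<Rightarrow> real) \<Rightarrow> bool" where
  "n_form_at \<Phi> e \<alpha> \<longleftrightarrow> (\<forall>C\<in>adapted_at \<Phi> e. \<forall>C'\<in>adapted_at \<Phi> e.
     \<alpha> C' = det (base_jacobian C' C (proj \<Phi> e)) * \<alpha> C)"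

definition n1_form_at ::
  "('m::topological_space, 'e::topological_space, 'n::finite, 'r::finite) fib_bundle \<Rightarrow> 'e \<Rightarrow>
   (('m, 'e, 'n, 'r) achart \<Rightarrow> real^'n) \<Rightarrow> bool" where
  "n1_form_at \<Phi> e \<alpha> \<longleftrightarrow> (\<forall>C\<in>adapted_at \<Phi> e. \<forall>C'\<in>adapted_at \<Phi> e.
     \<alpha> C' = det (base_jacobian C' C (proj \<Phi> e)) *\<^sub>R (base_jacobian C C' (proj \<Phi> e) *v \<alpha> C))"

text \<open>Densities \<open>L d\<^sup>nx\<close> on the k-th jet bundle and \<open>\<Lambda>\<^sup>n\<^sup>-\<^sup>1M\<close>-valued functions
  \<open>F\<^sup>\<lambda> \<partial>\<^sub>\<lambda> \<lrcorner> d\<^sup>nx\<close> on the j-th jet bundle, given by their coordinate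
  expressions in all adapted charts.\<close>

type_synonym ('m, 'e, 'n, 'r) density = "('m, 'e, 'n, 'r) achart \<Rightarrow> ('n, 'r) coords \<Rightarrow> real"
type_synonym ('m, 'e, 'n, 'r) current = "('m, 'e, 'n, 'r) achart \<Rightarrow> 'n \<Rightarrow> ('n, 'r) coords \<Rightarrow> real"

definition is_density ::
  "('m::topological_space, 'e::topological_space, 'n::finite, 'r::finite) fib_bundle \<Rightarrow> nat \<Rightarrow>
   ('m, 'e, 'n, 'r) density \<Rightarrow> bool" where
  "is_density \<Phi> k L \<longleftrightarrow>
     (\<forall>C\<in>adapted \<Phi>. smooth_coords (jet_coords k) (coord_domain (jet_coords k) C) (L C)) \<and>
     (\<forall>z\<in>jet_bundle \<Phi> k. n_form_at \<Phi> (fst z) (\<lambda>C. L C (snd z C)))"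

definition is_current ::
  "('m::topological_space, 'e::topological_space, 'n::finite, 'r::finite) fib_bundle \<Rightarrow> nat \<Rightarrow>
   ('m, 'e, 'n, 'r) current \<Rightarrow> bool" where
  "is_current \<Phi> j F \<longleftrightarrow>
     (\<forall>C\<in>adapted \<Phi>. \<forall>\<mu>.
        smooth_coords (jet_coords j) (coord_domain (jet_coords j) C) (F C \<mu>)) \<and>
     (\<forall>z\<in>jet_bundle \<Phi> j. n1_form_at \<Phi> (fst z) (\<lambda>C. \<chi> \<mu>. F C \<mu> (snd z C)))"

definition truncate :: "nat \<Rightarrow> ('n, 'r) coords \<Rightarrow> ('n, 'r) coords" where
  "truncate j \<xi> = (\<lambda>\<iota>. case \<iota> of
     Base \<mu> \<Rightarrow> \<xi> \<iota> | Fld a ms \<Rightarrow> (if length ms \<le> j then \<xi> \<iota> else 0) | _ \<Rightarrow> 0)"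

text \<open>Pull-back of a current on the j-th jet bundle to all higher jet bundles (and to the phase
  bundle).\<close>

definition pull_back :: "nat \<Rightarrow> ('m, 'e, 'n, 'r) current \<Rightarrow> ('m, 'e, 'n, 'r) current" where
  "pull_back j F = (\<lambda>C \<mu> \<xi>. F C \<mu> (truncate j \<xi>))"

text \<open>Total divergence, for F on the (k-1)-st jet bundle.\<close>

definition total_div ::
  "nat \<Rightarrow> ('m, 'e, 'n::finite, 'r::finite) current \<Rightarrow> ('m, 'e, 'n, 'r) density" where
  "total_div k F C \<xi> = (\<Sum>l\<in>UNIV. base_partial l (F C l) \<xi> +
     (\<Sum>a\<in>UNIV. \<Sum>ms | length ms < k. fld_partial a ms (F C l) \<xi> * \<xi> (Fld a (ms @ [l]))))"


section \<open>The phase bundle and the Euler-Lagrange equations\<close>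

definition jet_part ::
  "('m, 'e, 'n::finite, 'r::finite) point \<Rightarrow> ('m, 'e, 'n, 'r) point" where
  "jet_part z = (fst z, \<lambda>C \<iota>. case \<iota> of Base \<mu> \<Rightarrow> snd z C \<iota> | Fld a ms \<Rightarrow> snd z C \<iota> | _ \<Rightarrow> 0)"

text \<open>The last condition says that the momenta at z define a linear map from the vertical tangent
  space of the (k-1)-st jet bundle to the (n-1)-forms on the base, i.e. an element of
  \<open>V\<^sup>*(J\<^sup>k\<^sup>-\<^sup>1\<Phi>) \<otimes> \<Lambda>\<^sup>n\<^sup>-\<^sup>1M\<close>.\<close>

definition phase_bundle ::
  "('m::topological_space, 'e::topological_space, 'n::finite, 'r::finite) fib_bundle \<Rightarrow> nat \<Rightarrow>
   ('m, 'e, 'n, 'r) point set" where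
  "phase_bundle \<Phi> k = {z. jet_part z \<in> jet_bundle \<Phi> (k - 1) \<and>
     (\<forall>C a ms l. C \<notin> adapted_at \<Phi> (fst z) \<or> length ms \<ge> k \<longrightarrow> snd z C (Mom a ms l) = 0) \<and>
     (\<forall>C a ms ns l. mset ms = mset ns \<longrightarrow> snd z C (Mom a ms l) = snd z C (Mom a ns l)) \<and>
     (\<forall>C a ms n. snd z C (DFld a ms n) = 0) \<and> (\<forall>C a ms l n. snd z C (DMom a ms l n) = 0) \<and>
     (\<forall>X\<in>tangent_vectors \<Phi> (jet_bundle \<Phi> (k - 1)) (jet_part z).
        n1_form_at \<Phi> (fst z) (\<lambda>C. \<chi> l.
          \<Sum>a\<in>UNIV. \<Sum>ms | length ms < k. snd z C (Mom a ms l) * X C (Fld a ms)))}"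

text \<open>Total symmetrisation of the momenta; ms contains all upper indices and must be nonempty.\<close>

definition sym_mom ::
  "('m, 'e, 'n::finite, 'r::finite) point \<Rightarrow> ('m, 'e, 'n, 'r) achart \<Rightarrow> 'r \<Rightarrow> 'n list \<Rightarrow> real" where
  "sym_mom z C a ms = (\<Sum>\<pi> | \<pi> permutes {..<length ms}.
     snd z C (Mom a (butlast (permute_list \<pi> ms)) (last (permute_list \<pi> ms))))
     / fact (length ms)"

text \<open>The derivative, at x and in the direction \<nu>, of the coordinate \<iota> along a section \<sigma>.\<close>

definition coord_partial ::
  "('m \<Rightarrow> ('m, 'e, 'n::finite, 'r::finite) point) \<Rightarrow> ('m, 'e, 'n, 'r) achart \<Rightarrow> ('n, 'r) coord \<Rightarrow>
   'n \<Rightarrow> 'm \<Rightarrow> real" where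
  "coord_partial \<sigma> C \<iota> \<nu> x = partial \<nu> (\<lambda>y. snd (\<sigma> (chart_inv (fst C) y)) C \<iota>) (snd (fst C) x)"

definition euler_lagrange ::
  "('m::topological_space, 'e::topological_space, 'n::finite, 'r::finite) fib_bundle \<Rightarrow> nat \<Rightarrow>
   ('m, 'e, 'n, 'r) density \<Rightarrow> ('m \<Rightarrow> ('m, 'e, 'n, 'r) point) \<Rightarrow> bool" where
  "euler_lagrange \<Phi> k L \<sigma> \<longleftrightarrow>
     bundle_section \<Phi> (phase_bundle \<Phi> k) (carrier (base_atlas \<Phi>)) \<sigma> \<and>
     (\<exists>f. smooth_section \<Phi> (carrier (base_atlas \<Phi>)) f \<and>
        (\<forall>x\<in>carrier (base_atlas \<Phi>). jet_part (\<sigma> x) = jet \<Phi> (k - 1) f x \<and>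
           (\<forall>C\<in>adapted_at \<Phi> (f x). \<forall>a.
              (\<forall>ms. length ms = k \<longrightarrow>
                 sym_mom (\<sigma> x) C a ms = fld_partial a ms (L C) (snd (jet \<Phi> k f x) C)) \<and>
              (\<forall>ms. 1 \<le> length ms \<and> length ms \<le> k - 1 \<longrightarrow>
                 sym_mom (\<sigma> x) C a ms = fld_partial a ms (L C) (snd (jet \<Phi> k f x) C)
                   - (\<Sum>l\<in>UNIV. coord_partial \<sigma> C (Mom a ms l) l x)) \<and>
              0 = fld_partial a [] (L C) (snd (jet \<Phi> k f x) C)
                   - (\<Sum>l\<in>UNIV. coord_partial \<sigma> C (Mom a [] l) l x))))"

text \<open>The shift of momenta by a current F that has been pulled back to the (k-1)-st jet bundle.\<close>

definition momentum_shift ::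
  "('m::topological_space, 'e::topological_space, 'n::finite, 'r::finite) fib_bundle \<Rightarrow> nat \<Rightarrow>
   ('m, 'e, 'n, 'r) current \<Rightarrow> ('m, 'e, 'n, 'r) point \<Rightarrow> ('m, 'e, 'n, 'r) point" where
  "momentum_shift \<Phi> k F z = (fst z, \<lambda>C \<iota>. case \<iota> of
      Mom a ms l \<Rightarrow> snd z C \<iota> +
        (if C \<in> adapted_at \<Phi> (fst z) \<and> length ms < k
         then fld_partial a ms (F C l) (snd (jet_part z) C) else 0)
    | _ \<Rightarrow> snd z C \<iota>)"


section \<open>The infinitesimal phase bundle\<close>

definition first_jet ::
  "('m::topological_space, 'e::topological_space, 'n::finite, 'r::finite) fib_bundle \<Rightarrow>
   ('m \<Rightarrow> ('m, 'e, 'n, 'r) point) \<Rightarrow> 'm \<Rightarrow> ('m, 'e, 'n, 'r) point" where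
  "first_jet \<Phi> \<sigma> x = (fst (\<sigma> x), \<lambda>C \<iota>. if C \<in> adapted_at \<Phi> (fst (\<sigma> x)) then
     (case \<iota> of
        DFld a ms n \<Rightarrow> coord_partial \<sigma> C (Fld a ms) n x
      | DMom a ms l n \<Rightarrow> coord_partial \<sigma> C (Mom a ms l) n x
      | _ \<Rightarrow> snd (\<sigma> x) C \<iota>) else 0)"

definition first_jets_phase ::
  "('m::topological_space, 'e::topological_space, 'n::finite, 'r::finite) fib_bundle \<Rightarrow> nat \<Rightarrow>
   ('m, 'e, 'n, 'r) point set" where
  "first_jets_phase \<Phi> k =
     {first_jet \<Phi> \<sigma> x | \<sigma> U x. bundle_section \<Phi> (phase_bundle \<Phi> k) U \<sigma> \<and> x \<in> U}"

text \<open>Restriction to the holonomic first jets, i.e. to the k-th jet bundle of \<Phi>, before the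
  reduction by the degeneracy of the two-form.\<close>

definition pre_inf_phase ::
  "('m::topological_space, 'e::topological_space, 'n::finite, 'r::finite) fib_bundle \<Rightarrow> nat \<Rightarrow>
   ('m, 'e, 'n, 'r) point set" where
  "pre_inf_phase \<Phi> k = {z \<in> first_jets_phase \<Phi> k. \<exists>j\<in>jet_bundle \<Phi> k. fst j = fst z \<and>
     (\<forall>C\<in>adapted_at \<Phi> (fst z). \<forall>a ms. length ms < k \<longrightarrow>
        snd z C (Fld a ms) = snd j C (Fld a ms) \<and>
        (\<forall>n. snd z C (DFld a ms n) = snd j C (Fld a (ms @ [n]))))}"

text \<open>Its two-form: the \<open>d\<^sup>nx\<close>-components in all charts of the value on the vertical
  vectors X and Y.\<close>

definition pre_omega ::
  "nat \<Rightarrow> (('m, 'e, 'n::finite, 'r::finite) achart \<Rightarrow> ('n, 'r) coords) \<Rightarrow>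
   (('m, 'e, 'n, 'r) achart \<Rightarrow> ('n, 'r) coords) \<Rightarrow> ('m, 'e, 'n, 'r) achart \<Rightarrow> real" where
  "pre_omega k X Y C = (\<Sum>a\<in>UNIV. \<Sum>ms | length ms < k. \<Sum>l\<in>UNIV.
     (X C (DMom a ms l l) * Y C (Fld a ms) - Y C (DMom a ms l l) * X C (Fld a ms)) +
     (X C (Mom a ms l) * Y C (DFld a ms l) - Y C (Mom a ms l) * X C (DFld a ms l)))"

definition degeneracy ::
  "('m::topological_space, 'e::topological_space, 'n::finite, 'r::finite) fib_bundle \<Rightarrow> nat \<Rightarrow>
   ('m, 'e, 'n, 'r) point \<Rightarrow> (('m, 'e, 'n, 'r) achart \<Rightarrow> ('n, 'r) coords) set" where
  "degeneracy \<Phi> k z = {X \<in> tangent_vectors \<Phi> (pre_inf_phase \<Phi> k) z.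
     \<forall>Y\<in>tangent_vectors \<Phi> (pre_inf_phase \<Phi> k) z. \<forall>C. pre_omega k X Y C = 0}"

definition degenerate_path ::
  "('m::topological_space, 'e::topological_space, 'n::finite, 'r::finite) fib_bundle \<Rightarrow> nat \<Rightarrow>
   ('m, 'e, 'n, 'r) point \<Rightarrow> ('m, 'e, 'n, 'r) point \<Rightarrow> bool" where
  "degenerate_path \<Phi> k z w \<longleftrightarrow> (\<exists>\<gamma>. fibre_curve \<Phi> (pre_inf_phase \<Phi> k) \<gamma> \<and> \<gamma> 0 = z \<and> \<gamma> 1 = w \<and>
     (\<forall>t. velocity \<Phi> \<gamma> t \<in> degeneracy \<Phi> k (\<gamma> t)))"

definition leaf ::
  "('m::topological_space, 'e::topological_space, 'n::finite, 'r::finite) fib_bundle \<Rightarrow> nat \<Rightarrow>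
   ('m, 'e, 'n, 'r) point \<Rightarrow> ('m, 'e, 'n, 'r) point set" where
  "leaf \<Phi> k z = {w. (degenerate_path \<Phi> k)\<^sup>*\<^sup>* z w}"

definition inf_phase ::
  "('m::topological_space, 'e::topological_space, 'n::finite, 'r::finite) fib_bundle \<Rightarrow> nat \<Rightarrow>
   ('m, 'e, 'n, 'r) point set set" where
  "inf_phase \<Phi> k = leaf \<Phi> k ` pre_inf_phase \<Phi> k"

text \<open>Smooth functions on the space of leaves (quotient smooth structure): those whose pull-back is
  smooth. In an adapted chart, \<^term>\<open>pre_inf_coords k\<close> is the linear space of coordinates that
  satisfy the holonomic constraints.\<close>

definition pre_inf_coords :: "nat \<Rightarrow> ('n, 'r) coords set" where
  "pre_inf_coords k = {\<xi>.
     (\<exists>\<eta>\<in>jet_coords k. \<forall>a ms.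
        \<xi> (Fld a ms) = (if length ms < k then \<eta> (Fld a ms) else 0) \<and>
        (\<forall>n. \<xi> (DFld a ms n) = (if length ms < k then \<eta> (Fld a (ms @ [n])) else 0))) \<and>
     (\<forall>a ms ns l. mset ms = mset ns \<longrightarrow> \<xi> (Mom a ms l) = \<xi> (Mom a ns l) \<and>
        (\<forall>n. \<xi> (DMom a ms l n) = \<xi> (DMom a ns l n))) \<and>
     (\<forall>a ms l. length ms \<ge> k \<longrightarrow> \<xi> (Mom a ms l) = 0 \<and> (\<forall>n. \<xi> (DMom a ms l n) = 0))}"

definition smooth_on_inf_phase ::
  "('m::topological_space, 'e::topological_space, 'n::finite, 'r::finite) fib_bundle \<Rightarrow> nat \<Rightarrow>
   (('m, 'e, 'n, 'r) point set \<Rightarrow> real) \<Rightarrow> bool" where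
  "smooth_on_inf_phase \<Phi> k H \<longleftrightarrow> (\<forall>C\<in>adapted \<Phi>. \<exists>h.
     smooth_coords (pre_inf_coords k) (coord_domain (pre_inf_coords k) C) h \<and>
     (\<forall>z\<in>pre_inf_phase \<Phi> k. C \<in> adapted_at \<Phi> (fst z) \<longrightarrow> H (leaf \<Phi> k z) = h (snd z C)))"

text \<open>Vertical tangent vectors of the space of leaves are represented by curves in its fibres over
  the base which are projections of smooth curves. The induced form \<^term>\<open>inf_omega\<close> is evaluated
  on the velocities at 0 of two such curves with the same initial point: its value is that of
  \<^term>\<open>pre_omega\<close> on the velocities of any lifts starting at a common point.\<close>

definition lifts ::
  "('m::topological_space, 'e::topological_space, 'n::finite, 'r::finite) fib_bundle \<Rightarrow> nat \<Rightarrow>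
   (real \<Rightarrow> ('m, 'e, 'n, 'r) point set) \<Rightarrow> (real \<Rightarrow> ('m, 'e, 'n, 'r) point) set" where
  "lifts \<Phi> k c = {\<gamma>. fibre_curve \<Phi> (pre_inf_phase \<Phi> k) \<gamma> \<and> (\<forall>t. c t = leaf \<Phi> k (\<gamma> t))}"

definition inf_omega ::
  "('m::topological_space, 'e::topological_space, 'n::finite, 'r::finite) fib_bundle \<Rightarrow> nat \<Rightarrow>
   (real \<Rightarrow> ('m, 'e, 'n, 'r) point set) \<Rightarrow> (real \<Rightarrow> ('m, 'e, 'n, 'r) point set) \<Rightarrow>
   ('m, 'e, 'n, 'r) achart \<Rightarrow> real" where
  "inf_omega \<Phi> k c d = (THE \<alpha>. \<exists>\<gamma>\<in>lifts \<Phi> k c. \<exists>\<delta>\<in>lifts \<Phi> k d. \<gamma> 0 = \<delta> 0 \<and>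
     \<alpha> = pre_omega k (velocity \<Phi> \<gamma> 0) (velocity \<Phi> \<delta> 0))"

text \<open>A symplectomorphism of the infinitesimal phase bundle: a diffeomorphism over the identity of
  the base that preserves the induced symplectic form of the fibres. (A map of manifolds is smooth
  iff it pulls smooth functions back to smooth functions.)\<close>

definition symplectomorphism_inf_phase ::
  "('m::topological_space, 'e::topological_space, 'n::finite, 'r::finite) fib_bundle \<Rightarrow> nat \<Rightarrow>
   (('m, 'e, 'n, 'r) point set \<Rightarrow> ('m, 'e, 'n, 'r) point set) \<Rightarrow> bool" where
  "symplectomorphism_inf_phase \<Phi> k f \<longleftrightarrow>
     bij_betw f (inf_phase \<Phi> k) (inf_phase \<Phi> k) \<and>
     (\<forall>K\<in>inf_phase \<Phi> k. \<forall>z\<in>K. \<forall>w\<in>f K. base_pt \<Phi> w = base_pt \<Phi> z) \<and>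
     (\<forall>H. smooth_on_inf_phase \<Phi> k H \<longrightarrow>
        smooth_on_inf_phase \<Phi> k (\<lambda>K. H (f K)) \<and>
        smooth_on_inf_phase \<Phi> k (\<lambda>K. H (inv_into (inf_phase \<Phi> k) f K))) \<and>
     (\<forall>c d. lifts \<Phi> k c \<noteq> {} \<and> lifts \<Phi> k d \<noteq> {} \<and> c 0 = d 0 \<longrightarrow>
        lifts \<Phi> k (\<lambda>t. f (c t)) \<noteq> {} \<and> lifts \<Phi> k (\<lambda>t. f (d t)) \<noteq> {} \<and>
        inf_omega \<Phi> k (\<lambda>t. f (c t)) (\<lambda>t. f (d t)) = inf_omega \<Phi> k c d)"

text \<open>The first jet prolongation of a fibre-preserving map S of the phase bundle, and the map
  induced by it on leaves.\<close>

definition prolongation ::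
  "('m::topological_space, 'e::topological_space, 'n::finite, 'r::finite) fib_bundle \<Rightarrow> nat \<Rightarrow>
   (('m, 'e, 'n, 'r) point \<Rightarrow> ('m, 'e, 'n, 'r) point) \<Rightarrow>
   ('m, 'e, 'n, 'r) point \<Rightarrow> ('m, 'e, 'n, 'r) point" where
  "prolongation \<Phi> k S z = (THE w. \<exists>\<sigma> U x. bundle_section \<Phi> (phase_bundle \<Phi> k) U \<sigma> \<and> x \<in> U \<and>
     first_jet \<Phi> \<sigma> x = z \<and> w = first_jet \<Phi> (S \<circ> \<sigma>) x)"

definition induced_map ::
  "('m::topological_space, 'e::topological_space, 'n::finite, 'r::finite) fib_bundle \<Rightarrow> nat \<Rightarrow>
   (('m, 'e, 'n, 'r) point \<Rightarrow> ('m, 'e, 'n, 'r) point) \<Rightarrow>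
   ('m, 'e, 'n, 'r) point set \<Rightarrow> ('m, 'e, 'n, 'r) point set" where
  "induced_map \<Phi> k S K = prolongation \<Phi> k S ` K"

end

theory Submission
  imports Defs
begin

text \<open>Let u be the symmetrised unit vector of the coordinate \<open>Fld a ms\<close>. Write \<open>\<partial>\<^sub>u\<close> for the
  derivative in the direction u, and \<open>D\<^sub>\<lambda>\<close> for the total derivative, i.e. the
  derivative in the direction with components 1 at \<open>Base \<lambda>\<close> and \<open>\<xi> (Fld b (ns @ [\<lambda>]))\<close> at
  \<open>Fld b ns\<close>. This direction is affine in \<open>\<xi>\<close>, so, as partial derivatives commute,
  differentiating \<open>D\<^sub>\<lambda>F\<^sup>\<lambda>\<close> along u gives \<open>D\<^sub>\<lambda>\<partial>\<^sub>u F\<^sup>\<lambda>\<close> plus the total symmetrisation of the first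
  derivatives of \<open>F\<close>. Along a holonomic section the first term is the divergence of the shift of the
  momenta and the second one its total symmetrisation, so the Euler-Lagrange equations correspond term
  by term.

  The prolonged shift changes the two-form by the antisymmetrisation of the second variation of
  \<open>D\<^sub>\<lambda>F\<^sup>\<lambda>\<close>, which is symmetric. Hence it preserves the two-form, its degeneracy directions and their
  leaves; the shift with the opposite sign provides the inverse.\<close>

section \<open>Smooth functions on normed spaces\<close>

text \<open>Coordinate tuples are functions on an infinite index type, and symmetric jet coordinates
  form a finite-dimensional subspace without a chosen norm. Smoothness there is expressed by
  iterated directional derivatives, so differentiability, linearity in the direction and the chain
  rule have to be recovered from the continuity of these derivatives before a total derivative,
  whose direction moves with the point, can itself be differentiated.

  As F depends only on jets of order below l, its derivatives are taken after truncation to that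
  order. This also settles the equation of order k, which has no divergence term: there the
  derivatives of F vanish.

  That the shift maps the phase bundle to itself is not visible in a single chart. Contracted with a
  vertical vector, the shift is the derivative of F along a curve in one fibre over M, where the
  Jacobians in the transformation law of F are constant.

  Functions and curves on the space of leaves are given through representatives before the
  reduction, so statements about leaves reduce to statements about the prolonged shift.\<close>

lemma smooth_onD:
  assumes "smooth_on S f"
  shows "continuous_on S f"
    and "x \<in> S \<Longrightarrow> f differentiable (at x)"
    and "smooth_on S (\<lambda>x. frechet_derivative f (at x) v)"
proof -
  have j: "Ck_on j S f" for j using assms by (simp add: smooth_on_def)
  show "continuous_on S f" using j[of 0] by simp
  show "f differentiable (at x)" if "x \<in> S" using j[of "Suc 0"] that by simp
  show "smooth_on S (\<lambda>x. frechet_derivative f (at x) v)"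
    unfolding smooth_on_def using j[of "Suc _"] by simp
qed

lemma Ck_on_cong:
  assumes "open S" and "\<And>x. x \<in> S \<Longrightarrow> f x = g x" and "Ck_on j S f"
  shows "Ck_on j S g"
  using assms(2,3)
proof (induction j arbitrary: f g)
  case 0
  then show ?case using continuous_on_cong[of S S f g] by simp
next
  case (Suc j)
  have d: "(g has_derivative frechet_derivative f (at x)) (at x)" if "x \<in> S" for x
  proof (rule has_derivative_transform_within_open[OF _ assms(1) that Suc.prems(1)])
    show "(f has_derivative frechet_derivative f (at x)) (at x)"
      using Suc.prems(2) that by (simp add: frechet_derivative_works)
  qed
  show ?case
    unfolding Ck_on.simps
  proof (intro conjI ballI allI)
    fix x assume "x \<in> S"
    then show "g differentiable at x" using d by (auto intro: differentiableI)
  next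
    fix v
    show "Ck_on j S (\<lambda>x. frechet_derivative g (at x) v)"
    proof (rule Suc.IH)
      show "Ck_on j S (\<lambda>x. frechet_derivative f (at x) v)" using Suc.prems by simp
      show "frechet_derivative f (at x) v = frechet_derivative g (at x) v" if "x \<in> S" for x
        using frechet_derivative_at[OF d[OF that]] by simp
    qed
  qed
qed

lemma smooth_on_cong:
  assumes "open S" and "smooth_on S f" and "\<And>x. x \<in> S \<Longrightarrow> f x = g x"
  shows "smooth_on S g"
  using assms Ck_on_cong[OF assms(1), of f g] by (auto simp: smooth_on_def)

lemma Ck_on_subset: "Ck_on j S f \<Longrightarrow> T \<subseteq> S \<Longrightarrow> Ck_on j T f"
  by (induction j arbitrary: f) (auto intro: continuous_on_subset)

lemma smooth_on_subset: "smooth_on S f \<Longrightarrow> T \<subseteq> S \<Longrightarrow> smooth_on T f"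
  by (auto simp: smooth_on_def intro: Ck_on_subset)

lemma Ck_on_local:
  assumes "\<And>x. x \<in> S \<Longrightarrow> \<exists>T. open T \<and> x \<in> T \<and> Ck_on j T f"
  shows "Ck_on j S f"
  using assms
proof (induction j arbitrary: f)
  case 0
  then show ?case
    by (metis Ck_on.simps(1) continuous_at_imp_continuous_on continuous_on_eq_continuous_at)
next
  case (Suc j)
  show ?case unfolding Ck_on.simps
  proof (intro conjI ballI allI)
    fix x assume "x \<in> S"
    then show "f differentiable at x" using Suc.prems by fastforce
  next
    fix v
    show "Ck_on j S (\<lambda>x. frechet_derivative f (at x) v)"
      by (rule Suc.IH) (use Suc.prems in fastforce)
  qed
qed

lemma smooth_on_local:
  assumes "\<And>x. x \<in> S \<Longrightarrow> \<exists>T. open T \<and> x \<in> T \<and> smooth_on T f"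
  shows "smooth_on S f"
  unfolding smooth_on_def
proof
  show "Ck_on j S f" for j
    by (rule Ck_on_local) (use assms in \<open>auto simp: smooth_on_def\<close>)
qed

lemma Ck_on_SucI:
  assumes "open S" and d: "\<And>x. x \<in> S \<Longrightarrow> (f has_derivative f' x) (at x)"
    and "\<And>v. Ck_on j S (\<lambda>x. f' x v)"
  shows "Ck_on (Suc j) S f"
  unfolding Ck_on.simps
proof (intro conjI ballI allI)
  show "f differentiable at x" if "x \<in> S" for x using d[OF that] by (rule differentiableI)
  show "Ck_on j S (\<lambda>x. frechet_derivative f (at x) v)" for v
    by (rule Ck_on_cong[OF assms(1) _ assms(3)[of v]]) (use frechet_derivative_at[OF d] in auto)
qed

lemma Ck_on_const: "Ck_on j S (\<lambda>x. c)"
  by (induction j arbitrary: c) auto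

lemma smooth_on_const: "smooth_on S (\<lambda>x. c)"
  by (simp add: smooth_on_def Ck_on_const)

lemma Ck_on_add:
  assumes "open S" "Ck_on j S f" "Ck_on j S g"
  shows "Ck_on j S (\<lambda>x. f x + g x)"
  using assms(2,3)
proof (induction j arbitrary: f g)
  case 0 then show ?case by (auto intro: continuous_intros)
next
  case (Suc j)
  show ?case
    by (rule Ck_on_SucI[OF assms(1), where
          f' = "\<lambda>x v. frechet_derivative f (at x) v + frechet_derivative g (at x) v"])
      (use Suc in \<open>auto intro!: has_derivative_add simp: frechet_derivative_works\<close>)
qed

lemma smooth_on_add:
  "open S \<Longrightarrow> smooth_on S f \<Longrightarrow> smooth_on S g \<Longrightarrow> smooth_on S (\<lambda>x. f x + g x)"
  by (auto simp: smooth_on_def intro: Ck_on_add)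

lemma Ck_on_sum:
  assumes "open S" "\<And>i. i \<in> I \<Longrightarrow> Ck_on j S (f i)"
  shows "Ck_on j S (\<lambda>x. \<Sum>i\<in>I. f i x)"
  using assms(2)
  by (induction I rule: infinite_finite_induct) (auto intro: Ck_on_const Ck_on_add[OF assms(1)])

lemma smooth_on_sum:
  "open S \<Longrightarrow> (\<And>i. i \<in> I \<Longrightarrow> smooth_on S (f i)) \<Longrightarrow> smooth_on S (\<lambda>x. \<Sum>i\<in>I. f i x)"
  by (auto simp: smooth_on_def intro: Ck_on_sum)

lemma Ck_on_SucD: "Ck_on (Suc j) S f \<Longrightarrow> Ck_on j S f"
proof (induction j arbitrary: f)
  case 0
  then show ?case
    by (auto intro!: continuous_at_imp_continuous_on differentiable_imp_continuous_within)
next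
  case (Suc j)
  show ?case unfolding Ck_on.simps(2)[of j] using Suc.prems Suc.IH by (auto simp del: Ck_on.simps(1))
qed

text \<open>The derivative of a product again contains an undifferentiated factor, which the
  induction hypothesis wants at the lower order; \<open>Ck_on_SucD\<close> supplies it.\<close>

lemma Ck_on_bilinear:
  assumes "open S" "bounded_bilinear b" "Ck_on j S f" "Ck_on j S g"
  shows "Ck_on j S (\<lambda>x. b (f x) (g x))"
  using assms(3,4)
proof (induction j arbitrary: f g)
  case 0 then show ?case
    by (auto intro!: bounded_bilinear.continuous_on[OF assms(2)])
next
  case (Suc j)
  show ?case
  proof (rule Ck_on_SucI[OF assms(1)])
    show "((\<lambda>x. b (f x) (g x)) has_derivative (\<lambda>v. b (f x) (frechet_derivative g (at x) v) +
        b (frechet_derivative f (at x) v) (g x))) (at x)" if "x \<in> S" for x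
    proof -
      have "(f has_derivative frechet_derivative f (at x)) (at x)"
        "(g has_derivative frechet_derivative g (at x)) (at x)"
        using Suc.prems that by (simp_all add: frechet_derivative_works)
      then show ?thesis by (rule bounded_bilinear.FDERIV[OF assms(2)])
    qed
    show "Ck_on j S (\<lambda>x. b (f x) (frechet_derivative g (at x) v) +
        b (frechet_derivative f (at x) v) (g x))" for v
      by (rule Ck_on_add[OF assms(1)];
          rule Suc.IH; rule Ck_on_SucD[OF Suc.prems(1)] Ck_on_SucD[OF Suc.prems(2)]
          Suc.prems[unfolded Ck_on.simps, THEN conjunct2, THEN spec])
  qed
qed

lemma smooth_on_bilinear:
  "open S \<Longrightarrow> bounded_bilinear b \<Longrightarrow> smooth_on S f \<Longrightarrow> smooth_on S g \<Longrightarrow>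
    smooth_on S (\<lambda>x. b (f x) (g x))"
  by (auto simp: smooth_on_def intro: Ck_on_bilinear)

lemmas smooth_on_mult = smooth_on_bilinear[OF _ bounded_bilinear_mult]

lemma smooth_on_linear_comp:
  assumes "open S" "bounded_linear h" "smooth_on S f"
  shows "smooth_on S (\<lambda>x. h (f x))"
proof -
  have "Ck_on j S (\<lambda>x. h (f x))" for j
    using assms(3)
  proof (induction j arbitrary: f)
    case 0 then show ?case
      using bounded_linear.continuous_on[OF assms(2) smooth_onD(1)] by simp
  next
    case (Suc j)
    show ?case
    proof (rule Ck_on_SucI[OF assms(1)])
      show "((\<lambda>x. h (f x)) has_derivative (\<lambda>v. h (frechet_derivative f (at x) v))) (at x)"
        if "x \<in> S" for x
        using smooth_onD(2)[OF Suc.prems that] bounded_linear.has_derivative[OF assms(2)]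
        by (simp add: frechet_derivative_works)
      show "Ck_on j S (\<lambda>x. h (frechet_derivative f (at x) v))" for v
        using Suc.IH[OF smooth_onD(3)[OF Suc.prems]] .
    qed
  qed
  then show ?thesis by (simp add: smooth_on_def)
qed

text \<open>\<open>Ck_on\<close> controls derivatives of g in fixed directions only, whereas the
  chain rule produces a direction that moves with x. Expanding it in \<open>Basis\<close> gives
  products of smooth components with derivatives of g in fixed directions; this is where the
  intermediate space has to be Euclidean.\<close>

lemma smooth_on_compose:
  fixes f :: "'a::real_normed_vector \<Rightarrow> 'b::euclidean_space"
  assumes "open S" "open T" "smooth_on S f" "smooth_on T g" "f ` S \<subseteq> T"
  shows "smooth_on S (\<lambda>x. g (f x))"
proof -
  have fd: "(f has_derivative frechet_derivative f (at x)) (at x)" if "x \<in> S" for x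
    using smooth_onD(2)[OF assms(3) that] by (simp add: frechet_derivative_works)
  have "Ck_on j S (\<lambda>x. g (f x))" for j
    using assms(4)
  proof (induction j arbitrary: g)
    case 0 then show ?case
      using continuous_on_compose2[OF smooth_onD(1) smooth_onD(1)[OF assms(3)] assms(5)] by simp
  next
    case (Suc j)
    have gd: "(g has_derivative frechet_derivative g (at y)) (at y)" if "y \<in> T" for y
      using smooth_onD(2)[OF Suc.prems that] by (simp add: frechet_derivative_works)
    show ?case
    proof (rule Ck_on_SucI[OF assms(1)])
      show "((\<lambda>x. g (f x)) has_derivative (\<lambda>v. \<Sum>i\<in>Basis. (frechet_derivative f (at x) v \<bullet> i)
          *\<^sub>R frechet_derivative g (at (f x)) i)) (at x)" if "x \<in> S" for x
      proof -
        have fx: "f x \<in> T" using that assms(5) by blast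
        interpret l: bounded_linear "frechet_derivative g (at (f x))"
          using gd[OF fx] by (rule has_derivative_bounded_linear)
        have "frechet_derivative g (at (f x)) (frechet_derivative f (at x) v) =
          (\<Sum>i\<in>Basis. (frechet_derivative f (at x) v \<bullet> i) *\<^sub>R frechet_derivative g (at (f x)) i)" for v
          by (subst euclidean_representation[symmetric, of "frechet_derivative f (at x) v"])
            (simp only: l.sum l.scaleR)
        moreover have "((\<lambda>x. g (f x)) has_derivative
            (\<lambda>v. frechet_derivative g (at (f x)) (frechet_derivative f (at x) v))) (at x)"
          using has_derivative_compose[OF fd[OF that] gd[OF fx]] .
        ultimately show ?thesis by simp
      qed
      show "Ck_on j S (\<lambda>x. \<Sum>i\<in>Basis. (frechet_derivative f (at x) v \<bullet> i)
          *\<^sub>R frechet_derivative g (at (f x)) i)" for v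
      proof (rule Ck_on_sum[OF assms(1)], rule Ck_on_bilinear[OF assms(1) bounded_bilinear_scaleR])
        fix i :: 'b
        show "Ck_on j S (\<lambda>x. frechet_derivative g (at (f x)) i)"
          using Suc.IH[OF smooth_onD(3)[OF Suc.prems]] .
        show "Ck_on j S (\<lambda>x. frechet_derivative f (at x) v \<bullet> i)"
          using smooth_on_linear_comp[OF assms(1) bounded_linear_inner_left smooth_onD(3)[OF assms(3)]]
          by (auto simp: smooth_on_def)
      qed
    qed
  qed
  then show ?thesis by (simp add: smooth_on_def)
qed

section \<open>Smooth functions on spaces of coordinate tuples\<close>

text \<open>Schwarz's theorem by the double increment over a square of side r. The mean value
  theorem, applied twice in either order, writes it as r * r times one of the mixed derivatives at
  some point of the square, and continuity at the origin does the rest.\<close>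

lemma mixed_derivatives_commute:
  fixes f fs ft fst' fts :: "real \<Rightarrow> real \<Rightarrow> real"
  assumes "open W" "(0, 0) \<in> W"
    and fs: "\<And>s t. (s, t) \<in> W \<Longrightarrow> ((\<lambda>s. f s t) has_real_derivative fs s t) (at s)"
    and ft: "\<And>s t. (s, t) \<in> W \<Longrightarrow> ((\<lambda>t. f s t) has_real_derivative ft s t) (at t)"
    and fst': "\<And>s t. (s, t) \<in> W \<Longrightarrow> ((\<lambda>t. fs s t) has_real_derivative fst' s t) (at t)"
    and fts: "\<And>s t. (s, t) \<in> W \<Longrightarrow> ((\<lambda>s. ft s t) has_real_derivative fts s t) (at s)"
    and c1: "continuous_on W (\<lambda>p. fst' (fst p) (snd p))"
    and c2: "continuous_on W (\<lambda>p. fts (fst p) (snd p))"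
  shows "fst' 0 0 = fts 0 0"
proof (rule ccontr)
  assume ne: "fst' 0 0 \<noteq> fts 0 0"
  \<comment> \<open>Half the distance of the two values: the balls of this radius around them are
    disjoint.\<close>
  define e where "e = \<bar>fst' 0 0 - fts 0 0\<bar> / 2"
  have e: "e > 0" using ne by (simp add: e_def)
  define N where "N = W \<inter> (\<lambda>p. fst' (fst p) (snd p)) -` ball (fst' 0 0) e
    \<inter> (\<lambda>p. fts (fst p) (snd p)) -` ball (fts 0 0) e"
  have "open N"
    unfolding N_def using assms(1) c1 c2
    by (metis (no_types, lifting) continuous_open_preimage continuous_on_subset inf_le1 open_ball)
  moreover have "(0, 0) \<in> N" using e assms(2) by (simp add: N_def)
  ultimately obtain A B where AB: "open A" "open B" "(0, 0) \<in> A \<times> B" "A \<times> B \<subseteq> N"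
    by (auto elim!: open_prod_elim)
  have "open (A \<inter> B)" "0 \<in> A \<inter> B" using AB by auto
  then obtain r where r: "r > 0" "cball 0 r \<subseteq> A \<inter> B" by (meson open_contains_cball)
  have sub: "(s, t) \<in> N" if "0 \<le> s" "s \<le> r" "0 \<le> t" "t \<le> r" for s t
    using r AB that by (auto simp: subset_iff dist_real_def)
  have W: "(s, t) \<in> W" if "0 \<le> s" "s \<le> r" "0 \<le> t" "t \<le> r" for s t
    using sub[OF that] by (simp add: N_def)
  let ?\<Delta> = "f r r - f r 0 - (f 0 r - f 0 0)"
  have "\<exists>z. 0 < z \<and> z < r \<and> (f r r - f r 0) - (f 0 r - f 0 0) = (r - 0) * (fs z r - fs z 0)"
    by (rule MVT2) (use r W in \<open>auto intro!: derivative_intros fs\<close>)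
  then obtain z where z: "0 < z" "z < r" "?\<Delta> = r * (fs z r - fs z 0)" by auto
  have "\<exists>y. 0 < y \<and> y < r \<and> fs z r - fs z 0 = (r - 0) * fst' z y"
    by (rule MVT2) (use r z W in \<open>auto intro!: fst'\<close>)
  then obtain y where y: "0 < y" "y < r" "?\<Delta> = r * (r * fst' z y)" using z by auto
  have "\<exists>z. 0 < z \<and> z < r \<and> (f r r - f 0 r) - (f r 0 - f 0 0) = (r - 0) * (ft r z - ft 0 z)"
    by (rule MVT2) (use r W in \<open>auto intro!: derivative_intros ft\<close>)
  then obtain z' where z': "0 < z'" "z' < r" "?\<Delta> = r * (ft r z' - ft 0 z')" by auto
  have "\<exists>y. 0 < y \<and> y < r \<and> ft r z' - ft 0 z' = (r - 0) * fts y z'"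
    by (rule MVT2) (use r z' W in \<open>auto intro!: fts\<close>)
  then obtain y' where y': "0 < y'" "y' < r" "?\<Delta> = r * (r * fts y' z')" using z' by auto
  have "fst' z y = fts y' z'" using y(3) y'(3) r by simp
  moreover have "\<bar>fst' z y - fst' 0 0\<bar> < e" "\<bar>fts y' z' - fts 0 0\<bar> < e"
    using sub[of z y] sub[of y' z'] z y z' y' by (auto simp: N_def dist_real_def abs_minus_commute)
  ultimately show False unfolding e_def by argo
qed

section \<open>Finite-dimensional spaces of coordinate tuples\<close>

definition coord_space :: "('i \<Rightarrow> real) set \<Rightarrow> bool" where
  "coord_space V \<longleftrightarrow> (\<lambda>_. 0) \<in> V \<and>
     (\<forall>u\<in>V. \<forall>v\<in>V. \<forall>s t. (\<lambda>\<iota>. s * u \<iota> + t * v \<iota>) \<in> V) \<and>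
     (\<exists>J. finite J \<and> (\<forall>v\<in>V. \<forall>\<iota>. \<iota> \<notin> J \<longrightarrow> v \<iota> = 0))"

text \<open>Openness is relative to V because the admissible tuples satisfy linear constraints such
  as symmetry; neighbourhoods are only tested in directions of V.\<close>

definition rel_open :: "('i \<Rightarrow> real) set \<Rightarrow> ('i \<Rightarrow> real) set \<Rightarrow> bool" where
  "rel_open V S \<longleftrightarrow> (\<exists>U. open U \<and> S = V \<inter> U)"

lemma rel_open_subset: "rel_open V S \<Longrightarrow> S \<subseteq> V"
  by (auto simp: rel_open_def)

lemma coord_space_zero: "coord_space V \<Longrightarrow> (\<lambda>_. 0) \<in> V"
  by (simp add: coord_space_def)

lemma coord_space_lin:
  "coord_space V \<Longrightarrow> u \<in> V \<Longrightarrow> v \<in> V \<Longrightarrow> (\<lambda>\<iota>. s * u \<iota> + t * v \<iota>) \<in> V"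
  by (simp add: coord_space_def)

lemma coord_space_line:
  "coord_space V \<Longrightarrow> u \<in> V \<Longrightarrow> v \<in> V \<Longrightarrow> (\<lambda>\<iota>. u \<iota> + t * v \<iota>) \<in> V"
  using coord_space_lin[of V u v 1 t] by simp

lemma coord_space_sum:
  assumes "coord_space V" "\<And>b. b \<in> B \<Longrightarrow> u b \<in> V"
  shows "(\<lambda>\<iota>. \<Sum>b\<in>B. c b * u b \<iota>) \<in> V"
  using assms(2)
proof (induction B rule: infinite_finite_induct)
  case (insert x F)
  then show ?case using coord_space_lin[OF assms(1), of "u x" _ "c x" 1] by simp
qed (simp_all add: coord_space_zero[OF assms(1)])

text \<open>Gaussian elimination: a vector w with w i = 1 splits every v into (v i) times w and a
  remainder vanishing at i. The coefficients come out as fixed linear functions of finitely many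
  coordinates of v, so that the coefficients of a differentiable family are differentiable. The
  index set K stays the same while J shrinks in the induction.\<close>

lemma coord_space_basis_aux:
  fixes V :: "('i \<Rightarrow> real) set"
  assumes "finite K" "finite J" "J \<subseteq> K" "(\<lambda>_. 0) \<in> V"
    and "\<And>u v s t. u \<in> V \<Longrightarrow> v \<in> V \<Longrightarrow> (\<lambda>\<iota>. s * u \<iota> + t * v \<iota>) \<in> V"
    and "\<And>v \<iota>. v \<in> V \<Longrightarrow> \<iota> \<notin> J \<Longrightarrow> v \<iota> = 0"
  shows "\<exists>B a. finite B \<and> B \<subseteq> V \<and> (\<forall>v\<in>V. \<forall>\<iota>. v \<iota> = (\<Sum>b\<in>B. (\<Sum>j\<in>K. a b j * v j) * b \<iota>))"
  using assms(2-6)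
proof (induction J arbitrary: V rule: finite_induct)
  case empty
  then show ?case by (intro exI[of _ "{}"]) auto
next
  case (insert i J)
  show ?case
  proof (cases "\<exists>w\<in>V. w i \<noteq> 0")
    case False
    show ?thesis
    proof (rule insert.IH)
      show "v \<iota> = 0" if "v \<in> V" "\<iota> \<notin> J" for v \<iota>
        using insert.prems(4)[of v \<iota>] False that by (cases "\<iota> = i") auto
    qed (use insert.prems(1-3) in auto)
  next
    case True
    then obtain w0 where w0: "w0 \<in> V" "w0 i \<noteq> 0" by blast
    define w where "w = (\<lambda>\<iota>. (1 / w0 i) * w0 \<iota> + 0 * w0 \<iota>)"
    have w: "w \<in> V" "w i = 1" using insert.prems(3)[OF w0(1) w0(1), of "1 / w0 i" 0] w0(2) by (simp_all add: w_def)
    define V' where "V' = {v \<in> V. v i = 0}"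
    have "\<exists>B a. finite B \<and> B \<subseteq> V' \<and> (\<forall>v\<in>V'. \<forall>\<iota>. v \<iota> = (\<Sum>b\<in>B. (\<Sum>j\<in>K. a b j * v j) * b \<iota>))"
    proof (rule insert.IH)
      show "v \<iota> = 0" if "v \<in> V'" "\<iota> \<notin> J" for v \<iota>
        using insert.prems(4)[of v \<iota>] that by (auto simp: V'_def)
    qed (use insert.prems(1-3) in \<open>auto simp: V'_def\<close>)
    then obtain B a where B: "finite B" "B \<subseteq> V'"
      and rep: "\<And>v \<iota>. v \<in> V' \<Longrightarrow> v \<iota> = (\<Sum>b\<in>B. (\<Sum>j\<in>K. a b j * v j) * b \<iota>)" by blast
    have wB: "w \<notin> B" using B w by (auto simp: V'_def)
    \<comment> \<open>The coefficient of w is v i. The other coefficients are the old ones evaluated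
      on v - (v i) w, which is absorbed into the entry at j = i.\<close>
    define a' where "a' = (\<lambda>b j. if b = w then of_bool (j = i)
      else a b j - (\<Sum>k\<in>K. a b k * w k) * of_bool (j = i))"
    have iK: "i \<in> K" using insert.prems by auto
    have "v \<iota> = (\<Sum>b\<in>insert w B. (\<Sum>j\<in>K. a' b j * v j) * b \<iota>)" if v: "v \<in> V" for v \<iota>
    proof -
      have ind: "(\<Sum>j\<in>K. c * of_bool (j = i) * v j) = c * v i" for c :: real
        using sum.delta[OF assms(1), of i "\<lambda>j. c * v j"] iK
        by (simp add: of_bool_def if_distrib if_distribR cong: if_cong)
      have "(\<lambda>\<iota>. 1 * v \<iota> + (- v i) * w \<iota>) \<in> V'"
        using insert.prems(3)[OF v w(1), of 1 "- v i"] w(2) by (simp add: V'_def)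
      from rep[OF this, of \<iota>]
      have "v \<iota> - v i * w \<iota> = (\<Sum>b\<in>B. (\<Sum>j\<in>K. a b j * (v j - v i * w j)) * b \<iota>)" by simp
      also have "\<dots> = (\<Sum>b\<in>B. (\<Sum>j\<in>K. a' b j * v j) * b \<iota>)"
      proof (rule sum.cong[OF refl])
        fix b assume "b \<in> B"
        then have "b \<noteq> w" using wB by auto
        then have "(\<Sum>j\<in>K. a' b j * v j) =
            (\<Sum>j\<in>K. a b j * v j) - (\<Sum>j\<in>K. (\<Sum>k\<in>K. a b k * w k) * of_bool (j = i) * v j)"
          by (simp add: a'_def left_diff_distrib sum_subtractf)
        also have "\<dots> = (\<Sum>j\<in>K. a b j * (v j - v i * w j))"
          unfolding ind by (simp add: right_diff_distrib sum_subtractf sum_distrib_right sum_distrib_left mult_ac)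
        finally show "(\<Sum>j\<in>K. a b j * (v j - v i * w j)) * b \<iota> = (\<Sum>j\<in>K. a' b j * v j) * b \<iota>"
          by simp
      qed
      finally show ?thesis
        using B(1) wB ind[of 1] by (simp add: a'_def)
    qed
    then show ?thesis
      using B w(1) by (intro exI[of _ "insert w B"] exI[of _ a']) (auto simp: V'_def)
  qed
qed

lemma coord_space_basis:
  assumes "coord_space V"
  obtains B a K where "finite B" "B \<subseteq> V" "finite K"
    "\<And>v \<iota>. v \<in> V \<Longrightarrow> v \<iota> = (\<Sum>b\<in>B. (\<Sum>j\<in>K. a b j * v j) * b \<iota>)"
proof -
  obtain J where J: "finite J" "\<And>v \<iota>. v \<in> V \<Longrightarrow> \<iota> \<notin> J \<Longrightarrow> v \<iota> = 0"
    using assms unfolding coord_space_def by blast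
  have "\<exists>B a. finite B \<and> B \<subseteq> V \<and> (\<forall>v\<in>V. \<forall>\<iota>. v \<iota> = (\<Sum>b\<in>B. (\<Sum>j\<in>J. a b j * v j) * b \<iota>))"
    by (rule coord_space_basis_aux[OF J(1) J(1) subset_refl coord_space_zero[OF assms]])
      (fact coord_space_lin[OF assms] J(2))+
  then obtain B a where "finite B" "B \<subseteq> V"
    "\<forall>v\<in>V. \<forall>\<iota>. v \<iota> = (\<Sum>b\<in>B. (\<Sum>j\<in>J. a b j * v j) * b \<iota>)" by blast
  with J(1) show ?thesis by (intro that[of B J a]) blast+
qed

lemma tendsto_coordinatewise:
  fixes f :: "'a \<Rightarrow> 'i \<Rightarrow> real"
  assumes "\<And>\<iota>. ((\<lambda>x. f x \<iota>) \<longlongrightarrow> l \<iota>) F"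
  shows "(f \<longlongrightarrow> l) F"
proof -
  have "limitin (product_topology (\<lambda>_. euclidean) UNIV) f l F"
    unfolding limitin_componentwise using assms by auto
  then show ?thesis by (simp add: euclidean_product_topology)
qed

text \<open>Otherwise coefficients bounded by 1/(n+1) would lead out of S for every n. The resulting
  points of V converge to \<xi> in each coordinate, hence in the product topology, so they
  eventually lie in the open set that cuts out S.\<close>

lemma rel_open_box:
  assumes V: "coord_space V" and S: "rel_open V S" "\<xi> \<in> S" and B: "finite B" "B \<subseteq> V"
  obtains r where "r > 0"
    "\<And>c. (\<And>b. b \<in> B \<Longrightarrow> \<bar>c b\<bar> \<le> r) \<Longrightarrow> (\<lambda>\<iota>. \<xi> \<iota> + (\<Sum>b\<in>B. c b * b \<iota>)) \<in> S"
proof -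
  obtain U where U: "open U" "S = V \<inter> U" using S(1) by (auto simp: rel_open_def)
  have "\<exists>n. \<forall>c. (\<forall>b\<in>B. \<bar>c b\<bar> \<le> inverse (real (Suc n))) \<longrightarrow> (\<lambda>\<iota>. \<xi> \<iota> + (\<Sum>b\<in>B. c b * b \<iota>)) \<in> S"
  proof (rule ccontr)
    assume "\<not> ?thesis"
    then have "\<forall>n. \<exists>c. (\<forall>b\<in>B. \<bar>c b\<bar> \<le> inverse (real (Suc n))) \<and> (\<lambda>\<iota>. \<xi> \<iota> + (\<Sum>b\<in>B. c b * b \<iota>)) \<notin> S"
      by blast
    from choice[OF this] obtain c where c: "\<And>n b. b \<in> B \<Longrightarrow> \<bar>c n b\<bar> \<le> inverse (real (Suc n))"
      and nS: "\<And>n. (\<lambda>\<iota>. \<xi> \<iota> + (\<Sum>b\<in>B. c n b * b \<iota>)) \<notin> S" by blast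
    have c0: "(\<lambda>n. c n b) \<longlonglongrightarrow> 0" if "b \<in> B" for b
      by (rule Lim_null_comparison[OF _ LIMSEQ_inverse_real_of_nat]) (use c[OF that] in auto)
    have "(\<lambda>n. \<xi> \<iota> + (\<Sum>b\<in>B. c n b * b \<iota>)) \<longlonglongrightarrow> \<xi> \<iota> + (\<Sum>b\<in>B. 0 * b \<iota>)" for \<iota>
      by (intro tendsto_intros c0)
    then have "(\<lambda>n. (\<lambda>\<iota>. \<xi> \<iota> + (\<Sum>b\<in>B. c n b * b \<iota>))) \<longlonglongrightarrow> \<xi>"
      by (intro tendsto_coordinatewise) simp
    then have "eventually (\<lambda>n. (\<lambda>\<iota>. \<xi> \<iota> + (\<Sum>b\<in>B. c n b * b \<iota>)) \<in> U) sequentially"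
      by (rule topological_tendstoD) (use U S in auto)
    then obtain n where "(\<lambda>\<iota>. \<xi> \<iota> + (\<Sum>b\<in>B. c n b * b \<iota>)) \<in> U"
      by (auto simp: eventually_sequentially)
    moreover have "(\<lambda>\<iota>. \<xi> \<iota> + (\<Sum>b\<in>B. c n b * b \<iota>)) \<in> V"
      using coord_space_line[OF V _ coord_space_sum[OF V], of \<xi> B "\<lambda>b. b" 1 "c n"] B S U by auto
    ultimately show False using nS U by blast
  qed
  then obtain n where "\<forall>c. (\<forall>b\<in>B. \<bar>c b\<bar> \<le> inverse (real (Suc n))) \<longrightarrow> (\<lambda>\<iota>. \<xi> \<iota> + (\<Sum>b\<in>B. c b * b \<iota>)) \<in> S" ..
  then show ?thesis by (intro that[of "inverse (real (Suc n))"]) auto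
qed

lemma rel_open_sublevel:
  assumes "rel_open V S" "continuous_on S (g :: _ \<Rightarrow> real)"
  shows "rel_open V {\<eta> \<in> S. \<bar>g \<eta> - z\<bar> < e}"
proof -
  obtain U where U: "open U" "S = V \<inter> U" using assms(1) by (auto simp: rel_open_def)
  have "openin (top_of_set S) (S \<inter> g -` ball z e)"
    by (rule continuous_openin_preimage_gen[OF assms(2) open_ball])
  then obtain P where "open P" "S \<inter> g -` ball z e = S \<inter> P" by (auto simp: openin_open)
  moreover have "{\<eta> \<in> S. \<bar>g \<eta> - z\<bar> < e} = S \<inter> g -` ball z e"
    by (auto simp: dist_real_def abs_minus_commute)
  ultimately show ?thesis using U unfolding rel_open_def by (intro exI[of _ "U \<inter> P"]) auto
qed

lemma rel_open_Int: "rel_open V S \<Longrightarrow> rel_open V T \<Longrightarrow> rel_open V (S \<inter> T)"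
  unfolding rel_open_def by (elim exE conjE, rule_tac x = "U \<inter> Ua" in exI) auto

lemma rel_open_INT:
  assumes "finite B" "rel_open V S" "\<And>b. b \<in> B \<Longrightarrow> rel_open V (T b)"
  shows "rel_open V (S \<inter> (\<Inter>b\<in>B. T b))"
  using assms(1,3)
proof (induction B rule: finite_induct)
  case empty then show ?case using assms(2) by simp
next
  case (insert b B)
  have "S \<inter> (\<Inter>b\<in>insert b B. T b) = (S \<inter> (\<Inter>b\<in>B. T b)) \<inter> T b" by auto
  then show ?case using insert by (auto intro: rel_open_Int)
qed

lemma rel_open_line:
  assumes V: "coord_space V" and S: "rel_open V S" "\<xi> \<in> S" and v: "v \<in> V"
  shows "\<forall>\<^sub>F t in nhds 0. (\<lambda>\<iota>. \<xi> \<iota> + t * v \<iota>) \<in> S"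
proof -
  obtain r where "r > 0" and r: "\<And>c. (\<And>b. b \<in> {v} \<Longrightarrow> \<bar>c b\<bar> \<le> r) \<Longrightarrow>
      (\<lambda>\<iota>. \<xi> \<iota> + (\<Sum>b\<in>{v}. c b * b \<iota>)) \<in> S"
    using rel_open_box[OF V S, of "{v}"] v by auto
  have "\<forall>\<^sub>F t in nhds 0. \<bar>t\<bar> < r"
    using \<open>r > 0\<close> by (auto simp: eventually_nhds_metric dist_real_def)
  then show ?thesis
    by eventually_elim (use r[of "\<lambda>_. _"] in auto)
qed

section \<open>Directional derivatives: total differentiability, chain rule and symmetry\<close>

lemma smooth_coordsD:
  assumes "smooth_coords V S G"
  shows "continuous_on S G"
    and "v \<in> V \<Longrightarrow> \<xi> \<in> S \<Longrightarrow> ((\<lambda>t. G (\<lambda>\<iota>. \<xi> \<iota> + t * v \<iota>)) has_real_derivative dir_deriv v G \<xi>) (at 0)"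
    and "v \<in> V \<Longrightarrow> smooth_coords V S (dir_deriv v G)"
proof -
  have j: "Ck_coords j V S G" for j using assms by (simp add: smooth_coords_def)
  show "continuous_on S G" using j[of 0] by simp
  show "((\<lambda>t. G (\<lambda>\<iota>. \<xi> \<iota> + t * v \<iota>)) has_real_derivative dir_deriv v G \<xi>) (at 0)"
    if "v \<in> V" "\<xi> \<in> S"
    using j[of "Suc 0"] that unfolding dir_deriv_def
    by (auto simp: DERIV_deriv_iff_real_differentiable)
  show "smooth_coords V S (dir_deriv v G)" if "v \<in> V"
    unfolding smooth_coords_def using j[of "Suc _"] that by simp
qed

lemma smooth_coords_line:
  assumes "smooth_coords V S G" "v \<in> V" "(\<lambda>\<iota>. \<xi> \<iota> + t * v \<iota>) \<in> S"
  shows "((\<lambda>t. G (\<lambda>\<iota>. \<xi> \<iota> + t * v \<iota>)) has_real_derivative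
    dir_deriv v G (\<lambda>\<iota>. \<xi> \<iota> + t * v \<iota>)) (at t)"
proof -
  have "((\<lambda>s. G (\<lambda>\<iota>. \<xi> \<iota> + (s + t) * v \<iota>)) has_real_derivative
      dir_deriv v G (\<lambda>\<iota>. \<xi> \<iota> + t * v \<iota>)) (at 0)"
    using smooth_coordsD(2)[OF assms] by (simp add: algebra_simps)
  then show ?thesis
    using DERIV_shift[of "\<lambda>t. G (\<lambda>\<iota>. \<xi> \<iota> + t * v \<iota>)" _ 0 t] by simp
qed

text \<open>The classical argument that continuous partial derivatives give a total derivative. The
  vectors of B are switched on one at a time, so each increment runs along a single direction, and
  on N the derivative in that direction differs by less than e from its value at \<xi>.\<close>

lemma smooth_coords_box_estimate:
  assumes V: "coord_space V" and S: "rel_open V S" "\<xi> \<in> S" and G: "smooth_coords V S G"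
    and B: "finite B" "B \<subseteq> V" and e: "e > 0"
  obtains r where "r > 0" "\<And>c. (\<And>b. b \<in> B \<Longrightarrow> \<bar>c b\<bar> \<le> r) \<Longrightarrow>
     \<bar>G (\<lambda>\<iota>. \<xi> \<iota> + (\<Sum>b\<in>B. c b * b \<iota>)) - G \<xi> - (\<Sum>b\<in>B. c b * dir_deriv b G \<xi>)\<bar> \<le> e * (\<Sum>b\<in>B. \<bar>c b\<bar>)"
proof -
  define N where "N = S \<inter> (\<Inter>b\<in>B. {\<eta> \<in> S. \<bar>dir_deriv b G \<eta> - dir_deriv b G \<xi>\<bar> < e})"
  have N: "rel_open V N"
    unfolding N_def
    by (intro rel_open_INT B S rel_open_sublevel smooth_coordsD(1)[OF smooth_coordsD(3)[OF G]])
      (use B in auto)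
  have "\<xi> \<in> N" using S e by (auto simp: N_def)
  from rel_open_box[OF V N this B] obtain r where r: "r > 0" "\<And>c. (\<And>b. b \<in> B \<Longrightarrow> \<bar>c b\<bar> \<le> r) \<Longrightarrow>
      (\<lambda>\<iota>. \<xi> \<iota> + (\<Sum>b\<in>B. c b * b \<iota>)) \<in> N"
    by blast
  have "\<bar>G (\<lambda>\<iota>. \<xi> \<iota> + (\<Sum>b\<in>A. c b * b \<iota>)) - G \<xi> - (\<Sum>b\<in>A. c b * dir_deriv b G \<xi>)\<bar>
      \<le> e * (\<Sum>b\<in>A. \<bar>c b\<bar>)" if "A \<subseteq> B" "\<And>b. b \<in> B \<Longrightarrow> \<bar>c b\<bar> \<le> r" for A c
    using finite_subset[OF that(1) B(1)] that
  proof (induction A rule: finite_induct)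
    case (insert a A)
    define \<eta> where "\<eta> = (\<lambda>\<iota>. \<xi> \<iota> + (\<Sum>b\<in>A. c b * b \<iota>))"
    define D where "D = dir_deriv a G \<xi>"
    let ?I = "{- \<bar>c a\<bar>..\<bar>c a\<bar>}"
    have a: "a \<in> V" "a \<in> B" using insert.prems B by auto
    have N: "(\<lambda>\<iota>. \<eta> \<iota> + s * a \<iota>) \<in> N" if "s \<in> ?I" for s
    proof -
      have "(\<Sum>b\<in>B. (if b = a then s else if b \<in> A then c b else 0) * b \<iota>) =
          s * a \<iota> + (\<Sum>b\<in>A. c b * b \<iota>)" for \<iota>
      proof -
        have "(\<Sum>b\<in>B. (if b = a then s else if b \<in> A then c b else 0) * b \<iota>)
            = (\<Sum>b\<in>insert a A. (if b = a then s else if b \<in> A then c b else 0) * b \<iota>)"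
          by (rule sum.mono_neutral_right) (use insert.prems B in auto)
        also have "\<dots> = s * a \<iota> + (\<Sum>b\<in>A. (if b = a then s else if b \<in> A then c b else 0) * b \<iota>)"
          using insert.hyps by simp
        also have "(\<Sum>b\<in>A. (if b = a then s else if b \<in> A then c b else 0) * b \<iota>) = (\<Sum>b\<in>A. c b * b \<iota>)"
          by (rule sum.cong) (use insert.hyps in auto)
        finally show ?thesis .
      qed
      moreover have "\<bar>if b = a then s else if b \<in> A then c b else 0\<bar> \<le> r" if "b \<in> B" for b
        using insert.prems(2)[of a] insert.prems(2)[OF that] \<open>s \<in> ?I\<close> r(1) a by auto
      ultimately show ?thesis
        using r(2)[of "\<lambda>b. if b = a then s else if b \<in> A then c b else 0"]
        by (simp add: \<eta>_def algebra_simps)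
    qed
    \<comment> \<open>After subtraction of s * D the function of s has derivative at most e in
      absolute value on the whole segment, so the mean value inequality applies.\<close>
    have "norm ((G (\<lambda>\<iota>. \<eta> \<iota> + c a * a \<iota>) - c a * D) - (G (\<lambda>\<iota>. \<eta> \<iota> + 0 * a \<iota>) - 0 * D))
        \<le> e * norm (c a - 0)"
    proof (rule field_differentiable_bound[where S = ?I and
          f' = "\<lambda>s. dir_deriv a G (\<lambda>\<iota>. \<eta> \<iota> + s * a \<iota>) - D"])
      fix s assume s: "s \<in> ?I"
      have "(\<lambda>\<iota>. \<eta> \<iota> + s * a \<iota>) \<in> S" using N[OF s] by (simp add: N_def)
      then show "((\<lambda>s. G (\<lambda>\<iota>. \<eta> \<iota> + s * a \<iota>) - s * D) has_field_derivative
          dir_deriv a G (\<lambda>\<iota>. \<eta> \<iota> + s * a \<iota>) - D) (at s within ?I)"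
        by (auto intro!: derivative_eq_intros DERIV_subset[OF smooth_coords_line[OF G a(1)]])
      show "norm (dir_deriv a G (\<lambda>\<iota>. \<eta> \<iota> + s * a \<iota>) - D) \<le> e"
        using N[OF s] a by (auto simp: N_def D_def)
    qed auto
    moreover have "\<bar>G \<eta> - G \<xi> - (\<Sum>b\<in>A. c b * dir_deriv b G \<xi>)\<bar> \<le> e * (\<Sum>b\<in>A. \<bar>c b\<bar>)"
      unfolding \<eta>_def using insert by auto
    moreover have "(\<lambda>\<iota>. \<xi> \<iota> + (\<Sum>b\<in>insert a A. c b * b \<iota>)) = (\<lambda>\<iota>. \<eta> \<iota> + c a * a \<iota>)"
      using insert.hyps by (auto simp: \<eta>_def)
    ultimately show ?case
      using insert.hyps by (simp add: D_def algebra_simps)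
  qed simp
  from this[OF subset_refl] r(1) show ?thesis by (intro that) auto
qed

lemma has_derivative_locally_Lipschitz:
  assumes "(f has_derivative f') (at x)"
  obtains K where "K > 0" "\<forall>\<^sub>F y in at x. norm (f y - f x) \<le> K * norm (y - x)"
proof -
  have bl: "bounded_linear f'" and
    ev: "\<forall>\<^sub>F y in at x. norm (f y - f x - f' (y - x)) \<le> 1 * norm (y - x)"
    using assms zero_less_one unfolding has_derivative_within_alt2 by blast+
  obtain K where K: "K > 0" "\<And>h. norm (f' h) \<le> norm h * K"
    using bounded_linear.pos_bounded[OF bl] by blast
  have "\<forall>\<^sub>F y in at x. norm (f y - f x) \<le> (K + 1) * norm (y - x)"
    using ev
  proof eventually_elim
    case (elim y)
    have "norm (f y - f x) \<le> norm (f y - f x - f' (y - x)) + norm (f' (y - x))"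
      by (metis diff_add_cancel norm_triangle_ineq)
    also have "\<dots> \<le> (K + 1) * norm (y - x)"
      using elim K(2)[of "y - x"] by (simp add: algebra_simps)
    finally show ?case .
  qed
  then show ?thesis using K by (intro that[of "K + 1"]) auto
qed

lemma has_derivative_transform_nhds:
  assumes "(f has_derivative f') (at x)" "\<forall>\<^sub>F y in nhds x. f y = g y"
  shows "(g has_derivative f') (at x)"
proof -
  have "\<forall>\<^sub>F y in at x. f y = g y"
    using assms(2) by (simp add: eventually_at_filter eventually_mono)
  then show ?thesis
    using has_derivative_transform_eventually[OF assms(1), of g] eventually_nhds_x_imp_x[OF assms(2)]
    by simp
qed

text \<open>The increment of \<Xi> is written in the finite family B. Its coefficients
  \<open>c b\<close> are differentiable real functions, being finite linear combinations of the
  coordinates of \<Xi>; they are O(|y - y0|), so the box estimate makes the remainder of G o(|y -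
  y0|).\<close>

lemma smooth_coords_chain_basis:
  fixes \<Xi> :: "'a::real_normed_vector \<Rightarrow> 'i \<Rightarrow> real"
  assumes V: "coord_space V" and S: "rel_open V S" and G: "smooth_coords V S G"
    and B: "finite B" "B \<subseteq> V"
      "\<And>v \<iota>. v \<in> V \<Longrightarrow> v \<iota> = (\<Sum>b\<in>B. (\<Sum>j\<in>K. a b j * v j) * b \<iota>)"
    and y: "\<forall>\<^sub>F y in nhds y0. \<Xi> y \<in> S"
    and d: "\<And>\<iota>. ((\<lambda>y. \<Xi> y \<iota>) has_derivative \<Xi>' \<iota>) (at y0)"
  shows "((\<lambda>y. G (\<Xi> y)) has_derivative
    (\<lambda>h. \<Sum>b\<in>B. (\<Sum>j\<in>K. a b j * \<Xi>' j h) * dir_deriv b G (\<Xi> y0))) (at y0)"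
proof -
  define c where "c = (\<lambda>b y. \<Sum>j\<in>K. a b j * (\<Xi> y j - \<Xi> y0 j))"
  define c' where "c' = (\<lambda>b h. \<Sum>j\<in>K. a b j * \<Xi>' j h)"
  define D where "D = (\<lambda>b. dir_deriv b G (\<Xi> y0))"
  have cd: "(c b has_derivative c' b) (at y0)" for b
    unfolding c_def c'_def by (auto intro!: derivative_eq_intros d)
  have c0: "c b y0 = 0" for b by (simp add: c_def)
  have y0: "\<Xi> y0 \<in> S" using eventually_nhds_x_imp_x[OF y] .
  have rep: "G (\<Xi> y) = G (\<lambda>\<iota>. \<Xi> y0 \<iota> + (\<Sum>b\<in>B. c b y * b \<iota>))" if "\<Xi> y \<in> S" for y
  proof -
    have "(\<lambda>\<iota>. 1 * \<Xi> y \<iota> + (-1) * \<Xi> y0 \<iota>) \<in> V"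
      using that y0 rel_open_subset[OF S] by (intro coord_space_lin[OF V]) auto
    note * = B(3)[OF this]
    have "\<Xi> y \<iota> = \<Xi> y0 \<iota> + (\<Sum>b\<in>B. c b y * b \<iota>)" for \<iota>
      using *[of \<iota>] by (simp add: c_def)
    then show ?thesis by presburger
  qed
  have "\<forall>b. \<exists>L. L > 0 \<and> (\<forall>\<^sub>F y in at y0. norm (c b y - c b y0) \<le> L * norm (y - y0))"
  proof
    fix b
    from has_derivative_locally_Lipschitz[OF cd[of b]] obtain L
      where "L > 0" "\<forall>\<^sub>F y in at y0. norm (c b y - c b y0) \<le> L * norm (y - y0)" .
    then show "\<exists>L. L > 0 \<and> (\<forall>\<^sub>F y in at y0. norm (c b y - c b y0) \<le> L * norm (y - y0))" by blast
  qed
  from choice[OF this] obtain L where L: "\<And>b. L b > 0" "\<And>b. \<forall>\<^sub>F y in at y0. norm (c b y - c b y0) \<le> L b * norm (y - y0)"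
    by blast
  let ?L = "\<Sum>b\<in>B. L b"
  have L0: "?L \<ge> 0" using L(1) by (simp add: sum_nonneg less_imp_le)
  have "\<forall>\<^sub>F y in at y0. \<forall>b\<in>B. norm (c b y - c b y0) \<le> L b * norm (y - y0)"
    using L(2) by (intro eventually_ball_finite B(1)) auto
  then have Lip: "\<forall>\<^sub>F y in at y0. (\<Sum>b\<in>B. \<bar>c b y\<bar>) \<le> ?L * norm (y - y0)"
    by eventually_elim (auto simp: c0 sum_distrib_right intro: sum_mono)
  have R: "((\<lambda>y. G (\<Xi> y) - G (\<Xi> y0) - (\<Sum>b\<in>B. c b y * D b)) has_derivative (\<lambda>_. 0)) (at y0)"
    unfolding has_derivative_within_alt2
  proof (intro conjI allI impI)
    fix e :: real assume "e > 0"
    \<comment> \<open>The coefficients sum up to at most ?L times the distance. Dividing by ?L + 1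
      instead of ?L keeps the quotient defined when ?L is zero.\<close>
    then have "e / (?L + 1) > 0" using L0 by simp
    from smooth_coords_box_estimate[OF V S y0 G B(1,2) this] obtain r
      where r: "r > 0" "\<And>c. (\<And>b. b \<in> B \<Longrightarrow> \<bar>c b\<bar> \<le> r) \<Longrightarrow>
        \<bar>G (\<lambda>\<iota>. \<Xi> y0 \<iota> + (\<Sum>b\<in>B. c b * b \<iota>)) - G (\<Xi> y0) - (\<Sum>b\<in>B. c b * D b)\<bar>
        \<le> e / (?L + 1) * (\<Sum>b\<in>B. \<bar>c b\<bar>)" unfolding D_def by blast
    have "(c b \<longlongrightarrow> 0) (at y0)" for b
      using has_derivative_continuous[OF cd, of b] by (simp add: continuous_within c0)
    then have "\<forall>\<^sub>F y in at y0. \<bar>c b y\<bar> < r" for b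
      using r(1) by (auto simp: tendsto_iff)
    then have "\<forall>\<^sub>F y in at y0. \<forall>b\<in>B. \<bar>c b y\<bar> < r"
      by (intro eventually_ball_finite B(1)) auto
    moreover have "\<forall>\<^sub>F y in at y0. \<Xi> y \<in> S"
      using y by (simp add: eventually_at_filter eventually_mono)
    ultimately show "\<forall>\<^sub>F y in at y0. norm (G (\<Xi> y) - G (\<Xi> y0) - (\<Sum>b\<in>B. c b y * D b) -
        (G (\<Xi> y0) - G (\<Xi> y0) - (\<Sum>b\<in>B. c b y0 * D b)) - 0) \<le> e * norm (y - y0)"
      using Lip
    proof eventually_elim
      case (elim y)
      have "\<bar>G (\<Xi> y) - G (\<Xi> y0) - (\<Sum>b\<in>B. c b y * D b)\<bar> \<le> e / (?L + 1) * (\<Sum>b\<in>B. \<bar>c b y\<bar>)"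
        unfolding rep[OF elim(2)] by (rule r(2)) (use elim(1) less_imp_le in blast)
      also have "\<dots> \<le> e / (?L + 1) * (?L * norm (y - y0))"
        using elim(3) \<open>e / (?L + 1) > 0\<close> by (intro mult_left_mono) auto
      also have "\<dots> = (?L / (?L + 1)) * (e * norm (y - y0))" by simp
      also have "\<dots> \<le> 1 * (e * norm (y - y0))"
        using L0 \<open>e > 0\<close> by (intro mult_right_mono) auto
      finally show ?case by (simp add: c0)
    qed
  qed simp
  have "((\<lambda>y. G (\<Xi> y0) + (\<Sum>b\<in>B. c b y * D b)) has_derivative (\<lambda>h. \<Sum>b\<in>B. c' b h * D b)) (at y0)"
    by (auto intro!: derivative_eq_intros cd)
  from has_derivative_add[OF R this] show ?thesis
    by (simp add: c'_def D_def)
qed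

text \<open>Linearity in the direction is not built into \<open>smooth_coords\<close>, which treats
  each direction separately. It results from the chain rule along the line through \<xi> with
  direction v, compared with the definition of \<open>dir_deriv\<close>.\<close>

lemma dir_deriv_basis:
  assumes V: "coord_space V" and S: "rel_open V S" and G: "smooth_coords V S G"
    and B: "finite B" "B \<subseteq> V"
      "\<And>v \<iota>. v \<in> V \<Longrightarrow> v \<iota> = (\<Sum>b\<in>B. (\<Sum>j\<in>K. a b j * v j) * b \<iota>)"
    and v: "v \<in> V" "\<xi> \<in> S"
  shows "dir_deriv v G \<xi> = (\<Sum>b\<in>B. (\<Sum>j\<in>K. a b j * v j) * dir_deriv b G \<xi>)"
proof -
  have "((\<lambda>t. G (\<lambda>\<iota>. \<xi> \<iota> + t * v \<iota>)) has_derivative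
      (\<lambda>h. \<Sum>b\<in>B. (\<Sum>j\<in>K. a b j * (h * v j)) * dir_deriv b G (\<lambda>\<iota>. \<xi> \<iota> + 0 * v \<iota>))) (at (0::real))"
    by (rule smooth_coords_chain_basis[OF V S G B rel_open_line[OF V S v(2,1)]])
      (auto intro!: derivative_eq_intros)
  moreover have "(\<lambda>h::real. \<Sum>b\<in>B. (\<Sum>j\<in>K. a b j * (h * v j)) * dir_deriv b G (\<lambda>\<iota>. \<xi> \<iota> + 0 * v \<iota>))
    = (*) (\<Sum>b\<in>B. (\<Sum>j\<in>K. a b j * v j) * dir_deriv b G \<xi>)"
    by (auto simp: sum_distrib_left sum_distrib_right mult_ac)
  ultimately have "((\<lambda>t. G (\<lambda>\<iota>. \<xi> \<iota> + t * v \<iota>)) has_real_derivative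
      (\<Sum>b\<in>B. (\<Sum>j\<in>K. a b j * v j) * dir_deriv b G \<xi>)) (at 0)"
    by (simp add: has_field_derivative_def)
  then show ?thesis
    using smooth_coordsD(2)[OF G v] DERIV_unique by blast
qed

text \<open>The representation of vectors of V by the family B is a linear identity with constant
  coefficients. It holds for \<Xi> y near y0 and can be differentiated, which puts the derivative of
  \<Xi> into V and makes it an admissible direction.\<close>

lemma smooth_coords_chain:
  fixes \<Xi> :: "'a::real_normed_vector \<Rightarrow> 'i \<Rightarrow> real"
  assumes V: "coord_space V" and S: "rel_open V S" and G: "smooth_coords V S G"
    and y: "\<forall>\<^sub>F y in nhds y0. \<Xi> y \<in> S"
    and d: "\<And>\<iota>. ((\<lambda>y. \<Xi> y \<iota>) has_derivative \<Xi>' \<iota>) (at y0)"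
  shows "(\<lambda>\<iota>. \<Xi>' \<iota> h) \<in> V"
    and "((\<lambda>y. G (\<Xi> y)) has_derivative (\<lambda>h. dir_deriv (\<lambda>\<iota>. \<Xi>' \<iota> h) G (\<Xi> y0))) (at y0)"
proof -
  obtain B a K where B: "finite B" "B \<subseteq> V" "finite K"
    "\<And>v \<iota>. v \<in> V \<Longrightarrow> v \<iota> = (\<Sum>b\<in>B. (\<Sum>j\<in>K. a b j * v j) * b \<iota>)"
    by (rule coord_space_basis[OF V]) (rule that)
  have y0: "\<Xi> y0 \<in> S" using eventually_nhds_x_imp_x[OF y] .
  have eq: "\<Xi>' \<iota> h = (\<Sum>b\<in>B. (\<Sum>j\<in>K. a b j * \<Xi>' j h) * b \<iota>)" for \<iota> h
  proof -
    have "((\<lambda>y. \<Sum>b\<in>B. (\<Sum>j\<in>K. a b j * \<Xi> y j) * b \<iota>) has_derivative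
        (\<lambda>h. \<Sum>b\<in>B. (\<Sum>j\<in>K. a b j * \<Xi>' j h) * b \<iota>)) (at y0)"
      by (auto intro!: derivative_eq_intros d)
    moreover have "\<forall>\<^sub>F y in nhds y0. (\<Sum>b\<in>B. (\<Sum>j\<in>K. a b j * \<Xi> y j) * b \<iota>) = \<Xi> y \<iota>"
      using y by eventually_elim (use B(4)[symmetric] rel_open_subset[OF S] in auto)
    ultimately have "((\<lambda>y. \<Xi> y \<iota>) has_derivative
        (\<lambda>h. \<Sum>b\<in>B. (\<Sum>j\<in>K. a b j * \<Xi>' j h) * b \<iota>)) (at y0)"
      by (rule has_derivative_transform_nhds)
    from has_derivative_unique[OF d[of \<iota>] this] show ?thesis by (rule fun_cong)
  qed
  show mem: "(\<lambda>\<iota>. \<Xi>' \<iota> h) \<in> V" for h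
  proof -
    have "(\<lambda>\<iota>. \<Sum>b\<in>B. (\<Sum>j\<in>K. a b j * \<Xi>' j h) * b \<iota>) \<in> V"
      using B(2) by (intro coord_space_sum[OF V]) auto
    then show ?thesis by (simp only: eq[symmetric])
  qed
  have "dir_deriv (\<lambda>\<iota>. \<Xi>' \<iota> h) G (\<Xi> y0) =
      (\<Sum>b\<in>B. (\<Sum>j\<in>K. a b j * \<Xi>' j h) * dir_deriv b G (\<Xi> y0))" for h
    by (rule dir_deriv_basis[OF V S G B(1,2,4) mem y0])
  then show "((\<lambda>y. G (\<Xi> y)) has_derivative (\<lambda>h. dir_deriv (\<lambda>\<iota>. \<Xi>' \<iota> h) G (\<Xi> y0))) (at y0)"
    using smooth_coords_chain_basis[OF V S G B(1,2,4) y d] by presburger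
qed

lemma has_derivative_imp_real_derivative:
  fixes f :: "real \<Rightarrow> real"
  assumes "(f has_derivative f') (at x)"
  shows "(f has_real_derivative f' 1) (at x)"
proof -
  interpret bounded_linear f' using assms by (rule has_derivative_bounded_linear)
  have "f' = (*) (f' 1)"
  proof
    show "f' h = f' 1 * h" for h using scaleR[of h 1] by (simp add: mult.commute)
  qed
  then show ?thesis using assms by (simp add: has_field_derivative_def)
qed

lemma smooth_coords_chain_real:
  assumes V: "coord_space V" and S: "rel_open V S" and G: "smooth_coords V S G"
    and y: "\<forall>\<^sub>F t in nhds t0. \<Xi> t \<in> S"
    and d: "\<And>\<iota>. ((\<lambda>t. \<Xi> t \<iota>) has_real_derivative v \<iota>) (at t0)"
  shows "v \<in> V"
    and "((\<lambda>t. G (\<Xi> t)) has_real_derivative dir_deriv v G (\<Xi> t0)) (at t0)"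
proof -
  have d': "((\<lambda>t. \<Xi> t \<iota>) has_derivative (\<lambda>h. v \<iota> * h)) (at t0)" for \<iota>
    using d by (simp add: has_field_derivative_def)
  note chain = smooth_coords_chain[OF V S G y d']
  show "v \<in> V" using chain(1)[of 1] by simp
  show "((\<lambda>t. G (\<Xi> t)) has_real_derivative dir_deriv v G (\<Xi> t0)) (at t0)"
    using has_derivative_imp_real_derivative[OF chain(2)] by simp
qed

lemma dir_deriv_sum:
  assumes V: "coord_space V" and S: "rel_open V S" and G: "smooth_coords V S G"
    and u: "\<And>i. i \<in> I \<Longrightarrow> u i \<in> V" and \<xi>: "\<xi> \<in> S"
    and v: "\<And>\<iota>. v \<iota> = (\<Sum>i\<in>I. c i * u i \<iota>)"
  shows "dir_deriv v G \<xi> = (\<Sum>i\<in>I. c i * dir_deriv (u i) G \<xi>)"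
proof -
  obtain B a K where B: "finite B" "B \<subseteq> V" "finite K"
    "\<And>v \<iota>. v \<in> V \<Longrightarrow> v \<iota> = (\<Sum>b\<in>B. (\<Sum>j\<in>K. a b j * v j) * b \<iota>)"
    by (rule coord_space_basis[OF V]) (rule that)
  have rep: "dir_deriv v G \<xi> = (\<Sum>b\<in>B. (\<Sum>j\<in>K. a b j * v j) * dir_deriv b G \<xi>)" if "v \<in> V" for v
    by (rule dir_deriv_basis[OF V S G B(1,2,4) that \<xi>])
  have "v = (\<lambda>\<iota>. \<Sum>i\<in>I. c i * u i \<iota>)" using v by auto
  then have "v \<in> V" using coord_space_sum[OF V u] by simp
  have "dir_deriv v G \<xi> = (\<Sum>b\<in>B. (\<Sum>j\<in>K. a b j * (\<Sum>i\<in>I. c i * u i j)) * dir_deriv b G \<xi>)"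
    using rep[OF \<open>v \<in> V\<close>] v by simp
  also have "\<dots> = (\<Sum>b\<in>B. \<Sum>i\<in>I. c i * ((\<Sum>j\<in>K. a b j * u i j) * dir_deriv b G \<xi>))"
  proof (rule sum.cong[OF refl])
    fix b
    have "(\<Sum>j\<in>K. a b j * (\<Sum>i\<in>I. c i * u i j)) = (\<Sum>i\<in>I. c i * (\<Sum>j\<in>K. a b j * u i j))"
      unfolding sum_distrib_left by (subst sum.swap) (simp add: mult_ac)
    then show "(\<Sum>j\<in>K. a b j * (\<Sum>i\<in>I. c i * u i j)) * dir_deriv b G \<xi> =
        (\<Sum>i\<in>I. c i * ((\<Sum>j\<in>K. a b j * u i j) * dir_deriv b G \<xi>))"
      by (simp add: sum_distrib_right mult.assoc)
  qed
  also have "\<dots> = (\<Sum>i\<in>I. c i * dir_deriv (u i) G \<xi>)"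
    using rep[OF u] by (subst sum.swap) (simp add: sum_distrib_left)
  finally show ?thesis .
qed

lemma dir_deriv_add:
  assumes V: "coord_space V" and S: "rel_open V S" and G: "smooth_coords V S G"
    and u: "u \<in> V" "v \<in> V" and \<xi>: "\<xi> \<in> S"
  shows "dir_deriv (\<lambda>\<iota>. u \<iota> + v \<iota>) G \<xi> = dir_deriv u G \<xi> + dir_deriv v G \<xi>"
  using dir_deriv_sum[OF V S G, of "UNIV :: bool set" "\<lambda>b. if b then u else v" \<xi> _ "\<lambda>_. 1"] u \<xi>
  by (simp add: UNIV_bool)

lemma dir_deriv_zero: "dir_deriv (\<lambda>_. 0) G \<xi> = 0"
  by (simp add: dir_deriv_def)

lemma dir_deriv_const: "dir_deriv v (\<lambda>_. c) \<xi> = 0"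
  by (simp add: dir_deriv_def)

lemma dir_deriv_coord: "dir_deriv v (\<lambda>\<xi>. \<xi> \<iota>) \<xi> = v \<iota>"
  unfolding dir_deriv_def by (rule DERIV_imp_deriv) (auto intro!: derivative_eq_intros)

text \<open>Only the plane through \<xi> spanned by u and v matters; on the parameters W for which
  it stays in S, Schwarz's theorem applies to G as a function of two real variables.\<close>

lemma dir_deriv_commute:
  assumes V: "coord_space V" and S: "rel_open V S" and G: "smooth_coords V S G"
    and u: "u \<in> V" and v: "v \<in> V" and \<xi>: "\<xi> \<in> S"
  shows "dir_deriv u (dir_deriv v G) \<xi> = dir_deriv v (dir_deriv u G) \<xi>"
proof -
  define \<Psi> where "\<Psi> = (\<lambda>s t \<iota>. \<xi> \<iota> + s * v \<iota> + t * u \<iota>)"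
  obtain U where U: "open U" "S = V \<inter> U" using S by (auto simp: rel_open_def)
  have cont: "continuous_on UNIV (\<lambda>p. \<Psi> (fst p) (snd p))"
    unfolding \<Psi>_def by (auto intro!: continuous_on_coordinatewise_then_product continuous_intros)
  define W where "W = (\<lambda>p. \<Psi> (fst p) (snd p)) -` U"
  have oW: "open W"
    unfolding W_def by (rule open_vimage[OF U(1) cont])
  have inV: "\<Psi> s t \<in> V" for s t
    unfolding \<Psi>_def
    using coord_space_line[OF V coord_space_line[OF V _ v] u] \<xi> U by simp
  have inS: "\<Psi> s t \<in> S" if "(s, t) \<in> W" for s t
    using that inV U by (auto simp: W_def)
  have 0: "(0, 0) \<in> W" using \<xi> U by (simp add: W_def \<Psi>_def)
  have d1: "((\<lambda>s. H (\<Psi> s t)) has_real_derivative dir_deriv v H (\<Psi> s t)) (at s)"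
    if "(s, t) \<in> W" "smooth_coords V S H" for H s t
    using smooth_coords_line[OF that(2) v, of "\<lambda>\<iota>. \<xi> \<iota> + t * u \<iota>" s] inS[OF that(1)]
    by (simp add: \<Psi>_def algebra_simps)
  have d2: "((\<lambda>t. H (\<Psi> s t)) has_real_derivative dir_deriv u H (\<Psi> s t)) (at t)"
    if "(s, t) \<in> W" "smooth_coords V S H" for H s t
    using smooth_coords_line[OF that(2) u, of "\<lambda>\<iota>. \<xi> \<iota> + s * v \<iota>" t] inS[OF that(1)]
    by (simp add: \<Psi>_def algebra_simps)
  have c: "continuous_on W (\<lambda>p. H (\<Psi> (fst p) (snd p)))" if "smooth_coords V S H" for H
    by (rule continuous_on_compose2[OF smooth_coordsD(1)[OF that] continuous_on_subset[OF cont]])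
      (use inS in auto)
  note Gu = smooth_coordsD(3)[OF G u] and Gv = smooth_coordsD(3)[OF G v]
  have "dir_deriv u (dir_deriv v G) (\<Psi> 0 0) = dir_deriv v (dir_deriv u G) (\<Psi> 0 0)"
    by (rule mixed_derivatives_commute[OF oW 0 d1[OF _ G] d2[OF _ G] d2[OF _ Gv] d1[OF _ Gu]
          c[OF smooth_coordsD(3)[OF Gv u]] c[OF smooth_coordsD(3)[OF Gu v]]])
  then show ?thesis by (simp add: \<Psi>_def)
qed

section \<open>Stability of smoothness under sums, products and composition\<close>

lemma eventually_eq_DERIV:
  fixes f :: "real \<Rightarrow> real"
  assumes "(f has_real_derivative D) (at x)" "\<forall>\<^sub>F t in nhds x. f t = g t"
  shows "(g has_real_derivative D) (at x)"
  using DERIV_cong_ev[OF refl assms(2) refl] assms(1) by simp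

text \<open>\<open>dir_deriv v G\<close> is known to agree with \<open>D v\<close> on S only. The
  last premise absorbs this discrepancy: filled with an induction hypothesis it yields
  \<open>Ck_coords_cong\<close>, and filled with that lemma it yields the convenient form
  \<open>Ck_coords_Suc\<close>.\<close>

lemma Ck_coords_Suc_cong:
  assumes d: "\<And>v \<xi>. v \<in> V \<Longrightarrow> \<xi> \<in> S \<Longrightarrow>
      ((\<lambda>t. G (\<lambda>\<iota>. \<xi> \<iota> + t * v \<iota>)) has_real_derivative D v \<xi>) (at 0)"
    and V: "coord_space V" and S: "rel_open V S"
    and cong: "\<And>v g. v \<in> V \<Longrightarrow> (\<And>\<xi>. \<xi> \<in> S \<Longrightarrow> g \<xi> = D v \<xi>) \<Longrightarrow> Ck_coords j V S g"
  shows "Ck_coords (Suc j) V S G"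
  unfolding Ck_coords.simps
proof (intro ballI conjI)
  fix v assume v: "v \<in> V"
  show "Ck_coords j V S (dir_deriv v G)"
    by (rule cong[OF v]) (simp add: dir_deriv_def DERIV_imp_deriv[OF d[OF v]])
  show "(\<lambda>t. G (\<lambda>\<iota>. \<xi> \<iota> + t * v \<iota>)) differentiable (at 0)" if "\<xi> \<in> S" for \<xi>
    using d[OF v that] by (auto simp: real_differentiable_def)
qed

lemma Ck_coords_cong:
  assumes V: "coord_space V" and S: "rel_open V S"
    and "\<And>\<xi>. \<xi> \<in> S \<Longrightarrow> f \<xi> = g \<xi>" and "Ck_coords j V S f"
  shows "Ck_coords j V S g"
  using assms(3,4)
proof (induction j arbitrary: f g)
  case 0
  then show ?case using continuous_on_cong[of S S f g] by simp
next
  case (Suc j)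
  show ?case
  proof (rule Ck_coords_Suc_cong[OF _ V S])
    fix v \<xi> assume v: "v \<in> V" "\<xi> \<in> S"
    have "((\<lambda>t. f (\<lambda>\<iota>. \<xi> \<iota> + t * v \<iota>)) has_real_derivative dir_deriv v f \<xi>) (at 0)"
      using Suc.prems(2) v by (auto simp: DERIV_deriv_iff_real_differentiable dir_deriv_def)
    moreover have "\<forall>\<^sub>F t in nhds 0. f (\<lambda>\<iota>. \<xi> \<iota> + t * v \<iota>) = g (\<lambda>\<iota>. \<xi> \<iota> + t * v \<iota>)"
      using rel_open_line[OF V S v(2,1)] by eventually_elim (rule Suc.prems(1))
    ultimately show "((\<lambda>t. g (\<lambda>\<iota>. \<xi> \<iota> + t * v \<iota>)) has_real_derivative dir_deriv v f \<xi>) (at 0)"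
      by (rule eventually_eq_DERIV)
  next
    fix v h assume "v \<in> V" and h: "\<And>\<xi>. \<xi> \<in> S \<Longrightarrow> h \<xi> = dir_deriv v f \<xi>"
    then have "Ck_coords j V S (dir_deriv v f)" using Suc.prems(2) by simp
    then show "Ck_coords j V S h" by (rule Suc.IH[rotated]) (rule h[symmetric])
  qed
qed

lemma smooth_coords_cong:
  assumes "coord_space V" "rel_open V S" "smooth_coords V S f" "\<And>\<xi>. \<xi> \<in> S \<Longrightarrow> f \<xi> = g \<xi>"
  shows "smooth_coords V S g"
  using assms(3) Ck_coords_cong[OF assms(1,2,4)] by (simp add: smooth_coords_def)

context
  fixes V S :: "('i \<Rightarrow> real) set"
  assumes V: "coord_space V" and S: "rel_open V S"
begin

lemma dir_deriv_cong:
  assumes "v \<in> V" "\<xi> \<in> S" "\<And>\<xi>. \<xi> \<in> S \<Longrightarrow> f \<xi> = g \<xi>"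
  shows "dir_deriv v f \<xi> = dir_deriv v g \<xi>"
proof -
  have "\<forall>\<^sub>F t in nhds 0. f (\<lambda>\<iota>. \<xi> \<iota> + t * v \<iota>) = g (\<lambda>\<iota>. \<xi> \<iota> + t * v \<iota>)"
    using rel_open_line[OF V S assms(2,1)] by eventually_elim (rule assms(3))
  then show ?thesis unfolding dir_deriv_def by (rule deriv_cong_ev) simp
qed

lemma Ck_coords_Suc:
  assumes d: "\<And>v \<xi>. v \<in> V \<Longrightarrow> \<xi> \<in> S \<Longrightarrow>
      ((\<lambda>t. G (\<lambda>\<iota>. \<xi> \<iota> + t * v \<iota>)) has_real_derivative D v \<xi>) (at 0)"
    and "\<And>v. v \<in> V \<Longrightarrow> Ck_coords j V S (D v)"
  shows "Ck_coords (Suc j) V S G"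
  by (rule Ck_coords_Suc_cong[OF d V S], assumption+)
    (rule Ck_coords_cong[OF V S _ assms(2)]; simp)

lemma Ck_coords_const: "Ck_coords j V S (\<lambda>_. c)"
proof (induction j arbitrary: c)
  case (Suc j)
  show ?case by (rule Ck_coords_Suc[where D = "\<lambda>_ _. 0"]) (use Suc in auto)
qed simp

lemma smooth_coords_const: "smooth_coords V S (\<lambda>_. c)"
  by (simp add: smooth_coords_def Ck_coords_const)

lemma smooth_coords_coord: "smooth_coords V S (\<lambda>\<xi>. \<xi> \<iota>)"
  unfolding smooth_coords_def
proof
  show "Ck_coords j V S (\<lambda>\<xi>. \<xi> \<iota>)" for j
  proof (cases j)
    case 0
    then show ?thesis
      by (auto intro: continuous_on_subset[OF continuous_on_product_coordinates])
  next
    case (Suc i)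
    show ?thesis unfolding Suc
      by (rule Ck_coords_Suc[where D = "\<lambda>v _. v \<iota>"])
        (auto intro!: derivative_eq_intros Ck_coords_const)
  qed
qed

lemma Ck_coords_add:
  assumes "Ck_coords j V S f" "Ck_coords j V S g"
  shows "Ck_coords j V S (\<lambda>\<xi>. f \<xi> + g \<xi>)"
  using assms
proof (induction j arbitrary: f g)
  case 0 then show ?case by (auto intro: continuous_intros)
next
  case (Suc j)
  show ?case
  proof (rule Ck_coords_Suc[where D = "\<lambda>v \<xi>. dir_deriv v f \<xi> + dir_deriv v g \<xi>"])
    show "Ck_coords j V S (\<lambda>\<xi>. dir_deriv v f \<xi> + dir_deriv v g \<xi>)" if "v \<in> V" for v
      using Suc that by auto
    show "((\<lambda>t. f (\<lambda>\<iota>. \<xi> \<iota> + t * v \<iota>) + g (\<lambda>\<iota>. \<xi> \<iota> + t * v \<iota>)) has_real_derivative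
        dir_deriv v f \<xi> + dir_deriv v g \<xi>) (at 0)" if "v \<in> V" "\<xi> \<in> S" for v \<xi>
      using Suc.prems that
      by (intro DERIV_add) (auto simp: DERIV_deriv_iff_real_differentiable dir_deriv_def)
  qed
qed

lemma Ck_coords_sum:
  assumes "\<And>i. i \<in> I \<Longrightarrow> Ck_coords j V S (f i)"
  shows "Ck_coords j V S (\<lambda>\<xi>. \<Sum>i\<in>I. f i \<xi>)"
  using assms by (induction I rule: infinite_finite_induct) (auto intro: Ck_coords_const Ck_coords_add)

lemma smooth_coords_add:
  "smooth_coords V S f \<Longrightarrow> smooth_coords V S g \<Longrightarrow> smooth_coords V S (\<lambda>\<xi>. f \<xi> + g \<xi>)"
  by (auto simp: smooth_coords_def intro: Ck_coords_add)

lemma smooth_coords_sum: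
  "(\<And>i. i \<in> I \<Longrightarrow> smooth_coords V S (f i)) \<Longrightarrow> smooth_coords V S (\<lambda>\<xi>. \<Sum>i\<in>I. f i \<xi>)"
  by (auto simp: smooth_coords_def intro: Ck_coords_sum)

lemma smooth_coords_mult:
  assumes "smooth_coords V S f" "smooth_coords V S g"
  shows "smooth_coords V S (\<lambda>\<xi>. f \<xi> * g \<xi>)"
proof -
  have "Ck_coords j V S (\<lambda>\<xi>. f \<xi> * g \<xi>)" for j
    using assms
  proof (induction j arbitrary: f g)
    case 0
    then show ?case using continuous_on_mult[OF 0[THEN smooth_coordsD(1)]] by simp
  next
    case (Suc j)
    show ?case
    proof (rule Ck_coords_Suc)
      show "((\<lambda>t. f (\<lambda>\<iota>. \<xi> \<iota> + t * v \<iota>) * g (\<lambda>\<iota>. \<xi> \<iota> + t * v \<iota>)) has_real_derivative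
          dir_deriv v f \<xi> * g \<xi> + f \<xi> * dir_deriv v g \<xi>) (at 0)" if "v \<in> V" "\<xi> \<in> S" for v \<xi>
        using DERIV_mult[OF smooth_coordsD(2)[OF Suc.prems(1) that]
            smooth_coordsD(2)[OF Suc.prems(2) that]] by (simp add: mult.commute add.commute)
      show "Ck_coords j V S (\<lambda>\<xi>. dir_deriv v f \<xi> * g \<xi> + f \<xi> * dir_deriv v g \<xi>)" if "v \<in> V" for v
        using Ck_coords_add[OF Suc.IH[OF smooth_coordsD(3)[OF Suc.prems(1) that] Suc.prems(2)]
            Suc.IH[OF Suc.prems(1) smooth_coordsD(3)[OF Suc.prems(2) that]]] .
    qed
  qed
  then show ?thesis by (simp add: smooth_coords_def)
qed

lemma smooth_coords_cmult: "smooth_coords V S f \<Longrightarrow> smooth_coords V S (\<lambda>\<xi>. c * f \<xi>)"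
  by (rule smooth_coords_mult[OF smooth_coords_const])

lemma dir_deriv_mult:
  assumes "smooth_coords V S f" "smooth_coords V S g" "v \<in> V" "\<xi> \<in> S"
  shows "dir_deriv v (\<lambda>\<xi>. f \<xi> * g \<xi>) \<xi> = dir_deriv v f \<xi> * g \<xi> + f \<xi> * dir_deriv v g \<xi>"
  using DERIV_imp_deriv[OF DERIV_mult[OF smooth_coordsD(2)[OF assms(1,3,4)]
            smooth_coordsD(2)[OF assms(2,3,4)]]] unfolding dir_deriv_def[of v "\<lambda>\<xi>. f \<xi> * g \<xi>"]
  by (simp add: mult.commute add.commute)

lemma dir_deriv_plus:
  assumes "smooth_coords V S f" "smooth_coords V S g" "v \<in> V" "\<xi> \<in> S"
  shows "dir_deriv v (\<lambda>\<xi>. f \<xi> + g \<xi>) \<xi> = dir_deriv v f \<xi> + dir_deriv v g \<xi>"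
  using DERIV_imp_deriv[OF DERIV_add[OF smooth_coordsD(2)[OF assms(1,3,4)]
            smooth_coordsD(2)[OF assms(2,3,4)]]] unfolding dir_deriv_def[of v "\<lambda>\<xi>. f \<xi> + g \<xi>"]
  by simp

lemma dir_deriv_of_sum:
  assumes "\<And>i. i \<in> I \<Longrightarrow> smooth_coords V S (f i)" "v \<in> V" "\<xi> \<in> S"
  shows "dir_deriv v (\<lambda>\<xi>. \<Sum>i\<in>I. f i \<xi>) \<xi> = (\<Sum>i\<in>I. dir_deriv v (f i) \<xi>)"
  unfolding dir_deriv_def[of v "\<lambda>\<xi>. \<Sum>i\<in>I. f i \<xi>"]
  by (rule DERIV_imp_deriv, rule DERIV_sum, rule smooth_coordsD(2)[OF assms(1) assms(2,3)])

end

lemma smooth_coords_compose: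
  assumes V: "coord_space V" "rel_open V S" and V': "coord_space V'" "rel_open V' S'"
    and h: "smooth_coords V S h" and P: "\<And>\<iota>. smooth_coords V' S' (\<lambda>\<xi>. P \<xi> \<iota>)"
    and PS: "\<And>\<xi>. \<xi> \<in> S' \<Longrightarrow> P \<xi> \<in> S"
  shows "smooth_coords V' S' (\<lambda>\<xi>. h (P \<xi>))"
proof -
  obtain B a K where B: "finite B" "B \<subseteq> V" "finite K"
    "\<And>v \<iota>. v \<in> V \<Longrightarrow> v \<iota> = (\<Sum>b\<in>B. (\<Sum>j\<in>K. a b j * v j) * b \<iota>)"
    by (rule coord_space_basis[OF V(1)]) (rule that)
  \<comment> \<open>The additional factor p makes the claim inductive: a derivative of h along P is
    a sum of smooth factors times derivatives of h in the fixed directions of B, again composed with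
    P. The lemma is the case p = 1.\<close>
  have "Ck_coords j V' S' (\<lambda>\<xi>. p \<xi> * h (P \<xi>))" if "smooth_coords V' S' p" for j p
    using that h
  proof (induction j arbitrary: p h)
    case 0
    have "continuous_on S' P"
      by (intro continuous_on_coordinatewise_then_product smooth_coordsD(1)[OF P])
    then have "continuous_on S' (\<lambda>\<xi>. h (P \<xi>))"
      by (rule continuous_on_compose2[OF smooth_coordsD(1)[OF 0(2)]]) (use PS in auto)
    then show ?case using smooth_coordsD(1)[OF 0(1)] by (auto intro: continuous_intros)
  next
    case (Suc j)
    let ?D = "\<lambda>v b \<xi>. \<Sum>j\<in>K. a b j * dir_deriv v (\<lambda>\<xi>. P \<xi> j) \<xi>"
    show ?case
    proof (rule Ck_coords_Suc[OF V'])
      fix v \<xi> assume v: "v \<in> V'" "\<xi> \<in> S'"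
      have ev: "\<forall>\<^sub>F t in nhds 0. P (\<lambda>\<iota>. \<xi> \<iota> + t * v \<iota>) \<in> S"
        using rel_open_line[OF V' v(2,1)] by eventually_elim (rule PS)
      note d = smooth_coordsD(2)[OF P v]
      have c: "((\<lambda>t. h (P (\<lambda>\<iota>. \<xi> \<iota> + t * v \<iota>))) has_real_derivative
          dir_deriv (\<lambda>\<iota>. dir_deriv v (\<lambda>\<xi>. P \<xi> \<iota>) \<xi>) h (P \<xi>)) (at 0)"
        and m: "(\<lambda>\<iota>. dir_deriv v (\<lambda>\<xi>. P \<xi> \<iota>) \<xi>) \<in> V"
        using smooth_coords_chain_real[OF V Suc.prems(2) ev d] by simp_all
      have e: "dir_deriv (\<lambda>\<iota>. dir_deriv v (\<lambda>\<xi>. P \<xi> \<iota>) \<xi>) h (P \<xi>) =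
          (\<Sum>b\<in>B. ?D v b \<xi> * dir_deriv b h (P \<xi>))"
        by (rule dir_deriv_basis[OF V Suc.prems(2) B(1,2,4) m PS[OF v(2)]])
      show "((\<lambda>t. p (\<lambda>\<iota>. \<xi> \<iota> + t * v \<iota>) * h (P (\<lambda>\<iota>. \<xi> \<iota> + t * v \<iota>))) has_real_derivative
          dir_deriv v p \<xi> * h (P \<xi>) + (\<Sum>b\<in>B. (p \<xi> * ?D v b \<xi>) * dir_deriv b h (P \<xi>))) (at 0)"
        using DERIV_mult[OF smooth_coordsD(2)[OF Suc.prems(1) v] c] unfolding e
        by (simp add: sum_distrib_left sum_distrib_right mult_ac add.commute)
    next
      fix v assume v: "v \<in> V'"
      have "smooth_coords V' S' (\<lambda>\<xi>. p \<xi> * ?D v b \<xi>)" for b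
        by (intro smooth_coords_mult smooth_coords_sum smooth_coords_cmult V' Suc.prems(1)
            smooth_coordsD(3)[OF P v])
      then show "Ck_coords j V' S' (\<lambda>\<xi>. dir_deriv v p \<xi> * h (P \<xi>) +
          (\<Sum>b\<in>B. (p \<xi> * ?D v b \<xi>) * dir_deriv b h (P \<xi>)))"
        by (intro Ck_coords_add[OF V'] Ck_coords_sum[OF V'] Suc.IH smooth_coordsD(3)[OF Suc.prems(1) v]
           Suc.prems(2) smooth_coordsD(3)[OF Suc.prems(2)]) (use B(2) in auto)
    qed
  qed
  from this[OF smooth_coords_const[OF V', of 1]] show ?thesis by (simp add: smooth_coords_def)
qed

text \<open>The passage from functions of coordinate tuples to functions on a normed space. It is
  applied to sections read in a chart and to curves in a fibre. As in composition, the fixed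
  directions of B replace the moving direction.\<close>

lemma smooth_on_smooth_coords:
  fixes \<Xi> :: "'a::real_normed_vector \<Rightarrow> 'i \<Rightarrow> real"
  assumes V: "coord_space V" "rel_open V S" and T: "open T"
    and h: "smooth_coords V S h" and \<Xi>: "\<And>\<iota>. smooth_on T (\<lambda>y. \<Xi> y \<iota>)"
    and \<Xi>S: "\<And>y. y \<in> T \<Longrightarrow> \<Xi> y \<in> S"
  shows "smooth_on T (\<lambda>y. h (\<Xi> y))"
proof -
  obtain B a K where B: "finite B" "B \<subseteq> V" "finite K"
    "\<And>v \<iota>. v \<in> V \<Longrightarrow> v \<iota> = (\<Sum>b\<in>B. (\<Sum>j\<in>K. a b j * v j) * b \<iota>)"
    by (rule coord_space_basis[OF V(1)]) (rule that)
  have d: "((\<lambda>y. \<Xi> y \<iota>) has_derivative frechet_derivative (\<lambda>y. \<Xi> y \<iota>) (at y)) (at y)" if "y \<in> T" for y \<iota>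
    using smooth_onD(2)[OF \<Xi> that] by (simp add: frechet_derivative_works)
  have "Ck_on j T (\<lambda>y. h (\<Xi> y))" for j
    using h
  proof (induction j arbitrary: h)
    case 0
    have "continuous_on T \<Xi>"
      by (intro continuous_on_coordinatewise_then_product smooth_onD(1)[OF \<Xi>])
    then have "continuous_on T (\<lambda>y. h (\<Xi> y))"
      by (rule continuous_on_compose2[OF smooth_coordsD(1)[OF 0]]) (use \<Xi>S in auto)
    then show ?case by simp
  next
    case (Suc j)
    let ?D = "\<lambda>b y v. \<Sum>j\<in>K. a b j * frechet_derivative (\<lambda>y. \<Xi> y j) (at y) v"
    show ?case
    proof (rule Ck_on_SucI[OF T])
      fix y assume y: "y \<in> T"
      have ev: "\<forall>\<^sub>F y in nhds y. \<Xi> y \<in> S"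
        using eventually_nhds_in_open[OF T y] by eventually_elim (rule \<Xi>S)
      show "((\<lambda>y. h (\<Xi> y)) has_derivative (\<lambda>v. \<Sum>b\<in>B. ?D b y v * dir_deriv b h (\<Xi> y))) (at y)"
        by (rule smooth_coords_chain_basis[OF V Suc.prems B(1,2,4) ev d[OF y]])
    next
      fix v
      have "smooth_on T (\<lambda>y. ?D b y v)" for b
        by (intro smooth_on_sum[OF T] smooth_on_mult[OF T] smooth_on_const smooth_onD(3)[OF \<Xi>])
      then have D: "Ck_on j T (\<lambda>y. ?D b y v)" for b by (simp add: smooth_on_def)
      show "Ck_on j T (\<lambda>y. \<Sum>b\<in>B. ?D b y v * dir_deriv b h (\<Xi> y))"
      proof (rule Ck_on_sum[OF T], rule Ck_on_bilinear[OF T bounded_bilinear_mult D])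
        fix b assume "b \<in> B"
        then show "Ck_on j T (\<lambda>y. dir_deriv b h (\<Xi> y))"
          using B(2) by (intro Suc.IH smooth_coordsD(3)[OF Suc.prems]) auto
      qed
    qed
  qed
  then show ?thesis by (simp add: smooth_on_def)
qed

lemma dir_deriv_precompose:
  assumes "\<And>\<xi> t v. P (\<lambda>\<iota>. \<xi> \<iota> + t * v \<iota>) = (\<lambda>\<iota>. P \<xi> \<iota> + t * P v \<iota>)"
  shows "dir_deriv v (\<lambda>\<xi>. G (P \<xi>)) \<xi> = dir_deriv (P v) G (P \<xi>)"
  unfolding dir_deriv_def assms ..

section \<open>Iterated partial derivatives\<close>

lemma DERIV_along_line:
  fixes g :: "'a::real_normed_vector \<Rightarrow> real"
  assumes "g differentiable (at (y + s *\<^sub>R v))"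
  shows "((\<lambda>s. g (y + s *\<^sub>R v)) has_real_derivative frechet_derivative g (at (y + s *\<^sub>R v)) v) (at s)"
proof -
  have "((\<lambda>s. y + s *\<^sub>R v) has_derivative (\<lambda>h. h *\<^sub>R v)) (at s)"
    by (auto intro!: derivative_eq_intros)
  from has_derivative_compose[OF this assms[unfolded frechet_derivative_works]]
  show ?thesis by (auto dest: has_derivative_imp_real_derivative)
qed

lemma smooth_on_partial: "smooth_on S g \<Longrightarrow> smooth_on S (partial \<mu> g)"
  using smooth_onD(3)[of S g "axis \<mu> 1"] by (simp add: partial_def[abs_def])

lemma smooth_on_partials: "smooth_on S g \<Longrightarrow> smooth_on S (partials ms g)"
  by (induction ms) (auto simp: partials_def smooth_on_partial)

lemma partial_cong:
  assumes "open S" "y \<in> S" "\<And>y. y \<in> S \<Longrightarrow> f y = g y" "f differentiable (at y)"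
  shows "partial \<mu> f y = partial \<mu> g y"
  unfolding partial_def
  using frechet_derivative_transform_within_open[OF assms(4,1,2,3)] by simp

lemma partial_commute:
  assumes S: "open S" and g: "smooth_on S g" and y: "y \<in> S"
  shows "partial \<mu> (partial \<nu> g) y = partial \<nu> (partial \<mu> g) y"
proof -
  define e where "e = (\<lambda>\<mu>::'a. axis \<mu> (1::real))"
  define \<Psi> where "\<Psi> = (\<lambda>s t. y + s *\<^sub>R e \<nu> + t *\<^sub>R e \<mu>)"
  have cont: "continuous_on UNIV (\<lambda>p. \<Psi> (fst p) (snd p))"
    unfolding \<Psi>_def by (auto intro!: continuous_intros)
  define W where "W = (\<lambda>p. \<Psi> (fst p) (snd p)) -` S"
  have oW: "open W" unfolding W_def by (rule open_vimage[OF S cont])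
  have inS: "\<Psi> s t \<in> S" if "(s, t) \<in> W" for s t using that by (simp add: W_def)
  have 0: "(0, 0) \<in> W" using y by (simp add: W_def \<Psi>_def)
  have d1: "((\<lambda>s. h (\<Psi> s t)) has_real_derivative partial \<nu> h (\<Psi> s t)) (at s)"
    if "(s, t) \<in> W" "smooth_on S h" for h s t
    using DERIV_along_line[of h "y + t *\<^sub>R e \<mu>" s "e \<nu>"] smooth_onD(2)[OF that(2) inS[OF that(1)]]
    by (simp add: \<Psi>_def algebra_simps partial_def e_def)
  have d2: "((\<lambda>t. h (\<Psi> s t)) has_real_derivative partial \<mu> h (\<Psi> s t)) (at t)"
    if "(s, t) \<in> W" "smooth_on S h" for h s t
    using DERIV_along_line[of h "y + s *\<^sub>R e \<nu>" t "e \<mu>"] smooth_onD(2)[OF that(2) inS[OF that(1)]]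
    by (simp add: \<Psi>_def algebra_simps partial_def e_def)
  have c: "continuous_on W (\<lambda>p. h (\<Psi> (fst p) (snd p)))" if "smooth_on S h" for h
    by (rule continuous_on_compose2[OF smooth_onD(1)[OF that] continuous_on_subset[OF cont]])
      (use inS in auto)
  note p = smooth_on_partial
  have "partial \<mu> (partial \<nu> g) (\<Psi> 0 0) = partial \<nu> (partial \<mu> g) (\<Psi> 0 0)"
    by (rule mixed_derivatives_commute[OF oW 0 d1[OF _ g] d2[OF _ g] d2[OF _ p[OF g]] d1[OF _ p[OF g]]
          c[OF p[OF p[OF g]]] c[OF p[OF p[OF g]]]])
  then show ?thesis by (simp add: \<Psi>_def)
qed

lemma partials_move:
  assumes S: "open S" and g: "smooth_on S g" and y: "y \<in> S"
  shows "partials (xs @ m # ys) g y = partials (m # xs @ ys) g y"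
  using y
proof (induction xs arbitrary: y)
  case (Cons x xs)
  have "partials ((x # xs) @ m # ys) g y = partial x (partials (xs @ m # ys) g) y"
    by (simp add: partials_def)
  also have "\<dots> = partial x (partials (m # xs @ ys) g) y"
    by (rule partial_cong[OF S Cons.prems Cons.IH smooth_onD(2)[OF smooth_on_partials[OF g] Cons.prems]])
  also have "\<dots> = partial x (partial m (partials (xs @ ys) g)) y"
    by (simp add: partials_def)
  also have "\<dots> = partial m (partial x (partials (xs @ ys) g)) y"
    by (rule partial_commute[OF S smooth_on_partials[OF g] Cons.prems])
  also have "\<dots> = partials (m # (x # xs) @ ys) g y" by (simp add: partials_def)
  finally show ?case .
qed simp

text \<open>Any index can be commuted to the front, so induction on the list suffices. This is why
  jets of sections have symmetric coordinates.\<close>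

lemma partials_mset:
  assumes S: "open S" and g: "smooth_on S g" and y: "y \<in> S" and "mset ms = mset ns"
  shows "partials ms g y = partials ns g y"
  using assms(4) y
proof (induction ms arbitrary: ns y)
  case (Cons m ms)
  then have "m \<in> set ns" by (metis list.set_intros(1) mset_eq_setD)
  then obtain xs ys where ns: "ns = xs @ m # ys" by (auto simp: in_set_conv_decomp)
  have ms: "mset ms = mset (xs @ ys)" using Cons.prems(1) ns by simp
  have "partials (m # ms) g y = partial m (partials ms g) y" by (simp add: partials_def)
  also have "\<dots> = partial m (partials (xs @ ys) g) y"
    by (rule partial_cong[OF S Cons.prems(2) Cons.IH[OF ms]
          smooth_onD(2)[OF smooth_on_partials[OF g] Cons.prems(2)]])
  also have "\<dots> = partials (m # xs @ ys) g y" by (simp add: partials_def)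
  also have "\<dots> = partials ns g y" unfolding ns by (rule partials_move[OF S g Cons.prems(2), symmetric])
  finally show ?case .
qed simp

section \<open>Coordinate spaces of jets\<close>

lemma coord_spaceI:
  assumes "(\<lambda>_. 0) \<in> V" "\<And>u v s t. u \<in> V \<Longrightarrow> v \<in> V \<Longrightarrow> (\<lambda>\<iota>. s * u \<iota> + t * v \<iota>) \<in> V"
    and "finite J" "\<And>v \<iota>. v \<in> V \<Longrightarrow> \<iota> \<notin> J \<Longrightarrow> v \<iota> = 0"
  shows "coord_space V"
  unfolding coord_space_def
  by (intro conjI ballI allI exI[of _ J] impI) (fact assms(1), erule assms(2), assumption,
      fact assms(3), erule assms(4), assumption)

lemma finite_lists_below: "finite {ms :: 'n::finite list. length ms < k}"
  by (rule finite_subset[OF _ finite_lists_length_le[of UNIV k]]) auto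

lemma finite_lists_upto: "finite {ms :: 'n::finite list. length ms \<le> k}"
  using finite_lists_length_le[of "UNIV :: 'n set" k] by simp

lemma jet_coords_sym: "\<xi> \<in> jet_coords k \<Longrightarrow> mset ms = mset ns \<Longrightarrow> \<xi> (Fld a ms) = \<xi> (Fld a ns)"
  unfolding jet_coords_def by blast

lemma jet_coordsD:
  assumes "\<xi> \<in> jet_coords k"
  shows "length ms > k \<Longrightarrow> \<xi> (Fld a ms) = 0" "\<xi> (Mom a ms l) = 0"
    "\<xi> (DFld a ms n) = 0" "\<xi> (DMom a ms l n) = 0"
  using assms unfolding jet_coords_def by blast+

lemma jet_coordsI:
  assumes "\<And>a ms ns. mset ms = mset ns \<Longrightarrow> \<xi> (Fld a ms) = \<xi> (Fld a ns)"
    and "\<And>a ms. length ms > k \<Longrightarrow> \<xi> (Fld a ms) = 0"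
    and "\<And>a ms l. \<xi> (Mom a ms l) = 0" "\<And>a ms n. \<xi> (DFld a ms n) = 0"
    and "\<And>a ms l n. \<xi> (DMom a ms l n) = 0"
  shows "\<xi> \<in> jet_coords k"
  using assms unfolding jet_coords_def by blast

lemma coord_space_jet_coords: "coord_space (jet_coords k :: ('n::finite, 'r::finite) coords set)"
proof (rule coord_spaceI[where J = "range Base \<union> (\<lambda>(a, ms). Fld a ms) ` (UNIV \<times> {ms. length ms \<le> k})"])
  show "(\<lambda>_. 0) \<in> (jet_coords k :: ('n, 'r) coords set)" by (simp add: jet_coords_def)
  show "(\<lambda>\<iota>. s * u \<iota> + t * v \<iota>) \<in> jet_coords k"
    if "u \<in> jet_coords k" "v \<in> jet_coords k" for u v :: "('n, 'r) coords" and s t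
  proof (rule jet_coordsI)
    fix a :: 'r and ms ns :: "'n list" assume "mset ms = mset ns"
    from jet_coords_sym[OF that(1) this] jet_coords_sym[OF that(2) this]
    show "s * u (Fld a ms) + t * v (Fld a ms) = s * u (Fld a ns) + t * v (Fld a ns)" by simp
  qed (simp_all add: jet_coordsD[OF that(1)] jet_coordsD[OF that(2)])
  show "finite (range Base \<union> (\<lambda>(a, ms). Fld a ms) ` (UNIV \<times> {ms. length ms \<le> k}) :: ('n, 'r) coord set)"
    by (intro finite_UnI finite_imageI finite_cartesian_product finite_lists_upto) simp_all
  show "v \<iota> = 0" if "v \<in> jet_coords k"
    "\<iota> \<notin> range Base \<union> (\<lambda>(a, ms). Fld a ms) ` (UNIV \<times> {ms. length ms \<le> k})" for v and \<iota> :: "('n, 'r) coord"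
    using that(2) jet_coordsD[OF that(1)] by (cases \<iota>) (auto simp: image_iff not_le)
qed

lemma pre_inf_coordsE:
  assumes "\<xi> \<in> pre_inf_coords k"
  obtains \<eta> where "\<eta> \<in> jet_coords k"
      "\<And>a ms. \<xi> (Fld a ms) = (if length ms < k then \<eta> (Fld a ms) else 0)"
      "\<And>a ms n. \<xi> (DFld a ms n) = (if length ms < k then \<eta> (Fld a (ms @ [n])) else 0)"
proof -
  from assms[unfolded pre_inf_coords_def mem_Collect_eq, THEN conjunct1]
  obtain \<eta> where "\<eta> \<in> jet_coords k" and *: "\<forall>a ms.
      \<xi> (Fld a ms) = (if length ms < k then \<eta> (Fld a ms) else 0) \<and>
      (\<forall>n. \<xi> (DFld a ms n) = (if length ms < k then \<eta> (Fld a (ms @ [n])) else 0))" ..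
  show ?thesis
    by (rule that[OF \<open>\<eta> \<in> jet_coords k\<close>]) (rule *[rule_format, THEN conjunct1] *[rule_format, THEN conjunct2, rule_format])+
qed

lemma pre_inf_coordsD:
  assumes "\<xi> \<in> pre_inf_coords k"
  shows "mset ms = mset ns \<Longrightarrow> \<xi> (Fld a ms) = \<xi> (Fld a ns)"
    and "mset ms = mset ns \<Longrightarrow> \<xi> (DFld a ms n) = \<xi> (DFld a ns n)"
    and "mset ms = mset ns \<Longrightarrow> \<xi> (Mom a ms l) = \<xi> (Mom a ns l)"
    and "mset ms = mset ns \<Longrightarrow> \<xi> (DMom a ms l n) = \<xi> (DMom a ns l n)"
    and "length ms \<ge> k \<Longrightarrow> \<xi> (Fld a ms) = 0" "length ms \<ge> k \<Longrightarrow> \<xi> (DFld a ms n) = 0"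
    and "length ms \<ge> k \<Longrightarrow> \<xi> (Mom a ms l) = 0" "length ms \<ge> k \<Longrightarrow> \<xi> (DMom a ms l n) = 0"
proof -
  obtain \<eta> where \<eta>: "\<eta> \<in> jet_coords k"
      "\<And>a ms. \<xi> (Fld a ms) = (if length ms < k then \<eta> (Fld a ms) else 0)"
      "\<And>a ms n. \<xi> (DFld a ms n) = (if length ms < k then \<eta> (Fld a (ms @ [n])) else 0)"
    using assms by (rule pre_inf_coordsE) (rule that)
  show "mset ms = mset ns \<Longrightarrow> \<xi> (Fld a ms) = \<xi> (Fld a ns)"
    and "mset ms = mset ns \<Longrightarrow> \<xi> (DFld a ms n) = \<xi> (DFld a ns n)"
    and "length ms \<ge> k \<Longrightarrow> \<xi> (Fld a ms) = 0" "length ms \<ge> k \<Longrightarrow> \<xi> (DFld a ms n) = 0"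
    using jet_coords_sym[OF \<eta>(1), of ms ns a] jet_coords_sym[OF \<eta>(1), of "ms @ [n]" "ns @ [n]" a]
      mset_eq_length[of ms ns]
    by (simp_all add: \<eta>(2,3))
  note d = assms[unfolded pre_inf_coords_def mem_Collect_eq, THEN conjunct2]
  show "mset ms = mset ns \<Longrightarrow> \<xi> (Mom a ms l) = \<xi> (Mom a ns l)"
    and "mset ms = mset ns \<Longrightarrow> \<xi> (DMom a ms l n) = \<xi> (DMom a ns l n)"
    using d[THEN conjunct1, rule_format, of ms ns] by simp_all
  show "length ms \<ge> k \<Longrightarrow> \<xi> (Mom a ms l) = 0" "length ms \<ge> k \<Longrightarrow> \<xi> (DMom a ms l n) = 0"
    using d[THEN conjunct2, rule_format, of ms] by simp_all
qed

lemma pre_inf_coordsI: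
  assumes "\<eta> \<in> jet_coords k"
    and "\<And>a ms. \<xi> (Fld a ms) = (if length ms < k then \<eta> (Fld a ms) else 0)"
    and "\<And>a ms n. \<xi> (DFld a ms n) = (if length ms < k then \<eta> (Fld a (ms @ [n])) else 0)"
    and "\<And>a ms ns l. mset ms = mset ns \<Longrightarrow> \<xi> (Mom a ms l) = \<xi> (Mom a ns l)"
    and "\<And>a ms ns l n. mset ms = mset ns \<Longrightarrow> \<xi> (DMom a ms l n) = \<xi> (DMom a ns l n)"
    and "\<And>a ms l. length ms \<ge> k \<Longrightarrow> \<xi> (Mom a ms l) = 0"
    and "\<And>a ms l n. length ms \<ge> k \<Longrightarrow> \<xi> (DMom a ms l n) = 0"
  shows "\<xi> \<in> pre_inf_coords k"
  unfolding pre_inf_coords_def mem_Collect_eq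
  by (intro conjI bexI[OF _ assms(1)] allI impI) (rule assms; assumption?)+

lemma coord_space_pre_inf_coords: "coord_space (pre_inf_coords k :: ('n::finite, 'r::finite) coords set)"
proof -
  let ?B = "{ms :: 'n list. length ms < k}"
  let ?J = "range Base \<union> (\<lambda>(a, ms). Fld a ms) ` (UNIV \<times> ?B)
    \<union> (\<lambda>(a, ms, n). DFld a ms n) ` (UNIV \<times> ?B \<times> UNIV)
    \<union> (\<lambda>(a, ms, l). Mom a ms l) ` (UNIV \<times> ?B \<times> UNIV)
    \<union> (\<lambda>(a, ms, l, n). DMom a ms l n) ` (UNIV \<times> ?B \<times> UNIV \<times> UNIV) :: ('n, 'r) coord set"
  show ?thesis
  proof (rule coord_spaceI[where J = ?J])
    show "(\<lambda>_. 0) \<in> (pre_inf_coords k :: ('n, 'r) coords set)"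
      by (rule pre_inf_coordsI[OF coord_space_zero[OF coord_space_jet_coords]]) simp_all
    show "(\<lambda>\<iota>. s * u \<iota> + t * v \<iota>) \<in> pre_inf_coords k"
      if uv: "u \<in> pre_inf_coords k" "v \<in> pre_inf_coords k" for u v :: "('n, 'r) coords" and s t
    proof -
      obtain \<eta> where \<eta>: "\<eta> \<in> jet_coords k"
          "\<And>a ms. u (Fld a ms) = (if length ms < k then \<eta> (Fld a ms) else 0)"
          "\<And>a ms n. u (DFld a ms n) = (if length ms < k then \<eta> (Fld a (ms @ [n])) else 0)"
        using uv(1) by (rule pre_inf_coordsE) (rule that)
      obtain \<zeta> where \<zeta>: "\<zeta> \<in> jet_coords k"
          "\<And>a ms. v (Fld a ms) = (if length ms < k then \<zeta> (Fld a ms) else 0)"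
          "\<And>a ms n. v (DFld a ms n) = (if length ms < k then \<zeta> (Fld a (ms @ [n])) else 0)"
        using uv(2) by (rule pre_inf_coordsE) (rule that)
      show ?thesis
      proof (rule pre_inf_coordsI[OF coord_space_lin[OF coord_space_jet_coords \<eta>(1) \<zeta>(1), of s t]])
        fix a ms ns l n assume ms: "mset ms = mset (ns :: 'n list)"
        show "s * u (Mom a ms l) + t * v (Mom a ms l) = s * u (Mom a ns l) + t * v (Mom a ns l)"
          using pre_inf_coordsD(3)[OF uv(1) ms] pre_inf_coordsD(3)[OF uv(2) ms] by simp
        show "s * u (DMom a ms l n) + t * v (DMom a ms l n) = s * u (DMom a ns l n) + t * v (DMom a ns l n)"
          using pre_inf_coordsD(4)[OF uv(1) ms] pre_inf_coordsD(4)[OF uv(2) ms] by simp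
      qed (simp_all add: \<eta>(2,3) \<zeta>(2,3) pre_inf_coordsD(7,8)[OF uv(1)] pre_inf_coordsD(7,8)[OF uv(2)])
    qed
    show "finite ?J"
      by (intro finite_UnI finite_imageI finite_cartesian_product finite_lists_below) simp_all
    show "v \<iota> = 0" if v: "v \<in> pre_inf_coords k" and "\<iota> \<notin> ?J" for v \<iota>
      using that(2) pre_inf_coordsD(5-8)[OF v]
      by (cases \<iota>) (auto simp: image_iff not_less)
  qed
qed

lemma truncate_line: "truncate j (\<lambda>\<iota>. \<xi> \<iota> + t * v \<iota>) = (\<lambda>\<iota>. truncate j \<xi> \<iota> + t * truncate j v \<iota>)"
  by (auto simp: truncate_def fun_eq_iff split: coord.split)

lemma truncate_in_jet_coords:
  fixes \<xi> :: "('n, 'r) coords"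
  assumes "\<And>a ms ns. mset ms = mset ns \<Longrightarrow> \<xi> (Fld a ms) = \<xi> (Fld a ns)"
  shows "truncate j \<xi> \<in> jet_coords j"
proof (rule jet_coordsI)
  fix a ms ns assume ms: "mset ms = mset (ns :: 'n list)"
  show "truncate j \<xi> (Fld a ms) = truncate j \<xi> (Fld a ns)"
    using assms[OF ms, of a] mset_eq_length[OF ms] by (simp add: truncate_def)
qed (simp_all add: truncate_def)

text \<open>The direction-level form of the fact that a function of jets of order j has no
  derivative with respect to coordinates of higher order.\<close>

lemma truncate_sym_unit: "length ms > j \<Longrightarrow> truncate j (sym_unit a ms) = (\<lambda>_. 0)"
  by (auto simp: truncate_def sym_unit_def fun_eq_iff split: coord.split dest: mset_eq_length)

lemma truncate_sym_unit_in: "truncate j (sym_unit a ms) \<in> jet_coords j"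
  by (rule truncate_in_jet_coords) (simp add: sym_unit_def)

lemma sym_unit_in: "length ms \<le> k \<Longrightarrow> sym_unit a ms \<in> jet_coords k"
  by (rule jet_coordsI) (auto simp: sym_unit_def dest: mset_eq_length)

lemma sym_unit_mset: "mset ms = mset ns \<Longrightarrow> sym_unit a ms = sym_unit a ns"
  unfolding sym_unit_def by (simp only:)

definition base_unit :: "'n \<Rightarrow> ('n, 'r) coords" where
  "base_unit \<mu> = (\<lambda>\<iota>. if \<iota> = Base \<mu> then 1 else 0)"

lemma base_unit_in: "base_unit \<mu> \<in> jet_coords j"
  by (rule jet_coordsI) (simp_all add: base_unit_def)

lemma truncate_base_unit: "truncate j (base_unit \<mu>) = base_unit \<mu>"
  by (auto simp: truncate_def base_unit_def fun_eq_iff split: coord.split)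

text \<open>The sum runs over all index lists, so a symmetric coordinate is met once for each
  rearrangement of its indices; the factor 1/card in \<open>sym_unit\<close> compensates. Lists of
  length between j and k contribute nothing, as their truncated unit vectors vanish, so the bound k
  of the phase bundle sums can be used.\<close>

lemma truncate_decompose:
  fixes v :: "('n::finite, 'r::finite) coords"
  assumes v: "truncate j v \<in> jet_coords j" and "j < k"
  shows "truncate j v \<iota> = (\<Sum>\<mu>\<in>UNIV. v (Base \<mu>) * base_unit \<mu> \<iota>) +
    (\<Sum>a\<in>UNIV. \<Sum>ms | length ms < k. v (Fld a ms) * truncate j (sym_unit a ms) \<iota>)"
proof (cases \<iota>)
  case (Base \<mu>)
  have "(\<Sum>\<nu>\<in>UNIV. v (Base \<nu>) * base_unit \<nu> \<iota>) = (\<Sum>\<nu>\<in>UNIV. if \<mu> = \<nu> then v (Base \<nu>) else 0)"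
    by (rule sum.cong) (auto simp: base_unit_def Base)
  then show ?thesis by (simp add: Base truncate_def sym_unit_def)
next
  case (Fld c ns)
  show ?thesis
  proof (cases "length ns \<le> j")
    case True
    let ?P = "{ks. mset ks = mset ns}"
    have fin: "finite ?P" by (rule finite_mset_eq_lists)
    have sub: "?P \<subseteq> {ms. length ms < k}"
      using True assms(2) by (auto dest: mset_eq_length)
    have vs: "v (Fld c ms) = v (Fld c ns)" if "ms \<in> ?P" for ms
      using jet_coords_sym[OF v, of ms ns c] that True mset_eq_length[of ms ns]
      by (simp add: truncate_def)
    have "(\<Sum>ms | length ms < k. v (Fld a ms) * truncate j (sym_unit a ms) \<iota>) =
        (if a = c then v (Fld c ns) else 0)" for a
    proof (cases "a = c")
      case False
      then show ?thesis using True by (simp add: Fld truncate_def sym_unit_def)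
    next
      case a: True
      have "(\<Sum>ms | length ms < k. v (Fld a ms) * truncate j (sym_unit a ms) \<iota>) =
          (\<Sum>ms\<in>?P. v (Fld a ms) * truncate j (sym_unit a ms) \<iota>)"
        by (rule sum.mono_neutral_right[OF finite_lists_below sub])
          (auto simp: Fld truncate_def sym_unit_def)
      also have "\<dots> = (\<Sum>ms\<in>?P. v (Fld c ns) / real (card ?P))"
      proof (rule sum.cong[OF refl])
        fix ms assume ms: "ms \<in> ?P"
        then show "v (Fld a ms) * truncate j (sym_unit a ms) \<iota> = v (Fld c ns) / real (card ?P)"
          using True vs[OF ms] a by (simp add: Fld truncate_def sym_unit_def)
      qed
      also have "\<dots> = v (Fld c ns)" using fin by auto
      finally show ?thesis using a by simp
    qed
    then show ?thesis using True by (simp add: Fld truncate_def base_unit_def)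
  qed (simp add: Fld truncate_def base_unit_def)
qed (simp_all add: truncate_def base_unit_def)

lemma rel_open_coord_domain:
  fixes V :: "('n::finite, 'r::finite) coords set"
  assumes "open (snd (snd C) ` fst (snd C))"
  shows "rel_open V (coord_domain V C)"
proof -
  let ?f = "\<lambda>\<xi> :: ('n, 'r) coords. ((\<chi> \<mu>. \<xi> (Base \<mu>)) :: real^'n, (\<chi> a. \<xi> (Fld a [])) :: real^'r)"
  have "continuous_on UNIV ?f"
    by (intro continuous_on_Pair continuous_on_vec_lambda continuous_on_product_coordinates)
  then have "open (?f -` (snd (snd C) ` fst (snd C)))"
    by (rule open_vimage[OF assms])
  then show ?thesis
    unfolding rel_open_def coord_domain_def
    by (intro exI[of _ "?f -` (snd (snd C) ` fst (snd C))"]) auto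
qed

lemma truncate_coord_domain:
  assumes "\<xi> \<in> coord_domain V C" "truncate j \<xi> \<in> jet_coords j"
  shows "truncate j \<xi> \<in> coord_domain (jet_coords j) C"
  using assms by (simp add: coord_domain_def truncate_def)

lemma smooth_coords_truncate:
  assumes V: "coord_space V" "rel_open V S"
  shows "smooth_coords V S (\<lambda>\<xi>. truncate j \<xi> \<iota>)"
proof -
  have "(\<lambda>\<xi>. truncate j \<xi> \<iota>) = (\<lambda>\<xi>. \<xi> \<iota>) \<or> (\<lambda>\<xi>::('a, 'b) coords. truncate j \<xi> \<iota>) = (\<lambda>_. 0)"
    by (cases \<iota>) (auto simp: truncate_def fun_eq_iff)
  then show ?thesis
    using smooth_coords_coord[OF V, of \<iota>] smooth_coords_const[OF V, of 0] by metis
qed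

section \<open>Symmetrisation\<close>

text \<open>Double counting over pairs of a rearrangement ks and a permutation \<pi>. For fixed ks
  the inner sum is the one for ms, by composition with a permutation; for fixed \<pi> the map
  \<open>permute_list \<pi>\<close> only reorders the rearrangements. This links the permutation
  average in \<open>sym_mom\<close> with the weights of \<open>sym_unit\<close>.\<close>

lemma sum_permutations_average:
  fixes g :: "'a list \<Rightarrow> real"
  shows "(\<Sum>\<pi> | \<pi> permutes {..<length ms}. g (permute_list \<pi> ms)) / fact (length ms) =
    (\<Sum>ks | mset ks = mset ms. g ks) / real (card {ks. mset ks = mset ms})"
proof -
  let ?P = "{ks. mset ks = mset ms}" and ?\<Pi> = "{\<pi>. \<pi> permutes {..<length ms}}"
  have fin: "finite ?P" by (rule finite_mset_eq_lists)
  have card0: "real (card ?P) \<noteq> 0" using fin by auto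
  have 1: "(\<Sum>\<pi>\<in>?\<Pi>. g (permute_list \<pi> ks)) = (\<Sum>\<pi>\<in>?\<Pi>. g (permute_list \<pi> ms))" if ks: "ks \<in> ?P" for ks
  proof -
    obtain \<rho> where \<rho>: "\<rho> permutes {..<length ms}" "permute_list \<rho> ms = ks"
      by (rule mset_eq_permutation[of ks ms]) (use ks in auto)
    have "(\<Sum>\<pi>\<in>?\<Pi>. g (permute_list \<pi> ms)) = (\<Sum>\<pi>\<in>?\<Pi>. g (permute_list (\<rho> \<circ> \<pi>) ms))"
      by (rule setum_permutations_compose_left[OF \<rho>(1)])
    also have "\<dots> = (\<Sum>\<pi>\<in>?\<Pi>. g (permute_list \<pi> ks))"
      by (rule sum.cong) (simp_all add: permute_list_compose \<rho>(2))
    finally show ?thesis by simp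
  qed
  have 2: "(\<Sum>ks\<in>?P. g (permute_list \<pi> ks)) = (\<Sum>ks\<in>?P. g ks)" if \<pi>: "\<pi> permutes {..<length ms}" for \<pi>
  proof (rule sum.reindex_bij_betw)
    have len: "length ks = length ms" if "ks \<in> ?P" for ks using that mset_eq_length[of ks ms] by simp
    have "inj_on (permute_list \<pi>) ?P"
    proof (rule inj_on_inverseI)
      fix ks assume ks: "ks \<in> ?P"
      have "permute_list (inv \<pi>) (permute_list \<pi> ks) = permute_list (\<pi> \<circ> inv \<pi>) ks"
        using permute_list_compose[of "inv \<pi>" ks \<pi>] permutes_inv[OF \<pi>] len[OF ks] by simp
      then show "permute_list (inv \<pi>) (permute_list \<pi> ks) = ks"
        using permutes_inv_o(1)[OF \<pi>] by simp
    qed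
    moreover have "permute_list \<pi> ` ?P \<subseteq> ?P"
    proof (rule image_subsetI)
      fix ks assume ks: "ks \<in> ?P"
      then show "permute_list \<pi> ks \<in> ?P" using \<pi> len[OF ks] by simp
    qed
    ultimately show "bij_betw (permute_list \<pi>) ?P ?P"
      using endo_inj_surj[OF fin] by (auto simp: bij_betw_def)
  qed
  have "(\<Sum>ks\<in>?P. \<Sum>\<pi>\<in>?\<Pi>. g (permute_list \<pi> ks)) = (\<Sum>ks\<in>?P. \<Sum>\<pi>\<in>?\<Pi>. g (permute_list \<pi> ms))"
    by (rule sum.cong[OF refl 1])
  then have "real (card ?P) * (\<Sum>\<pi>\<in>?\<Pi>. g (permute_list \<pi> ms)) = (\<Sum>ks\<in>?P. \<Sum>\<pi>\<in>?\<Pi>. g (permute_list \<pi> ks))"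
    by simp
  also have "\<dots> = (\<Sum>\<pi>\<in>?\<Pi>. \<Sum>ks\<in>?P. g (permute_list \<pi> ks))" by (rule sum.swap)
  also have "\<dots> = (\<Sum>\<pi>\<in>?\<Pi>. \<Sum>ks\<in>?P. g ks)" by (rule sum.cong[OF refl]) (rule 2, simp)
  also have "\<dots> = fact (length ms) * (\<Sum>ks\<in>?P. g ks)"
    using card_permutations[OF refl, of "{..<length ms}"] by simp
  finally show ?thesis using card0 by (simp add: field_simps)
qed

section \<open>Charts and sections\<close>

lemma chart_image_open:
  assumes "is_chart c" "open W" "W \<subseteq> fst c"
  shows "open (snd c ` W)"
proof -
  obtain g where g: "open (fst c)" "open (snd c ` fst c)"
    "homeomorphism (fst c) (snd c ` fst c) (snd c) g"
    using assms(1) by (auto simp: is_chart_def)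
  have "openin (top_of_set (fst c)) W"
    using assms(2,3) by (simp add: openin_open_eq g(1))
  from homeomorphism_imp_open_map[OF g(3) this] show ?thesis
    by (simp add: openin_open_eq g(2))
qed

lemma chart_inj: "is_chart c \<Longrightarrow> inj_on (snd c) (fst c)"
  unfolding is_chart_def homeomorphism_def by (metis inj_on_inverseI)

lemma chart_inv_apply: "is_chart c \<Longrightarrow> x \<in> fst c \<Longrightarrow> chart_inv c (snd c x) = x"
  by (simp add: chart_inv_def chart_inj)

lemma adaptedD:
  assumes "C \<in> adapted \<Phi>"
  shows "is_chart (fst C)" "is_chart (snd C)" "fst C \<in> charts (base_atlas \<Phi>)"
    "snd C \<in> charts (total_atlas \<Phi>)"
    and "e \<in> fst (snd C) \<Longrightarrow> proj \<Phi> e \<in> fst (fst C)"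
    and "e \<in> fst (snd C) \<Longrightarrow> fst (snd (snd C) e) = snd (fst C) (proj \<Phi> e)"
  using assms by (auto simp: adapted_def charts_def)

lemma adapted_rel_open: "C \<in> adapted \<Phi> \<Longrightarrow> rel_open V (coord_domain V C)"
  by (rule rel_open_coord_domain) (use adaptedD(2)[of C \<Phi>] in \<open>simp add: is_chart_def\<close>)

lemma adapted_at_iff: "C \<in> adapted_at \<Phi> e \<longleftrightarrow> C \<in> adapted \<Phi> \<and> e \<in> fst (snd C)"
  by (simp add: adapted_at_def)

definition section_domain where
  "section_domain C U f = snd (fst C) ` {x \<in> U. f x \<in> fst (snd C)}"

lemma section_domain:
  assumes C: "C \<in> adapted \<Phi>" and U: "open U" "continuous_on U f"
    and pf: "\<forall>x\<in>U. proj \<Phi> (f x) = x"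
  shows "open (section_domain C U f)"
    and "open {x \<in> U. f x \<in> fst (snd C)}"
    and "y \<in> section_domain C U f \<Longrightarrow> \<exists>x\<in>U. f x \<in> fst (snd C) \<and> y = snd (fst C) x \<and> chart_inv (fst C) y = x"
    and "x \<in> U \<Longrightarrow> f x \<in> fst (snd C) \<Longrightarrow> x \<in> fst (fst C)"
    and "x \<in> U \<Longrightarrow> f x \<in> fst (snd C) \<Longrightarrow> snd (fst C) x \<in> section_domain C U f"
proof -
  have sub: "x \<in> fst (fst C)" if "x \<in> U" "f x \<in> fst (snd C)" for x
    using adaptedD(5)[OF C that(2)] pf that(1) by simp
  then show "x \<in> U \<Longrightarrow> f x \<in> fst (snd C) \<Longrightarrow> x \<in> fst (fst C)" .
  have "open (fst (snd C))" using adaptedD(2)[OF C] by (simp add: is_chart_def)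
  then have "open (U \<inter> f -` fst (snd C))" using U by (intro continuous_open_preimage)
  moreover have "U \<inter> f -` fst (snd C) = {x \<in> U. f x \<in> fst (snd C)}" by auto
  ultimately show o: "open {x \<in> U. f x \<in> fst (snd C)}" by simp
  show "open (section_domain C U f)"
    unfolding section_domain_def
    by (rule chart_image_open[OF adaptedD(1)[OF C] o]) (use sub in auto)
  show "\<exists>x\<in>U. f x \<in> fst (snd C) \<and> y = snd (fst C) x \<and> chart_inv (fst C) y = x"
    if "y \<in> section_domain C U f"
    using that sub chart_inv_apply[OF adaptedD(1)[OF C]] by (auto simp: section_domain_def)
  show "x \<in> U \<Longrightarrow> f x \<in> fst (snd C) \<Longrightarrow> snd (fst C) x \<in> section_domain C U f"
    by (auto simp: section_domain_def)
qed

lemma carrier_restrict: "U \<subseteq> carrier A \<Longrightarrow> carrier (restrict_atlas U A) = U"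
  by (auto simp: carrier_def restrict_atlas_def)

lemma smooth_sectionD:
  assumes "smooth_section \<Phi> U f"
  shows "open U" "U \<subseteq> carrier (base_atlas \<Phi>)" "x \<in> U \<Longrightarrow> proj \<Phi> (f x) = x"
    "continuous_on U f" "f ` U \<subseteq> carrier (total_atlas \<Phi>)"
    "\<forall>x\<in>U. proj \<Phi> (f x) = x"
  using assms carrier_restrict[of U "base_atlas \<Phi>"]
  by (auto simp: smooth_section_def smooth_map_def)

text \<open>The atlases only give smoothness in their own charts; this is the passage to the charts of
  the maximal atlases.\<close>
lemma section_local_smooth:
  fixes \<Phi> :: "('m::{t2_space,second_countable_topology}, 'e::{t2_space,second_countable_topology},
    'n::finite, 'r::finite) fib_bundle"
  assumes at: "smooth_atlas (base_atlas \<Phi>)" "smooth_atlas (total_atlas \<Phi>)"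
    and f: "smooth_section \<Phi> U f" and C: "C \<in> adapted \<Phi>"
  shows "smooth_on (section_domain C U f) (\<lambda>y. snd (snd C) (f (chart_inv (fst C) y)))"
proof (rule smooth_on_local)
  fix y0 assume y0: "y0 \<in> section_domain C U f"
  obtain b c where bc: "C = (b, c)" by (cases C)
  note fD = smooth_sectionD[OF f]
  note sd = section_domain[OF C fD(1,4,6)]
  from sd(3)[OF y0] obtain x0 where x0: "x0 \<in> U" "f x0 \<in> fst c" "y0 = snd b x0"
    by (auto simp: bc)
  obtain b' where b': "b' \<in> base_atlas \<Phi>" "x0 \<in> fst b'"
    using fD(2) x0(1) by (auto simp: carrier_def)
  obtain d where d: "d \<in> total_atlas \<Phi>" "f x0 \<in> fst d"
    using fD(5) x0(1) by (auto simp: carrier_def)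
  have chb: "is_chart b" "compatible b b'" and chc: "is_chart c" "compatible c d"
    using adaptedD(1-4)[OF C] b' d by (auto simp: bc charts_def)
  have chb': "is_chart b'" and chd: "is_chart d"
    using at b' d by (auto simp: smooth_atlas_def)
  \<comment> \<open>A neighbourhood of x0 on which the adapted pair b, c and the atlas charts b', d
    are all available. There the local expression of f in (b, c) is the transition from b to b',
    then f in (b', d), then the transition from d to c.\<close>
  define W where "W = {x \<in> U. f x \<in> fst c} \<inter> fst b' \<inter> {x \<in> U. f x \<in> fst d}"
  have "open (U \<inter> f -` fst d)"
    using chd fD(1,4) by (intro continuous_open_preimage) (auto simp: is_chart_def)
  moreover have "U \<inter> f -` fst d = {x \<in> U. f x \<in> fst d}" by auto
  ultimately have oW: "open W"
    unfolding W_def using sd(2) chb' by (auto simp: bc is_chart_def)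
  have Wb: "W \<subseteq> fst b" using sd(4) by (auto simp: W_def bc)
  have Wb': "W \<subseteq> fst b'" by (auto simp: W_def)
  have oT: "open (snd b ` W)" by (rule chart_image_open[OF chb(1) oW Wb])
  have oT': "open (snd b' ` W)" by (rule chart_image_open[OF chb' oW Wb'])
  have oT'': "open (snd d ` (fst c \<inter> fst d))"
    using chart_image_open[OF chd, of "fst c \<inter> fst d"] chc(1) chd by (auto simp: is_chart_def)
  \<comment> \<open>Smoothness of a section refers to the atlas restricted to U. The inverse of the
    restricted chart is formed over a smaller set, hence the separate check \<open>inv_r\<close> on
    W.\<close>
  let ?r = "(fst b' \<inter> U, snd b')"
  have s1: "smooth_on (snd b ` W) (\<lambda>y. snd b' (chart_inv b y))"
    using chb(2) Wb Wb' unfolding compatible_def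
    by (auto elim!: smooth_on_subset)
  have "smooth_on (snd b' ` (fst b' \<inter> U \<inter> f -` fst d)) (\<lambda>y. snd d (f (chart_inv ?r y)))"
    using f b'(1) d(1) unfolding smooth_section_def smooth_map_def restrict_atlas_def by force
  then have s2: "smooth_on (snd b' ` W) (\<lambda>y. snd d (f (chart_inv ?r y)))"
    by (rule smooth_on_subset) (auto simp: W_def)
  have s3: "smooth_on (snd d ` (fst c \<inter> fst d)) (\<lambda>y. snd c (chart_inv d y))"
    using chc(2) by (simp add: compatible_def)
  have inv_b: "chart_inv b (snd b x) = x" if "x \<in> W" for x
    using that Wb chart_inv_apply[OF chb(1)] by auto
  have inv_r: "chart_inv ?r (snd b' x) = x" if "x \<in> W" for x
    using that chart_inj[OF chb'] inj_on_subset[of "snd b'" "fst b'" "fst b' \<inter> U"]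
    by (auto simp: chart_inv_def W_def intro!: inv_into_f_f)
  have inv_d: "chart_inv d (snd d (f x)) = f x" if "x \<in> W" for x
    using that chart_inv_apply[OF chd] by (auto simp: W_def)
  have s12: "smooth_on (snd b ` W) (\<lambda>y. snd d (f (chart_inv ?r (snd b' (chart_inv b y)))))"
    by (rule smooth_on_compose[OF oT oT' s1 s2]) (auto simp: inv_b)
  have "smooth_on (snd b ` W) (\<lambda>y. snd c (chart_inv d (snd d (f (chart_inv ?r (snd b' (chart_inv b y)))))))"
    by (rule smooth_on_compose[OF oT oT'' s12 s3]) (auto simp: inv_b inv_r W_def)
  then have "smooth_on (snd b ` W) (\<lambda>y. snd c (f (chart_inv b y)))"
    by (rule smooth_on_cong[OF oT]) (auto simp: inv_b inv_r inv_d)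
  moreover have "x0 \<in> W" using x0 b' d by (simp add: W_def)
  ultimately show "\<exists>T. open T \<and> y0 \<in> T \<and> smooth_on T (\<lambda>y. snd (snd C) (f (chart_inv (fst C) y)))"
    using oT x0(3) by (intro exI[of _ "snd b ` W"]) (auto simp: bc)
qed

section \<open>Jets in adapted charts\<close>

definition local_field where
  "local_field C f a = (\<lambda>y. snd (snd (snd C) (f (chart_inv (fst C) y))) $ a)"

lemma local_field_smooth:
  fixes \<Phi> :: "('m::{t2_space,second_countable_topology}, 'e::{t2_space,second_countable_topology},
    'n::finite, 'r::finite) fib_bundle"
  assumes at: "smooth_atlas (base_atlas \<Phi>)" "smooth_atlas (total_atlas \<Phi>)"
    and f: "smooth_section \<Phi> U f" and C: "C \<in> adapted \<Phi>"
  shows "smooth_on (section_domain C U f) (local_field C f a)"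
  unfolding local_field_def
  using smooth_on_linear_comp[OF section_domain(1)[OF C smooth_sectionD(1,4,6)[OF f]]
      bounded_linear_compose[OF bounded_linear_vec_nth bounded_linear_snd]
      section_local_smooth[OF at f C]] .

lemma jet_coord:
  assumes "C \<in> adapted_at \<Phi> (f x)"
  shows "snd (jet \<Phi> k f x) C (Base \<mu>) = snd (fst C) x $ \<mu>"
    and "snd (jet \<Phi> k f x) C (Fld a ms) =
      (if length ms \<le> k then partials ms (local_field C f a) (snd (fst C) x) else 0)"
    and "snd (jet \<Phi> k f x) C (Mom a ms l) = 0"
    and "snd (jet \<Phi> k f x) C (DFld a ms n) = 0"
    and "snd (jet \<Phi> k f x) C (DMom a ms l n) = 0"
  using assms by (simp_all add: jet_def local_field_def)

lemma fst_jet [simp]: "fst (jet \<Phi> k f x) = f x"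
  by (simp add: jet_def)

lemma jet_truncate:
  assumes "C \<in> adapted_at \<Phi> (f x)" "j \<le> k"
  shows "truncate j (snd (jet \<Phi> k f x) C) = snd (jet \<Phi> j f x) C"
proof
  show "truncate j (snd (jet \<Phi> k f x) C) \<iota> = snd (jet \<Phi> j f x) C \<iota>" for \<iota>
    using assms by (cases \<iota>) (simp_all add: truncate_def jet_coord)
qed

lemma jet_coord_domain:
  fixes \<Phi> :: "('m::{t2_space,second_countable_topology}, 'e::{t2_space,second_countable_topology},
    'n::finite, 'r::finite) fib_bundle"
  assumes at: "smooth_atlas (base_atlas \<Phi>)" "smooth_atlas (total_atlas \<Phi>)"
    and f: "smooth_section \<Phi> U f" and x: "x \<in> U" and C: "C \<in> adapted_at \<Phi> (f x)"
  shows "snd (jet \<Phi> k f x) C \<in> coord_domain (jet_coords k) C"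
proof -
  have C': "C \<in> adapted \<Phi>" "f x \<in> fst (snd C)" using C by (simp_all add: adapted_at_iff)
  note fD = smooth_sectionD[OF f]
  note sd = section_domain[OF C'(1) fD(1,4,6)]
  have "snd (jet \<Phi> k f x) C \<in> jet_coords k"
  proof (rule jet_coordsI)
    fix a ms ns assume ms: "mset ms = mset (ns :: 'n list)"
    show "snd (jet \<Phi> k f x) C (Fld a ms) = snd (jet \<Phi> k f x) C (Fld a ns)"
      using mset_eq_length[OF ms] partials_mset[OF sd(1) local_field_smooth[OF at f C'(1)]
          sd(5)[OF x C'(2)] ms, of a] by (simp add: jet_coord[where f = f and x = x, OF C])
  qed (simp_all add: jet_coord[where f = f and x = x, OF C])
  moreover have "((\<chi> \<mu>. snd (jet \<Phi> k f x) C (Base \<mu>)), (\<chi> a. snd (jet \<Phi> k f x) C (Fld a []))) =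
      snd (snd C) (f x)"
    using adaptedD(6)[OF C'] chart_inv_apply[OF adaptedD(1)[OF C'(1)] sd(4)[OF x C'(2)]] fD(3)[OF x]
    by (simp add: jet_coord[where f = f and x = x, OF C] partials_def local_field_def prod_eq_iff vec_eq_iff)
  ultimately show ?thesis using C'(2) by (simp add: coord_domain_def)
qed

section \<open>Total derivatives in coordinates\<close>

text \<open>The decomposition of a truncated vector into unit vectors, carried through the linearity
  of \<open>dir_deriv\<close>: the differential of H as a sum over all index values, with its base
  part added.\<close>

lemma dir_deriv_truncate_sum:
  fixes v :: "('n::finite, 'r::finite) coords"
  assumes D: "rel_open (jet_coords j) D" and H: "smooth_coords (jet_coords j) D H"
    and \<eta>: "\<eta> \<in> D" and v: "truncate j v \<in> jet_coords j" and jk: "j < k"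
  shows "dir_deriv (truncate j v) H \<eta> = (\<Sum>\<mu>\<in>UNIV. v (Base \<mu>) * dir_deriv (base_unit \<mu>) H \<eta>) +
    (\<Sum>a\<in>UNIV. \<Sum>ms | length ms < k. v (Fld a ms) * dir_deriv (truncate j (sym_unit a ms)) H \<eta>)"
proof -
  let ?u = "\<lambda>\<iota> :: ('n, 'r) coord. \<Sum>\<mu>\<in>UNIV. v (Base \<mu>) * base_unit \<mu> \<iota>"
  let ?I = "(UNIV :: 'r set) \<times> {ms :: 'n list. length ms < k}"
  let ?w = "\<lambda>\<iota>. \<Sum>(a, ms)\<in>?I. v (Fld a ms) * truncate j (sym_unit a ms) \<iota>"
  note J = coord_space_jet_coords
  have u: "?u \<in> jet_coords j"
    by (rule coord_space_sum[OF J base_unit_in])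
  have "(\<lambda>\<iota>. \<Sum>p\<in>?I. v (Fld (fst p) (snd p)) * truncate j (sym_unit (fst p) (snd p)) \<iota>) \<in> jet_coords j"
    by (rule coord_space_sum[OF J truncate_sym_unit_in])
  then have w: "?w \<in> jet_coords j" by (simp only: case_prod_beta')
  have "truncate j v = (\<lambda>\<iota>. ?u \<iota> + ?w \<iota>)"
    using truncate_decompose[OF v jk] by (simp add: sum.cartesian_product fun_eq_iff)
  then have "dir_deriv (truncate j v) H \<eta> = dir_deriv ?u H \<eta> + dir_deriv ?w H \<eta>"
    using dir_deriv_add[OF J D H u w \<eta>] by simp
  moreover have "dir_deriv ?u H \<eta> = (\<Sum>\<mu>\<in>UNIV. v (Base \<mu>) * dir_deriv (base_unit \<mu>) H \<eta>)"
    by (rule dir_deriv_sum[OF J D H base_unit_in \<eta> refl])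
  moreover have "dir_deriv ?w H \<eta> = (\<Sum>p\<in>?I. v (Fld (fst p) (snd p)) *
      dir_deriv (truncate j (sym_unit (fst p) (snd p))) H \<eta>)"
    by (rule dir_deriv_sum[OF J D H truncate_sym_unit_in \<eta>]) (simp add: case_prod_beta')
  ultimately show ?thesis by (simp add: sum.cartesian_product case_prod_beta')
qed

lemma dir_deriv_truncate: "dir_deriv X (\<lambda>\<xi>. G (truncate j \<xi>)) \<xi> = dir_deriv (truncate j X) G (truncate j \<xi>)"
  by (rule dir_deriv_precompose) (rule truncate_line)

lemma smooth_coords_compose_truncate:
  fixes V :: "('n::finite, 'r::finite) coords set"
  assumes V: "coord_space V" "rel_open V S" and D: "rel_open (jet_coords j) D"
    and TS: "\<And>\<xi>. \<xi> \<in> S \<Longrightarrow> truncate j \<xi> \<in> D" and G: "smooth_coords (jet_coords j) D G"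
  shows "smooth_coords V S (\<lambda>\<xi>. G (truncate j \<xi>))"
  by (rule smooth_coords_compose[OF coord_space_jet_coords D V G smooth_coords_truncate[OF V] TS])

text \<open>The coordinate \<^term>\<open>\<kappa> b ns\<close> plays the role of the derivative of \<^term>\<open>Fld b ns\<close> in the
  direction n: it is \<^term>\<open>Fld b (ns @ [n])\<close> on jets and \<^term>\<open>DFld b ns n\<close> on first jets of
  sections of the phase bundle.\<close>

definition vertical_dir :: "('r \<Rightarrow> 'n list \<Rightarrow> ('n, 'r) coord) \<Rightarrow> ('n, 'r) coords \<Rightarrow> ('n, 'r) coords" where
  "vertical_dir \<kappa> X = (\<lambda>\<iota>. case \<iota> of Fld b ns \<Rightarrow> X (\<kappa> b ns) | _ \<Rightarrow> 0)"

definition total_dir :: "'n \<Rightarrow> ('r \<Rightarrow> 'n list \<Rightarrow> ('n, 'r) coord) \<Rightarrow> ('n, 'r) coords \<Rightarrow> ('n, 'r) coords" where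
  "total_dir n \<kappa> \<xi> = (\<lambda>\<iota>. base_unit n \<iota> + vertical_dir \<kappa> \<xi> \<iota>)"

lemma truncate_total_dir:
  "truncate j (total_dir n \<kappa> \<xi>) = (\<lambda>\<iota>. base_unit n \<iota> + truncate j (vertical_dir \<kappa> \<xi>) \<iota>)"
  by (auto simp: truncate_def total_dir_def base_unit_def fun_eq_iff split: coord.split)

lemma truncate_total_dir_in:
  fixes \<xi> :: "('n::finite, 'r::finite) coords"
  assumes "truncate j (vertical_dir \<kappa> \<xi>) \<in> jet_coords j"
  shows "truncate j (total_dir n \<kappa> \<xi>) \<in> jet_coords j"
  unfolding truncate_total_dir
  using coord_space_line[OF coord_space_jet_coords base_unit_in assms, of n 1] by simp

lemma total_dir_coord:
  "total_dir n \<kappa> \<xi> (Base \<mu>) = (if \<mu> = n then 1 else 0)" "total_dir n \<kappa> \<xi> (Fld b ns) = \<xi> (\<kappa> b ns)"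
  by (simp_all add: total_dir_def base_unit_def vertical_dir_def)

lemma vertical_dir_coord:
  "vertical_dir \<kappa> \<xi> (Base \<mu>) = 0" "vertical_dir \<kappa> \<xi> (Fld b ns) = \<xi> (\<kappa> b ns)"
  by (simp_all add: vertical_dir_def)

section \<open>Total derivatives in jet and in first-jet coordinates\<close>

context
  fixes V S :: "('n::finite, 'r::finite) coords set" and D :: "('n, 'r) coords set"
    and j k :: nat and \<kappa> :: "'r \<Rightarrow> 'n list \<Rightarrow> ('n, 'r) coord"
    and H :: "('n, 'r) coords \<Rightarrow> real" and n :: 'n
  assumes V: "coord_space V" "rel_open V S" and D: "rel_open (jet_coords j) D" and jk: "j < k"
    and H: "smooth_coords (jet_coords j) D H"
    and TV: "\<And>X. X \<in> V \<Longrightarrow> truncate j X \<in> jet_coords j"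
    and TS: "\<And>\<xi>. \<xi> \<in> S \<Longrightarrow> truncate j \<xi> \<in> D"
    and \<kappa>V: "\<And>X. X \<in> V \<Longrightarrow> truncate j (vertical_dir \<kappa> X) \<in> jet_coords j"
begin

text \<open>The coefficient of the base unit vectors is 1 in direction n and 0 otherwise; the field
  coefficients are the \<kappa>-coordinates. The assumptions of the context are met by
  \<open>jet_coords k\<close> with \<open>Fld b (ns @ [n])\<close> and by
  \<open>pre_inf_coords k\<close> with \<open>DFld b ns n\<close>.\<close>

lemma total_derivative_expand:
  assumes G: "smooth_coords (jet_coords j) D G" and \<xi>: "\<xi> \<in> S"
  shows "dir_deriv (truncate j (total_dir n \<kappa> \<xi>)) G (truncate j \<xi>) =
    dir_deriv (base_unit n) G (truncate j \<xi>) + (\<Sum>a\<in>UNIV. \<Sum>ms | length ms < k.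
      \<xi> (\<kappa> a ms) * dir_deriv (truncate j (sym_unit a ms)) G (truncate j \<xi>))"
proof -
  have "\<xi> \<in> V" using \<xi> rel_open_subset[OF V(2)] by auto
  have "(\<Sum>\<mu>\<in>UNIV. total_dir n \<kappa> \<xi> (Base \<mu>) * dir_deriv (base_unit \<mu>) G (truncate j \<xi>)) =
      (\<Sum>\<mu>\<in>UNIV. if \<mu> = n then dir_deriv (base_unit \<mu>) G (truncate j \<xi>) else 0)"
    by (rule sum.cong) (auto simp: total_dir_coord)
  then show ?thesis
    using dir_deriv_truncate_sum[OF D G TS[OF \<xi>] truncate_total_dir_in[OF \<kappa>V[OF \<open>\<xi> \<in> V\<close>], of n] jk]
    by (simp add: total_dir_coord)
qed

lemma vertical_derivative_expand:
  assumes G: "smooth_coords (jet_coords j) D G" and \<eta>: "\<eta> \<in> D" and X: "X \<in> V"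
  shows "dir_deriv (truncate j (vertical_dir \<kappa> X)) G \<eta> = (\<Sum>a\<in>UNIV. \<Sum>ms | length ms < k.
      X (\<kappa> a ms) * dir_deriv (truncate j (sym_unit a ms)) G \<eta>)"
  using dir_deriv_truncate_sum[OF D G \<eta> \<kappa>V[OF X] jk] by (simp add: vertical_dir_coord)

text \<open>The direction of the total derivative depends on \<xi>, so smoothness cannot be read off
  from \<open>smooth_coords\<close>. In the expanded form all directions are fixed and the
  dependence sits in the coordinate factors.\<close>

lemma smooth_total_derivative_aux:
  "smooth_coords V S (\<lambda>\<xi>. dir_deriv (base_unit n) H (truncate j \<xi>) + (\<Sum>a\<in>UNIV. \<Sum>ms | length ms < k.
      \<xi> (\<kappa> a ms) * dir_deriv (truncate j (sym_unit a ms)) H (truncate j \<xi>)))"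
  by (intro smooth_coords_add smooth_coords_sum smooth_coords_mult V smooth_coords_coord
      smooth_coords_compose_truncate[OF V D TS] smooth_coordsD(3)[OF H] base_unit_in truncate_sym_unit_in)

lemma smooth_total_derivative:
  "smooth_coords V S (\<lambda>\<xi>. dir_deriv (truncate j (total_dir n \<kappa> \<xi>)) H (truncate j \<xi>))"
  by (rule smooth_coords_cong[OF V smooth_total_derivative_aux]) (simp add: total_derivative_expand[OF H])

text \<open>The product rule on the expanded form: differentiating the factors
  \<open>\<xi> (\<kappa> a ms)\<close> gives the vertical term. It is used with X a symmetrised unit
  vector for the Euler-Lagrange equations, and with H a derivative of F and X a tangent vector for
  the two-form.\<close>

lemma dir_deriv_total_derivative:
  assumes X: "X \<in> V" and \<xi>: "\<xi> \<in> S"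
  shows "dir_deriv X (\<lambda>\<xi>. dir_deriv (truncate j (total_dir n \<kappa> \<xi>)) H (truncate j \<xi>)) \<xi> =
    dir_deriv (truncate j (total_dir n \<kappa> \<xi>)) (dir_deriv (truncate j X) H) (truncate j \<xi>) +
    dir_deriv (truncate j (vertical_dir \<kappa> X)) H (truncate j \<xi>)"
proof -
  let ?e = "\<lambda>a ms. truncate j (sym_unit a ms)" and ?T = "truncate j"
  note J = coord_space_jet_coords
  note e = smooth_coordsD(3)[OF H truncate_sym_unit_in]
  have com: "dir_deriv (?T X) (dir_deriv u H) (?T \<xi>) = dir_deriv u (dir_deriv (?T X) H) (?T \<xi>)"
    if "u \<in> jet_coords j" for u
    by (rule dir_deriv_commute[OF J D H TV[OF X] that TS[OF \<xi>]])
  have sp: "smooth_coords V S (\<lambda>\<xi>. \<xi> (\<kappa> a ms) * dir_deriv (?e a ms) H (?T \<xi>))" for a ms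
    by (intro smooth_coords_mult V smooth_coords_coord smooth_coords_compose_truncate[OF V D TS] e)
  have d: "dir_deriv X (\<lambda>\<xi>. \<xi> (\<kappa> a ms) * dir_deriv (?e a ms) H (?T \<xi>)) \<xi> =
      X (\<kappa> a ms) * dir_deriv (?e a ms) H (?T \<xi>) +
      \<xi> (\<kappa> a ms) * dir_deriv (?e a ms) (dir_deriv (?T X) H) (?T \<xi>)" for a ms
    using dir_deriv_mult[OF V smooth_coords_coord[OF V] smooth_coords_compose_truncate[OF V D TS e] X \<xi>]
    by (simp add: dir_deriv_coord dir_deriv_truncate com[OF truncate_sym_unit_in])
  have "dir_deriv X (\<lambda>\<xi>. dir_deriv (?T (total_dir n \<kappa> \<xi>)) H (?T \<xi>)) \<xi> =
      dir_deriv X (\<lambda>\<xi>. dir_deriv (base_unit n) H (?T \<xi>) + (\<Sum>a\<in>UNIV. \<Sum>ms | length ms < k.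
      \<xi> (\<kappa> a ms) * dir_deriv (?e a ms) H (?T \<xi>))) \<xi>"
    by (rule dir_deriv_cong[OF V X \<xi>]) (rule total_derivative_expand[OF H])
  also have "\<dots> = dir_deriv X (\<lambda>\<xi>. dir_deriv (base_unit n) H (?T \<xi>)) \<xi> +
      dir_deriv X (\<lambda>\<xi>. \<Sum>a\<in>UNIV. \<Sum>ms | length ms < k. \<xi> (\<kappa> a ms) * dir_deriv (?e a ms) H (?T \<xi>)) \<xi>"
    by (intro dir_deriv_plus[OF V _ _ X \<xi>] smooth_coords_sum[OF V] sp
        smooth_coords_compose_truncate[OF V D TS] smooth_coordsD(3)[OF H] base_unit_in)
  also have "dir_deriv X (\<lambda>\<xi>. \<Sum>a\<in>UNIV. \<Sum>ms | length ms < k. \<xi> (\<kappa> a ms) * dir_deriv (?e a ms) H (?T \<xi>)) \<xi> =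
      (\<Sum>a\<in>UNIV. dir_deriv X (\<lambda>\<xi>. \<Sum>ms | length ms < k. \<xi> (\<kappa> a ms) * dir_deriv (?e a ms) H (?T \<xi>)) \<xi>)"
    by (rule dir_deriv_of_sum[OF V _ X \<xi>]) (rule smooth_coords_sum[OF V sp])
  also have "\<dots> = (\<Sum>a\<in>UNIV. \<Sum>ms | length ms < k. dir_deriv X (\<lambda>\<xi>. \<xi> (\<kappa> a ms) * dir_deriv (?e a ms) H (?T \<xi>)) \<xi>)"
    by (rule sum.cong[OF refl]) (rule dir_deriv_of_sum[OF V sp X \<xi>])
  also have "\<dots> = (\<Sum>a\<in>UNIV. \<Sum>ms | length ms < k. X (\<kappa> a ms) * dir_deriv (?e a ms) H (?T \<xi>)) +
      (\<Sum>a\<in>UNIV. \<Sum>ms | length ms < k. \<xi> (\<kappa> a ms) * dir_deriv (?e a ms) (dir_deriv (?T X) H) (?T \<xi>))"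
    by (simp add: d sum.distrib)
  also have "dir_deriv X (\<lambda>\<xi>. dir_deriv (base_unit n) H (?T \<xi>)) \<xi> =
      dir_deriv (base_unit n) (dir_deriv (?T X) H) (?T \<xi>)"
    by (simp add: dir_deriv_truncate com[OF base_unit_in])
  finally show ?thesis
    using total_derivative_expand[OF smooth_coordsD(3)[OF H TV[OF X]] \<xi>]
      vertical_derivative_expand[OF H TS[OF \<xi>] X] by simp
qed

end

section \<open>The shift of momenta\<close>

text \<open>The parameter j stands for l - 1, the order of the jets on which F is defined, and
  \<open>jk\<close> for the bound of l by k.\<close>

locale current_on_jets =
  fixes \<Phi> :: "('m::{t2_space,second_countable_topology},
                'e::{t2_space,second_countable_topology}, 'n::finite, 'r::finite) fib_bundle"
    and k j :: nat and F :: "('m, 'e, 'n, 'r) current"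
  assumes jk: "j < k" and base_atlas: "smooth_atlas (base_atlas \<Phi>)"
    and total_atlas: "smooth_atlas (total_atlas \<Phi>)" and current: "is_current \<Phi> j F"
begin

abbreviation "J \<equiv> jet_coords j :: ('n, 'r) coords set"
abbreviation "Dom C \<equiv> coord_domain J C"
abbreviation "T \<equiv> truncate j :: ('n, 'r) coords \<Rightarrow> ('n, 'r) coords"
abbreviation "field_unit a ms \<equiv> T (sym_unit a ms)"
abbreviation "phase_section U \<sigma> \<equiv> bundle_section \<Phi> (phase_bundle \<Phi> k) U \<sigma>"
abbreviation "PI \<equiv> pre_inf_phase \<Phi> k"
abbreviation "PI_curve \<gamma> \<equiv> fibre_curve \<Phi> PI \<gamma>"
abbreviation "PI_tangent z \<equiv> tangent_vectors \<Phi> PI z"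

lemma Dom_open: "C \<in> adapted \<Phi> \<Longrightarrow> rel_open J (Dom C)"
  by (rule adapted_rel_open)

lemma F_smooth: "C \<in> adapted \<Phi> \<Longrightarrow> smooth_coords J (Dom C) (F C l)"
  using current by (simp add: is_current_def)

definition shift_amount where
  "shift_amount C a ms l \<xi> = dir_deriv (field_unit a ms) (F C l) (T \<xi>)"

text \<open>The derivative of \<open>shift_amount\<close> in direction n along a section whose first
  jet has coordinates \<xi>, as the chain rule gives it; the derivatives of the field coordinates
  are read off from \<open>DFld\<close>.\<close>

definition shift_derivative where
  "shift_derivative C a ms l n \<xi> =
     dir_deriv (T (total_dir n (\<lambda>b ns. DFld b ns n) \<xi>)) (dir_deriv (field_unit a ms) (F C l)) (T \<xi>)"

text \<open>A real factor s is included so that the inverse of \<^term>\<open>shift s\<close> is \<^term>\<open>shift (- s)\<close>.\<close>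

definition shift :: "real \<Rightarrow> ('m, 'e, 'n, 'r) point \<Rightarrow> ('m, 'e, 'n, 'r) point" where
  "shift s z = (fst z, \<lambda>C \<iota>. case \<iota> of
      Mom a ms l \<Rightarrow> snd z C \<iota> + (if C \<in> adapted_at \<Phi> (fst z) \<and> length ms < k
         then s * shift_amount C a ms l (snd z C) else 0)
    | _ \<Rightarrow> snd z C \<iota>)"

text \<open>An explicit coordinate form of the prolonged shift, which \<open>prolongation\<close>
  describes only through representing sections. The two are identified in
  \<open>prolongation_shift\<close>.\<close>

definition jet_shift_coords where
  "jet_shift_coords s C \<xi> = (\<lambda>\<iota>. case \<iota> of
      Mom a ms l \<Rightarrow> \<xi> \<iota> + (if length ms < k then s * shift_amount C a ms l \<xi> else 0)
    | DMom a ms l n \<Rightarrow> \<xi> \<iota> + (if length ms < k then s * shift_derivative C a ms l n \<xi> else 0)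
    | _ \<Rightarrow> \<xi> \<iota>)"

definition jet_shift :: "real \<Rightarrow> ('m, 'e, 'n, 'r) point \<Rightarrow> ('m, 'e, 'n, 'r) point" where
  "jet_shift s z =
     (fst z, \<lambda>C. if C \<in> adapted_at \<Phi> (fst z) then jet_shift_coords s C (snd z C) else snd z C)"

lemma shift_simps [simp]:
  "fst (shift s z) = fst z"
  "snd (shift s z) C (Base \<mu>) = snd z C (Base \<mu>)"
  "snd (shift s z) C (Fld a ms) = snd z C (Fld a ms)"
  "snd (shift s z) C (DFld a ms n) = snd z C (DFld a ms n)"
  "snd (shift s z) C (DMom a ms l n) = snd z C (DMom a ms l n)"
  "snd (shift s z) C (Mom a ms l) = snd z C (Mom a ms l) +
    (if C \<in> adapted_at \<Phi> (fst z) \<and> length ms < k then s * shift_amount C a ms l (snd z C) else 0)"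
  by (simp_all add: shift_def)

lemma jet_shift_simps [simp]:
  "fst (jet_shift s z) = fst z"
  "snd (jet_shift s z) C (Base \<mu>) = snd z C (Base \<mu>)"
  "snd (jet_shift s z) C (Fld a ms) = snd z C (Fld a ms)"
  "snd (jet_shift s z) C (DFld a ms n) = snd z C (DFld a ms n)"
  "snd (jet_shift s z) C (Mom a ms l) = snd z C (Mom a ms l) +
    (if C \<in> adapted_at \<Phi> (fst z) \<and> length ms < k then s * shift_amount C a ms l (snd z C) else 0)"
  "snd (jet_shift s z) C (DMom a ms l n) = snd z C (DMom a ms l n) +
    (if C \<in> adapted_at \<Phi> (fst z) \<and> length ms < k then s * shift_derivative C a ms l n (snd z C) else 0)"
  by (simp_all add: jet_shift_def jet_shift_coords_def)

lemma fld_partial_pull_back: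
  "fld_partial a ms (pull_back j F C l) \<xi> = shift_amount C a ms l \<xi>"
  unfolding fld_partial_def pull_back_def shift_amount_def by (rule dir_deriv_truncate)

lemma truncate_jet_part: "T (snd (jet_part z) C) = T (snd z C)"
  by (auto simp: truncate_def jet_part_def fun_eq_iff split: coord.split)

lemma shift_amount_truncate: "T \<xi> = T \<eta> \<Longrightarrow> shift_amount C a ms l \<xi> = shift_amount C a ms l \<eta>"
  by (simp add: shift_amount_def)

text \<open>One map evaluates F on the jet part, the other on all coordinates; both truncate to
  order j first, and truncation forgets the momenta.\<close>

lemma momentum_shift_eq: "momentum_shift \<Phi> k (pull_back j F) = shift 1"
proof
  show "momentum_shift \<Phi> k (pull_back j F) z = shift 1 z" for z
    by (auto simp: momentum_shift_def shift_def fun_eq_iff fld_partial_pull_back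
        shift_amount_truncate[OF truncate_jet_part] split: coord.split)
qed

lemma truncate_cong:
  assumes "\<And>\<mu>. \<xi> (Base \<mu>) = \<eta> (Base \<mu>)" "\<And>a ms. length ms \<le> j \<Longrightarrow> \<xi> (Fld a ms) = \<eta> (Fld a ms)"
  shows "T \<xi> = T \<eta>"
  using assms by (auto simp: truncate_def fun_eq_iff split: coord.split)

text \<open>The amounts added to \<open>Mom\<close> and \<open>DMom\<close> are functions of the
  base, field and \<open>DFld\<close> coordinates, which the shift leaves alone. The second shift
  therefore subtracts exactly what the first one added.\<close>

lemma jet_shift_inverse: "jet_shift (- s) (jet_shift s z) = z"
proof -
  have T: "T (snd (jet_shift s z) C) = T (snd z C)" for C by (rule truncate_cong) simp_all
  have D: "total_dir n (\<lambda>b ns. DFld b ns n) (snd (jet_shift s z) C) =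
      total_dir n (\<lambda>b ns. DFld b ns n) (snd z C)" for n C
    by (auto simp: total_dir_def vertical_dir_def fun_eq_iff split: coord.split)
  have "snd (jet_shift (- s) (jet_shift s z)) C \<iota> = snd z C \<iota>" for C \<iota>
    by (cases \<iota>) (simp_all add: shift_amount_def shift_derivative_def T D)
  then show ?thesis by (simp add: prod_eq_iff fun_eq_iff)
qed

lemma jet_shift_inverse': "jet_shift s (jet_shift (- s) z) = z"
  using jet_shift_inverse[of "- s" z] by simp

end

section \<open>Invariance of the phase bundle under the shift\<close>

lemma n1_form_atD:
  assumes "n1_form_at \<Phi> e \<alpha>" "C \<in> adapted_at \<Phi> e" "C' \<in> adapted_at \<Phi> e"
  shows "\<alpha> C' = det (base_jacobian C' C (proj \<Phi> e)) *\<^sub>R (base_jacobian C C' (proj \<Phi> e) *v \<alpha> C)"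
  using assms(1)[unfolded n1_form_at_def, rule_format, OF assms(2,3)] .

lemma n1_form_at_cong:
  assumes "n1_form_at \<Phi> e \<alpha>" "\<And>C. C \<in> adapted_at \<Phi> e \<Longrightarrow> \<beta> C = \<alpha> C"
  shows "n1_form_at \<Phi> e \<beta>"
  unfolding n1_form_at_def
proof (intro ballI)
  fix C C' assume C: "C \<in> adapted_at \<Phi> e" "C' \<in> adapted_at \<Phi> e"
  show "\<beta> C' = det (base_jacobian C' C (proj \<Phi> e)) *\<^sub>R (base_jacobian C C' (proj \<Phi> e) *v \<beta> C)"
    using n1_form_atD[OF assms(1) C] by (simp only: assms(2)[OF C(1)] assms(2)[OF C(2)])
qed

lemma n1_form_at_add:
  assumes "n1_form_at \<Phi> e \<alpha>" "n1_form_at \<Phi> e \<beta>"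
  shows "n1_form_at \<Phi> e (\<lambda>C. \<alpha> C + s *\<^sub>R \<beta> C)"
  unfolding n1_form_at_def
proof (intro ballI)
  fix C C' assume C: "C \<in> adapted_at \<Phi> e" "C' \<in> adapted_at \<Phi> e"
  let ?d = "det (base_jacobian C' C (proj \<Phi> e))" and ?M = "base_jacobian C C' (proj \<Phi> e)"
  have "\<alpha> C' = ?d *\<^sub>R (?M *v \<alpha> C)" "\<beta> C' = ?d *\<^sub>R (?M *v \<beta> C)"
    using n1_form_atD[OF assms(1) C] n1_form_atD[OF assms(2) C] .
  then show "\<alpha> C' + s *\<^sub>R \<beta> C' = ?d *\<^sub>R (?M *v (\<alpha> C + s *\<^sub>R \<beta> C))"
    by (simp add: matrix_vector_right_distrib matrix_vector_mult_scaleR algebra_simps)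
qed

lemma fibre_curve_eventually_adapted:
  assumes \<gamma>: "fibre_curve \<Phi> B \<gamma>" and C: "C \<in> adapted_at \<Phi> (fst (\<gamma> t))"
  shows "\<forall>\<^sub>F s in nhds t. C \<in> adapted_at \<Phi> (fst (\<gamma> s))"
    and "open {t. fst (\<gamma> t) \<in> fst (snd C)}"
proof -
  have C': "C \<in> adapted \<Phi>" "fst (\<gamma> t) \<in> fst (snd C)" using C by (simp_all add: adapted_at_iff)
  have "open (fst (snd C))" using adaptedD(2)[OF C'(1)] by (simp add: is_chart_def)
  then have "open ((\<lambda>t. fst (\<gamma> t)) -` fst (snd C))"
    using \<gamma> by (intro open_vimage) (simp_all add: fibre_curve_def)
  then show o: "open {t. fst (\<gamma> t) \<in> fst (snd C)}" by (simp add: vimage_def)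
  have "t \<in> {t. fst (\<gamma> t) \<in> fst (snd C)}" using C' by simp
  from eventually_nhds_in_open[OF o this]
  show "\<forall>\<^sub>F s in nhds t. C \<in> adapted_at \<Phi> (fst (\<gamma> s))"
    by eventually_elim (simp add: adapted_at_iff C'(1))
qed

lemma fibre_curve_DERIV:
  assumes \<gamma>: "fibre_curve \<Phi> B \<gamma>" and C: "C \<in> adapted_at \<Phi> (fst (\<gamma> t))"
  shows "((\<lambda>t. snd (\<gamma> t) C \<iota>) has_real_derivative velocity \<Phi> \<gamma> t C \<iota>) (at t)"
proof -
  have C': "C \<in> adapted \<Phi>" "fst (\<gamma> t) \<in> fst (snd C)" using C by (simp_all add: adapted_at_iff)
  have "smooth_on {t. fst (\<gamma> t) \<in> fst (snd C)} (\<lambda>t. snd (\<gamma> t) C \<iota>)"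
    using \<gamma> C'(1) by (simp add: fibre_curve_def)
  from smooth_onD(2)[OF this, of t] C'(2) have "(\<lambda>t. snd (\<gamma> t) C \<iota>) differentiable (at t)" by simp
  then show ?thesis using C by (simp add: velocity_def DERIV_deriv_iff_real_differentiable)
qed

lemma jet_bundle_base:
  assumes "z \<in> jet_bundle \<Phi> m" "C \<in> adapted_at \<Phi> (fst z)"
  shows "snd z C (Base \<mu>) = snd (fst C) (base_pt \<Phi> z) $ \<mu>"
  using assms unfolding jet_bundle_def
  by (auto simp: jet_coord base_pt_def dest: smooth_sectionD(3))

lemma truncate_DERIV:
  assumes "\<And>\<iota>. ((\<lambda>t. \<Xi> t \<iota>) has_real_derivative v \<iota>) (at t)"
  shows "((\<lambda>t. truncate j (\<Xi> t) \<iota>) has_real_derivative truncate j v \<iota>) (at t)"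
  by (cases \<iota>) (simp_all add: truncate_def assms)


lemma phase_bundleD:
  assumes "z \<in> phase_bundle \<Phi> k"
  shows "jet_part z \<in> jet_bundle \<Phi> (k - 1)"
    and "C \<notin> adapted_at \<Phi> (fst z) \<Longrightarrow> snd z C (Mom a ms l) = 0"
    and "length ms \<ge> k \<Longrightarrow> snd z C (Mom a ms l) = 0"
    and "mset ms = mset ns \<Longrightarrow> snd z C (Mom a ms l) = snd z C (Mom a ns l)"
    and "snd z C (DFld a ms n) = 0" and "snd z C (DMom a ms l n) = 0"
    and "X \<in> tangent_vectors \<Phi> (jet_bundle \<Phi> (k - 1)) (jet_part z) \<Longrightarrow>
        n1_form_at \<Phi> (fst z) (\<lambda>C. \<chi> l.
          \<Sum>a\<in>UNIV. \<Sum>ms | length ms < k. snd z C (Mom a ms l) * X C (Fld a ms))"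
proof -
  note d = assms[unfolded phase_bundle_def mem_Collect_eq]
  show "jet_part z \<in> jet_bundle \<Phi> (k - 1)" using d by (rule conjunct1)
  note d = d[THEN conjunct2]
  show "C \<notin> adapted_at \<Phi> (fst z) \<Longrightarrow> snd z C (Mom a ms l) = 0"
    and "length ms \<ge> k \<Longrightarrow> snd z C (Mom a ms l) = 0"
    using d[THEN conjunct1, rule_format, of C ms] by blast+
  note d = d[THEN conjunct2]
  show "mset ms = mset ns \<Longrightarrow> snd z C (Mom a ms l) = snd z C (Mom a ns l)"
    using d[THEN conjunct1, rule_format, of ms ns] by blast
  note d = d[THEN conjunct2]
  show "snd z C (DFld a ms n) = 0" using d[THEN conjunct1, rule_format] .
  note d = d[THEN conjunct2]
  show "snd z C (DMom a ms l n) = 0" using d[THEN conjunct1, rule_format] .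
  show "X \<in> tangent_vectors \<Phi> (jet_bundle \<Phi> (k - 1)) (jet_part z) \<Longrightarrow>
        n1_form_at \<Phi> (fst z) (\<lambda>C. \<chi> l.
          \<Sum>a\<in>UNIV. \<Sum>ms | length ms < k. snd z C (Mom a ms l) * X C (Fld a ms))"
    using d[THEN conjunct2, rule_format] .
qed

lemma phase_bundleI:
  assumes "jet_part z \<in> jet_bundle \<Phi> (k - 1)"
    and "\<And>C a ms l. C \<notin> adapted_at \<Phi> (fst z) \<Longrightarrow> snd z C (Mom a ms l) = 0"
    and "\<And>C a ms l. length ms \<ge> k \<Longrightarrow> snd z C (Mom a ms l) = 0"
    and "\<And>C a ms ns l. mset ms = mset ns \<Longrightarrow> snd z C (Mom a ms l) = snd z C (Mom a ns l)"
    and "\<And>C a ms n. snd z C (DFld a ms n) = 0" and "\<And>C a ms l n. snd z C (DMom a ms l n) = 0"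
    and "\<And>X. X \<in> tangent_vectors \<Phi> (jet_bundle \<Phi> (k - 1)) (jet_part z) \<Longrightarrow>
        n1_form_at \<Phi> (fst z) (\<lambda>C. \<chi> l.
          \<Sum>a\<in>UNIV. \<Sum>ms | length ms < k. snd z C (Mom a ms l) * X C (Fld a ms))"
  shows "z \<in> phase_bundle \<Phi> k"
  unfolding phase_bundle_def mem_Collect_eq
  by (intro conjI allI impI ballI; (elim disjE)?) (rule assms; assumption?)+

lemma jet_part_simps [simp]:
  "fst (jet_part z) = fst z"
  "snd (jet_part z) C (Base \<mu>) = snd z C (Base \<mu>)"
  "snd (jet_part z) C (Fld a ms) = snd z C (Fld a ms)"
  by (simp_all add: jet_part_def)

context current_on_jets
begin

lemma jet_bundle_coord_domain:
  assumes "z \<in> jet_bundle \<Phi> m" "C \<in> adapted_at \<Phi> (fst z)"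
  shows "snd z C \<in> coord_domain (jet_coords m) C"
proof -
  obtain f U x where "z = jet \<Phi> m f x" "smooth_section \<Phi> U f" "x \<in> U"
    using assms(1) by (auto simp: jet_bundle_def)
  then show ?thesis using jet_coord_domain[OF base_atlas total_atlas] assms(2) by auto
qed

lemma jet_bundle_truncate:
  assumes "z \<in> jet_bundle \<Phi> m" "j \<le> m"
  shows "\<exists>w\<in>jet_bundle \<Phi> j. fst w = fst z \<and> (\<forall>C\<in>adapted_at \<Phi> (fst z). T (snd z C) = snd w C)"
proof -
  obtain f U x where z: "z = jet \<Phi> m f x" "smooth_section \<Phi> U f" "x \<in> U"
    using assms(1) by (auto simp: jet_bundle_def)
  then have "jet \<Phi> j f x \<in> jet_bundle \<Phi> j" by (auto simp: jet_bundle_def)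
  then show ?thesis by (rule bexI[rotated]) (use z jet_truncate[OF _ assms(2)] in auto)
qed

lemma jet_bundle_truncate_in:
  assumes "z \<in> jet_bundle \<Phi> m" "j \<le> m" "C \<in> adapted_at \<Phi> (fst z)"
  shows "T (snd z C) \<in> Dom C"
  using jet_bundle_truncate[OF assms(1,2)] jet_bundle_coord_domain assms(3) by fastforce

lemma current_form:
  assumes "z \<in> jet_bundle \<Phi> m" "j \<le> m"
  shows "n1_form_at \<Phi> (fst z) (\<lambda>C. \<chi> \<mu>. F C \<mu> (T (snd z C)))"
proof -
  obtain w where w: "w \<in> jet_bundle \<Phi> j" "fst w = fst z"
      "\<forall>C\<in>adapted_at \<Phi> (fst z). T (snd z C) = snd w C"
    using jet_bundle_truncate[OF assms] by blast
  have "n1_form_at \<Phi> (fst z) (\<lambda>C. \<chi> \<mu>. F C \<mu> (snd w C))"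
    using current[unfolded is_current_def, THEN conjunct2, rule_format, OF w(1)] w(2) by simp
  then show ?thesis by (rule n1_form_at_cong) (simp add: w(3))
qed

lemma j_le: "j \<le> k - 1"
  using jk by simp

lemma phase_bundle_truncate:
  assumes "z \<in> phase_bundle \<Phi> k" "C \<in> adapted_at \<Phi> (fst z)"
  shows "T (snd z C) \<in> Dom C"
  using jet_bundle_truncate_in[OF phase_bundleD(1)[OF assms(1)] j_le, of C] assms(2)
  by (simp add: truncate_jet_part)

lemma shift_amount_smooth: "C \<in> adapted \<Phi> \<Longrightarrow> smooth_coords J (Dom C) (dir_deriv (field_unit a ms) (F C l))"
  by (rule smooth_coordsD(3)[OF F_smooth truncate_sym_unit_in])

lemma shift_amount_mset: "mset ms = mset ns \<Longrightarrow> shift_amount C a ms l \<xi> = shift_amount C a ns l \<xi>"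
  by (simp add: shift_amount_def sym_unit_mset[of ms ns])

text \<open>The chain rule for F along the curve. The velocity has no base component because the
  curve stays over one point of M, so only the field part of the differential remains. This gives
  the contracted shift a meaning independent of coordinates.\<close>

lemma shift_amount_contract:
  assumes \<gamma>: "fibre_curve \<Phi> (jet_bundle \<Phi> (k - 1)) \<gamma>" and C: "C \<in> adapted_at \<Phi> (fst (\<gamma> 0))"
  shows "((\<lambda>t. F C l (T (snd (\<gamma> t) C))) has_real_derivative
    (\<Sum>a\<in>UNIV. \<Sum>ms | length ms < k. shift_amount C a ms l (snd (\<gamma> 0) C) * velocity \<Phi> \<gamma> 0 C (Fld a ms)))
    (at 0)"
proof -
  have C': "C \<in> adapted \<Phi>" using C by (simp add: adapted_at_iff)
  let ?X = "velocity \<Phi> \<gamma> 0 C"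
  have mem: "\<gamma> t \<in> jet_bundle \<Phi> (k - 1)" and bp: "base_pt \<Phi> (\<gamma> t) = base_pt \<Phi> (\<gamma> 0)" for t
    using \<gamma> by (auto simp: fibre_curve_def)
  note ev = fibre_curve_eventually_adapted(1)[OF \<gamma> C]
  have evD: "\<forall>\<^sub>F t in nhds 0. T (snd (\<gamma> t) C) \<in> Dom C"
    using ev by eventually_elim (rule jet_bundle_truncate_in[OF mem j_le])
  note d = truncate_DERIV[OF fibre_curve_DERIV[OF \<gamma> C]]
  note J = coord_space_jet_coords
  have X: "T ?X \<in> J" and
    der: "((\<lambda>t. F C l (T (snd (\<gamma> t) C))) has_real_derivative dir_deriv (T ?X) (F C l) (T (snd (\<gamma> 0) C))) (at 0)"
    using smooth_coords_chain_real[OF J Dom_open[OF C'] F_smooth[OF C'] evD d] by simp_all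
  have base0: "?X (Base \<mu>) = 0" for \<mu>
  proof -
    have "\<forall>\<^sub>F t in nhds 0. snd (fst C) (base_pt \<Phi> (\<gamma> 0)) $ \<mu> = snd (\<gamma> t) C (Base \<mu>)"
      using ev
    proof eventually_elim
      case (elim t)
      show ?case using jet_bundle_base[OF mem elim] bp[of t] by simp
    qed
    from eventually_eq_DERIV[OF DERIV_const this] fibre_curve_DERIV[OF \<gamma> C]
    show ?thesis by (rule DERIV_unique[symmetric])
  qed
  have "dir_deriv (T ?X) (F C l) (T (snd (\<gamma> 0) C)) =
    (\<Sum>a\<in>UNIV. \<Sum>ms | length ms < k. shift_amount C a ms l (snd (\<gamma> 0) C) * ?X (Fld a ms))"
    unfolding dir_deriv_truncate_sum[OF Dom_open[OF C'] F_smooth[OF C'] jet_bundle_truncate_in[OF mem j_le C] X jk]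
    by (simp add: base0 shift_amount_def mult.commute)
  then show ?thesis using der by simp
qed

text \<open>The essential condition is the transformation law of the contraction with a vertical
  vector X. A curve with velocity X stays over one base point, so the Jacobians in the law for F are
  the same for all t, and differentiating that law at t = 0 gives the law for the shift.\<close>

lemma shift_in_phase_bundle:
  assumes z: "z \<in> phase_bundle \<Phi> k"
  shows "shift s z \<in> phase_bundle \<Phi> k"
proof (rule phase_bundleI)
  have jp: "jet_part (shift s z) = jet_part z"
    by (auto simp: jet_part_def fun_eq_iff split: coord.split)
  then show "jet_part (shift s z) \<in> jet_bundle \<Phi> (k - 1)" using phase_bundleD(1)[OF z] by simp
  fix C a ms l
  show "snd (shift s z) C (Mom a ms l) = 0" if "C \<notin> adapted_at \<Phi> (fst (shift s z))"
    using that phase_bundleD(2)[OF z] by simp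
  show "snd (shift s z) C (Mom a ms l) = 0" if "length ms \<ge> k"
    using that phase_bundleD(3)[OF z] by simp
  show "snd (shift s z) C (Mom a ms l) = snd (shift s z) C (Mom a ns l)" if "mset ms = mset ns" for ns
    using phase_bundleD(4)[OF z that] mset_eq_length[OF that] shift_amount_mset[OF that] by simp
  show "snd (shift s z) C (DFld a ms n) = 0" for n using phase_bundleD(5)[OF z] by simp
  show "snd (shift s z) C (DMom a ms l n) = 0" for n using phase_bundleD(6)[OF z] by simp
next
  fix X assume "X \<in> tangent_vectors \<Phi> (jet_bundle \<Phi> (k - 1)) (jet_part (shift s z))"
  then have X: "X \<in> tangent_vectors \<Phi> (jet_bundle \<Phi> (k - 1)) (jet_part z)"
    by (simp add: jet_part_def shift_def case_prod_beta cong: coord.case_cong)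
  then obtain \<gamma> where \<gamma>: "fibre_curve \<Phi> (jet_bundle \<Phi> (k - 1)) \<gamma>" "\<gamma> 0 = jet_part z"
    and Xv: "X = velocity \<Phi> \<gamma> 0" by (auto simp: tangent_vectors_def)
  have mem: "\<gamma> t \<in> jet_bundle \<Phi> (k - 1)" and bp: "base_pt \<Phi> (\<gamma> t) = base_pt \<Phi> (\<gamma> 0)" for t
    using \<gamma>(1) by (auto simp: fibre_curve_def)
  have e: "fst (\<gamma> 0) = fst z" using \<gamma>(2) by simp
  let ?b = "\<lambda>C. \<chi> l. \<Sum>a\<in>UNIV. \<Sum>ms | length ms < k.
    shift_amount C a ms l (snd (\<gamma> 0) C) * X C (Fld a ms)"
  have "n1_form_at \<Phi> (fst z) ?b"
    unfolding n1_form_at_def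
  proof (intro ballI)
    fix C C' assume C: "C \<in> adapted_at \<Phi> (fst z)" "C' \<in> adapted_at \<Phi> (fst z)"
    let ?d = "det (base_jacobian C' C (proj \<Phi> (fst z)))" and ?M = "base_jacobian C C' (proj \<Phi> (fst z))"
    have C0: "C \<in> adapted_at \<Phi> (fst (\<gamma> 0))" "C' \<in> adapted_at \<Phi> (fst (\<gamma> 0))" using C e by simp_all
    have "?b C' $ l = (?d *\<^sub>R (?M *v ?b C)) $ l" for l
    proof -
      have "((\<lambda>t. ?d * (\<Sum>m\<in>UNIV. ?M $ l $ m * F C m (T (snd (\<gamma> t) C)))) has_real_derivative
          ?d * (\<Sum>m\<in>UNIV. ?M $ l $ m * ?b C $ m)) (at 0)"
        using shift_amount_contract[OF \<gamma>(1) C0(1)]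
        by (intro DERIV_cmult DERIV_sum) (simp add: Xv)
      moreover have "\<forall>\<^sub>F t in nhds 0. ?d * (\<Sum>m\<in>UNIV. ?M $ l $ m * F C m (T (snd (\<gamma> t) C))) =
          F C' l (T (snd (\<gamma> t) C'))"
        using fibre_curve_eventually_adapted(1)[OF \<gamma>(1) C0(1)]
          fibre_curve_eventually_adapted(1)[OF \<gamma>(1) C0(2)]
      proof eventually_elim
        case (elim t)
        have "proj \<Phi> (fst (\<gamma> t)) = proj \<Phi> (fst z)" using bp[of t] e by (simp add: base_pt_def)
        with n1_form_atD[OF current_form[OF mem j_le] elim]
        have "(\<chi> \<mu>. F C' \<mu> (T (snd (\<gamma> t) C'))) = ?d *\<^sub>R (?M *v (\<chi> \<mu>. F C \<mu> (T (snd (\<gamma> t) C))))"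
          by (simp only:)
        then have "F C' l (T (snd (\<gamma> t) C')) = (?d *\<^sub>R (?M *v (\<chi> \<mu>. F C \<mu> (T (snd (\<gamma> t) C))))) $ l"
          by (drule_tac arg_cong[where f = "\<lambda>v. v $ l"]) (simp only: vec_lambda_beta)
        then show ?case by (simp add: matrix_vector_mult_def)
      qed
      ultimately have "((\<lambda>t. F C' l (T (snd (\<gamma> t) C'))) has_real_derivative
          ?d * (\<Sum>m\<in>UNIV. ?M $ l $ m * ?b C $ m)) (at 0)"
        by (rule eventually_eq_DERIV)
      from DERIV_unique[OF this shift_amount_contract[OF \<gamma>(1) C0(2)]]
      show ?thesis by (simp add: matrix_vector_mult_def Xv)
    qed
    then show "?b C' = ?d *\<^sub>R (?M *v ?b C)" by (simp add: vec_eq_iff)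
  qed
  from n1_form_at_add[OF phase_bundleD(7)[OF z X] this, of s]
  have "n1_form_at \<Phi> (fst z) (\<lambda>C. \<chi> l.
      \<Sum>a\<in>UNIV. \<Sum>ms | length ms < k. snd (shift s z) C (Mom a ms l) * X C (Fld a ms))"
  proof (rule n1_form_at_cong)
    fix C assume C: "C \<in> adapted_at \<Phi> (fst z)"
    have sa: "shift_amount C a ms l (snd (\<gamma> 0) C) = shift_amount C a ms l (snd z C)" for a ms l
      unfolding \<gamma>(2) by (rule shift_amount_truncate[OF truncate_jet_part])
    show "(\<chi> l. \<Sum>a\<in>UNIV. \<Sum>ms | length ms < k. snd (shift s z) C (Mom a ms l) * X C (Fld a ms)) =
      (\<chi> l. \<Sum>a\<in>UNIV. \<Sum>ms | length ms < k. snd z C (Mom a ms l) * X C (Fld a ms)) + s *\<^sub>R ?b C"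
      using C by (simp add: vec_eq_iff sa sum_distrib_left sum.distrib[symmetric] algebra_simps)
  qed
  then show "n1_form_at \<Phi> (fst (shift s z)) (\<lambda>C. \<chi> l.
      \<Sum>a\<in>UNIV. \<Sum>ms | length ms < k. snd (shift s z) C (Mom a ms l) * X C (Fld a ms))" by simp
qed

end

section \<open>Sections of the phase bundle and their first jets\<close>

lemma bundle_sectionD:
  assumes "bundle_section \<Phi> B U \<sigma>"
  shows "open U" "U \<subseteq> carrier (base_atlas \<Phi>)" "x \<in> U \<Longrightarrow> \<sigma> x \<in> B" "x \<in> U \<Longrightarrow> base_pt \<Phi> (\<sigma> x) = x"
    "continuous_on U (\<lambda>x. fst (\<sigma> x))" "\<forall>x\<in>U. proj \<Phi> (fst (\<sigma> x)) = x"
    "C \<in> adapted \<Phi> \<Longrightarrow> smooth_on (section_domain C U (\<lambda>x. fst (\<sigma> x)))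
        (\<lambda>y. snd (\<sigma> (chart_inv (fst C) y)) C \<iota>)"
  using assms by (simp_all add: bundle_section_def section_domain_def base_pt_def)

lemma smooth_on_truncate:
  fixes \<Xi> :: "'a::real_normed_vector \<Rightarrow> ('n, 'r) coords"
  assumes "\<And>\<iota>. smooth_on S (\<lambda>y. \<Xi> y \<iota>)"
  shows "smooth_on S (\<lambda>y. truncate j (\<Xi> y) \<iota>)"
proof (cases \<iota>)
  case (Fld a ms)
  then show ?thesis
    by (cases "length ms \<le> j") (simp_all add: truncate_def assms smooth_on_const)
qed (simp_all add: truncate_def assms smooth_on_const)

lemma truncate_has_derivative:
  fixes \<Xi> :: "'a::real_normed_vector \<Rightarrow> ('n, 'r) coords"
  assumes "\<And>\<iota>. ((\<lambda>y. \<Xi> y \<iota>) has_derivative \<Xi>' \<iota>) (at y)"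
  shows "((\<lambda>y. truncate j (\<Xi> y) \<iota>) has_derivative (\<lambda>h. truncate j (\<lambda>\<iota>. \<Xi>' \<iota> h) \<iota>)) (at y)"
proof (cases \<iota>)
  case (Fld a ms)
  then show ?thesis by (cases "length ms \<le> j") (simp_all add: truncate_def assms)
qed (simp_all add: truncate_def assms)

lemma partial_has_derivative: "(g has_derivative g') (at y) \<Longrightarrow> partial n g y = g' (axis n 1)"
  unfolding partial_def by (simp add: frechet_derivative_at[symmetric])

context current_on_jets
begin

context
  fixes U \<sigma>
  assumes \<sigma>: "phase_section U \<sigma>"
begin

private abbreviation "R C \<equiv> section_domain C U (\<lambda>x. fst (\<sigma> x))"

lemma section_chart:
  assumes "C \<in> adapted \<Phi>"
  shows "open (R C)"
    and "y \<in> R C \<Longrightarrow> \<exists>x\<in>U. C \<in> adapted_at \<Phi> (fst (\<sigma> x)) \<and> y = snd (fst C) x \<and> chart_inv (fst C) y = x"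
    and "x \<in> U \<Longrightarrow> C \<in> adapted_at \<Phi> (fst (\<sigma> x)) \<Longrightarrow>
      snd (fst C) x \<in> R C \<and> chart_inv (fst C) (snd (fst C) x) = x"
  using section_domain[OF assms bundle_sectionD(1,5,6)[OF \<sigma>]] assms
    chart_inv_apply[OF adaptedD(1)[OF assms]] by (auto simp: adapted_at_iff)

lemma section_truncate:
  assumes "C \<in> adapted \<Phi>" "y \<in> R C"
  shows "T (snd (\<sigma> (chart_inv (fst C) y)) C) \<in> Dom C"
  using section_chart(2)[OF assms] phase_bundle_truncate bundle_sectionD(3)[OF \<sigma>] by auto

lemma shift_amount_section_smooth:
  assumes C: "C \<in> adapted \<Phi>"
  shows "smooth_on (R C) (\<lambda>y. shift_amount C a ms l (snd (\<sigma> (chart_inv (fst C) y)) C))"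
  unfolding shift_amount_def
  by (rule smooth_on_smooth_coords[OF coord_space_jet_coords Dom_open[OF C] section_chart(1)[OF C]
        shift_amount_smooth[OF C] smooth_on_truncate[OF bundle_sectionD(7)[OF \<sigma> C]] section_truncate[OF C]])

lemma shift_bundle_section: "phase_section U (shift s \<circ> \<sigma>)"
  unfolding bundle_section_def
proof (intro conjI ballI allI)
  fix C \<iota> assume C: "C \<in> adapted \<Phi>"
  have "smooth_on (R C) (\<lambda>y. snd (shift s (\<sigma> (chart_inv (fst C) y))) C \<iota>)"
  proof (cases "\<exists>a ms l. \<iota> = Mom a ms l \<and> length ms < k")
    case False
    then have "(\<lambda>y. snd (shift s (\<sigma> (chart_inv (fst C) y))) C \<iota>) = (\<lambda>y. snd (\<sigma> (chart_inv (fst C) y)) C \<iota>)"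
      by (cases \<iota>) auto
    then show ?thesis using bundle_sectionD(7)[OF \<sigma> C] by simp
  next
    case True
    then obtain a ms l where \<iota>: "\<iota> = Mom a ms l" "length ms < k" by blast
    have "smooth_on (R C) (\<lambda>y. snd (\<sigma> (chart_inv (fst C) y)) C \<iota> +
        s * shift_amount C a ms l (snd (\<sigma> (chart_inv (fst C) y)) C))"
      by (intro smooth_on_add section_chart(1) C bundle_sectionD(7)[OF \<sigma> C] smooth_on_mult smooth_on_const
          shift_amount_section_smooth)
    then show ?thesis
    proof (rule smooth_on_cong[OF section_chart(1)[OF C]])
      fix y assume "y \<in> R C"
      from section_chart(2)[OF C this] have "C \<in> adapted_at \<Phi> (fst (\<sigma> (chart_inv (fst C) y)))" by auto
      then show "snd (\<sigma> (chart_inv (fst C) y)) C \<iota> +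
          s * shift_amount C a ms l (snd (\<sigma> (chart_inv (fst C) y)) C) =
          snd (shift s (\<sigma> (chart_inv (fst C) y))) C \<iota>" using \<iota> by simp
    qed
  qed
  then show "smooth_on (snd (fst C) ` {x \<in> U. fst ((shift s \<circ> \<sigma>) x) \<in> fst (snd C)})
      (\<lambda>y. snd ((shift s \<circ> \<sigma>) (chart_inv (fst C) y)) C \<iota>)"
    by (simp add: section_domain_def)
qed (use bundle_sectionD[OF \<sigma>] shift_in_phase_bundle in \<open>auto simp: base_pt_def\<close>)

context
  fixes x C
  assumes x: "x \<in> U" and C: "C \<in> adapted_at \<Phi> (fst (\<sigma> x))"
begin

lemma chart_adapted: "C \<in> adapted \<Phi>"
  using C by (simp add: adapted_at_iff)

lemma chart_point: "snd (fst C) x \<in> R C" "chart_inv (fst C) (snd (fst C) x) = x"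
  using section_chart(3)[OF chart_adapted x C] by simp_all

lemma coord_partial_base: "coord_partial \<sigma> C (Base \<mu>) n x = (if \<mu> = n then 1 else 0)"
proof -
  have "partial n (\<lambda>y. snd (\<sigma> (chart_inv (fst C) y)) C (Base \<mu>)) (snd (fst C) x) =
      partial n (\<lambda>y. y $ \<mu>) (snd (fst C) x)"
  proof (rule partial_cong[OF section_chart(1)[OF chart_adapted] chart_point(1)])
    show "(\<lambda>y. snd (\<sigma> (chart_inv (fst C) y)) C (Base \<mu>)) differentiable at (snd (fst C) x)"
      by (rule smooth_onD(2)[OF bundle_sectionD(7)[OF \<sigma> chart_adapted] chart_point(1)])
    fix y assume "y \<in> R C"
    from section_chart(2)[OF chart_adapted this] obtain x' where x': "x' \<in> U" "C \<in> adapted_at \<Phi> (fst (\<sigma> x'))"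
      "y = snd (fst C) x'" "chart_inv (fst C) y = x'" by blast
    show "snd (\<sigma> (chart_inv (fst C) y)) C (Base \<mu>) = y $ \<mu>"
      using jet_bundle_base[OF phase_bundleD(1)[OF bundle_sectionD(3)[OF \<sigma> x'(1)]], of C \<mu>]
        bundle_sectionD(4)[OF \<sigma> x'(1)] x' by (simp add: base_pt_def)
  qed
  also have "\<dots> = axis n 1 $ \<mu>"
    by (rule partial_has_derivative) (rule bounded_linear.has_derivative[OF bounded_linear_vec_nth has_derivative_ident])
  finally show ?thesis by (simp add: coord_partial_def axis_def)
qed

lemma first_jet_coord:
  "snd (first_jet \<Phi> \<sigma> x) C (Base \<mu>) = snd (\<sigma> x) C (Base \<mu>)"
  "snd (first_jet \<Phi> \<sigma> x) C (Fld a ms) = snd (\<sigma> x) C (Fld a ms)"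
  "snd (first_jet \<Phi> \<sigma> x) C (Mom a ms l) = snd (\<sigma> x) C (Mom a ms l)"
  "snd (first_jet \<Phi> \<sigma> x) C (DFld a ms n) = coord_partial \<sigma> C (Fld a ms) n x"
  "snd (first_jet \<Phi> \<sigma> x) C (DMom a ms l n) = coord_partial \<sigma> C (Mom a ms l) n x"
  using C by (simp_all add: first_jet_def)

text \<open>The chain rule in the chart. The derivative of the coordinate tuple in direction n has
  the unit vector n as its base part and the \<open>DFld\<close> coordinates of the first jet as its
  field part, so up to order j it is \<open>total_dir\<close>.\<close>

lemma coord_partial_shift:
  "coord_partial (shift s \<circ> \<sigma>) C (Mom a ms l) n x = coord_partial \<sigma> C (Mom a ms l) n x +
    (if length ms < k then s * shift_derivative C a ms l n (snd (first_jet \<Phi> \<sigma> x) C) else 0)"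
proof (cases "length ms < k")
  case False
  then show ?thesis by (simp add: coord_partial_def)
next
  case True
  let ?y = "snd (fst C) x" and ?\<Xi> = "\<lambda>y. snd (\<sigma> (chart_inv (fst C) y)) C"
  let ?v = "\<lambda>\<iota>. coord_partial \<sigma> C \<iota> n x" and ?H = "dir_deriv (field_unit a ms) (F C l)"
  note oR = section_chart(1)[OF chart_adapted]
  have d: "((\<lambda>y. ?\<Xi> y \<iota>) has_derivative frechet_derivative (\<lambda>y. ?\<Xi> y \<iota>) (at ?y)) (at ?y)" for \<iota>
    using smooth_onD(2)[OF bundle_sectionD(7)[OF \<sigma> chart_adapted] chart_point(1)] by (simp add: frechet_derivative_works)
  have ev: "\<forall>\<^sub>F y in nhds ?y. T (?\<Xi> y) \<in> Dom C"
    using eventually_nhds_in_open[OF oR chart_point(1)] by eventually_elim (rule section_truncate[OF chart_adapted])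
  have sa: "((\<lambda>y. shift_amount C a ms l (?\<Xi> y)) has_derivative
      (\<lambda>h. dir_deriv (T (\<lambda>\<iota>. frechet_derivative (\<lambda>y. ?\<Xi> y \<iota>) (at ?y) h)) ?H (T (?\<Xi> ?y)))) (at ?y)"
    unfolding shift_amount_def
    by (rule smooth_coords_chain(2)[OF coord_space_jet_coords Dom_open[OF chart_adapted]
        shift_amount_smooth[OF chart_adapted] ev truncate_has_derivative[OF d]])
  have "((\<lambda>y. ?\<Xi> y (Mom a ms l) + s * shift_amount C a ms l (?\<Xi> y)) has_derivative
      (\<lambda>h. frechet_derivative (\<lambda>y. ?\<Xi> y (Mom a ms l)) (at ?y) h +
        s * dir_deriv (T (\<lambda>\<iota>. frechet_derivative (\<lambda>y. ?\<Xi> y \<iota>) (at ?y) h)) ?H (T (?\<Xi> ?y)))) (at ?y)"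
    by (intro has_derivative_add d has_derivative_mult_right sa)
  moreover have "\<forall>\<^sub>F y in nhds ?y. ?\<Xi> y (Mom a ms l) + s * shift_amount C a ms l (?\<Xi> y) =
      snd ((shift s \<circ> \<sigma>) (chart_inv (fst C) y)) C (Mom a ms l)"
    using eventually_nhds_in_open[OF oR chart_point(1)]
  proof eventually_elim
    case (elim y)
    from section_chart(2)[OF chart_adapted elim] have "C \<in> adapted_at \<Phi> (fst (\<sigma> (chart_inv (fst C) y)))" by auto
    then show ?case using True by simp
  qed
  ultimately have "((\<lambda>y. snd ((shift s \<circ> \<sigma>) (chart_inv (fst C) y)) C (Mom a ms l)) has_derivative
      (\<lambda>h. frechet_derivative (\<lambda>y. ?\<Xi> y (Mom a ms l)) (at ?y) h +
        s * dir_deriv (T (\<lambda>\<iota>. frechet_derivative (\<lambda>y. ?\<Xi> y \<iota>) (at ?y) h)) ?H (T (?\<Xi> ?y)))) (at ?y)"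
    by (rule has_derivative_transform_nhds)
  from partial_has_derivative[OF this, of n]
  have "coord_partial (shift s \<circ> \<sigma>) C (Mom a ms l) n x = coord_partial \<sigma> C (Mom a ms l) n x +
      s * dir_deriv (T ?v) ?H (T (snd (\<sigma> x) C))"
    by (simp add: coord_partial_def partial_def chart_point(2))
  moreover have "T ?v = T (total_dir n (\<lambda>b ns. DFld b ns n) (snd (first_jet \<Phi> \<sigma> x) C))"
    by (rule truncate_cong) (simp_all add: total_dir_coord coord_partial_base first_jet_coord)
  moreover have "T (snd (first_jet \<Phi> \<sigma> x) C) = T (snd (\<sigma> x) C)"
    by (rule truncate_cong) (simp_all add: first_jet_coord)
  ultimately show ?thesis using True by (simp add: shift_derivative_def)
qed

end

text \<open>The right-hand side involves the section only through its first jet. This makes the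
  prolongation well defined and turns it into the explicit map \<open>jet_shift\<close>.\<close>

lemma first_jet_shift:
  assumes x: "x \<in> U"
  shows "first_jet \<Phi> (shift s \<circ> \<sigma>) x = jet_shift s (first_jet \<Phi> \<sigma> x)"
proof -
  have "snd (first_jet \<Phi> (shift s \<circ> \<sigma>) x) C \<iota> = snd (jet_shift s (first_jet \<Phi> \<sigma> x)) C \<iota>" for C \<iota>
  proof (cases "C \<in> adapted_at \<Phi> (fst (\<sigma> x))")
    case False
    then show ?thesis by (simp add: first_jet_def jet_shift_def)
  next
    case True
    have TT: "T (snd (first_jet \<Phi> \<sigma> x) C) = T (snd (\<sigma> x) C)"
      by (rule truncate_cong) (simp_all add: first_jet_coord[OF x True])
    have [simp]: "fst (first_jet \<Phi> \<sigma> x) = fst (\<sigma> x)" by (simp add: first_jet_def)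
    show ?thesis
    proof (cases \<iota>)
      case (DFld a ms n)
      then show ?thesis using True by (simp add: first_jet_def coord_partial_def)
    next
      case (DMom a ms l n)
      then show ?thesis using True coord_partial_shift[OF x True, of s a ms l n]
        by (simp add: first_jet_coord[OF x True]) (simp add: first_jet_def)
    next
      case (Mom a ms l)
      then show ?thesis using True shift_amount_truncate[OF TT]
        by (simp add: first_jet_coord[OF x True]) (simp add: first_jet_def)
    qed (use True in \<open>simp_all add: first_jet_def\<close>)
  qed
  then show ?thesis by (simp add: prod_eq_iff fun_eq_iff first_jet_def)
qed

end

section \<open>Euler-Lagrange equations\<close>


abbreviation "jet_dir l \<equiv> \<lambda>b ns. Fld b (ns @ [l])"

abbreviation "Dom\<^sub>k C \<equiv> coord_domain (jet_coords k :: ('n, 'r) coords set) C"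

lemma jet_coords_truncate: "X \<in> jet_coords k \<Longrightarrow> T X \<in> J"
  by (rule truncate_in_jet_coords) (rule jet_coords_sym)

lemma jet_coords_vertical: "X \<in> jet_coords k \<Longrightarrow> T (vertical_dir (jet_dir l) X) \<in> J"
  by (rule truncate_in_jet_coords) (simp only: vertical_dir_coord, rule jet_coords_sym, simp_all)

lemma jet_domain_truncate: "\<xi> \<in> Dom\<^sub>k C \<Longrightarrow> T \<xi> \<in> Dom C"
  by (rule truncate_coord_domain) (auto simp: coord_domain_def intro: jet_coords_truncate)


lemma total_div_eq:
  assumes C: "C \<in> adapted \<Phi>" and \<xi>: "\<xi> \<in> Dom\<^sub>k C"
  shows "total_div k (pull_back j F) C \<xi> =
    (\<Sum>l\<in>UNIV. dir_deriv (T (total_dir l (jet_dir l) \<xi>)) (F C l) (T \<xi>))"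
  unfolding total_div_def
proof (rule sum.cong[OF refl])
  fix l
  have "base_partial l (pull_back j F C l) \<xi> = dir_deriv (base_unit l) (F C l) (T \<xi>)"
    unfolding base_partial_def base_unit_def[symmetric] pull_back_def
    by (simp only: dir_deriv_truncate truncate_base_unit)
  then show "base_partial l (pull_back j F C l) \<xi> + (\<Sum>a\<in>UNIV. \<Sum>ms | length ms < k.
      fld_partial a ms (pull_back j F C l) \<xi> * \<xi> (Fld a (ms @ [l]))) =
      dir_deriv (T (total_dir l (jet_dir l) \<xi>)) (F C l) (T \<xi>)"
    using total_derivative_expand[where \<kappa> = "jet_dir l" and n = l, OF coord_space_jet_coords adapted_rel_open[OF C] Dom_open[OF C] jk
        F_smooth[OF C] jet_coords_truncate jet_domain_truncate jet_coords_vertical F_smooth[OF C] \<xi>]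
    by (simp add: fld_partial_pull_back shift_amount_def mult.commute)
qed

lemma smooth_total_div_summand:
  assumes C: "C \<in> adapted \<Phi>"
  shows "smooth_coords (jet_coords k) (Dom\<^sub>k C)
    (\<lambda>\<xi>. dir_deriv (T (total_dir l (jet_dir l) \<xi>)) (F C l) (T \<xi>))"
  by (rule smooth_total_derivative[OF coord_space_jet_coords adapted_rel_open[OF C] Dom_open[OF C] jk
        F_smooth[OF C] jet_coords_truncate jet_domain_truncate jet_coords_vertical])

lemma smooth_total_div:
  assumes C: "C \<in> adapted \<Phi>"
  shows "smooth_coords (jet_coords k) (Dom\<^sub>k C) (total_div k (pull_back j F) C)"
  by (rule smooth_coords_cong[OF coord_space_jet_coords adapted_rel_open[OF C]
        smooth_coords_sum[OF coord_space_jet_coords adapted_rel_open[OF C] smooth_total_div_summand[OF C]]])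
    (rule total_div_eq[OF C, symmetric])

lemma fld_partial_total_div:
  assumes C: "C \<in> adapted \<Phi>" and \<xi>: "\<xi> \<in> Dom\<^sub>k C" and ms: "length ms \<le> k"
  shows "fld_partial a ms (total_div k (pull_back j F) C) \<xi> =
    (\<Sum>l\<in>UNIV. dir_deriv (T (total_dir l (jet_dir l) \<xi>)) (dir_deriv (field_unit a ms) (F C l)) (T \<xi>)) +
    (\<Sum>l\<in>UNIV. dir_deriv (T (vertical_dir (jet_dir l) (sym_unit a ms))) (F C l) (T \<xi>))"
proof -
  note V = coord_space_jet_coords adapted_rel_open[OF C]
  note u = sym_unit_in[OF ms, of a]
  have "fld_partial a ms (total_div k (pull_back j F) C) \<xi> = dir_deriv (sym_unit a ms)
      (\<lambda>\<xi>. \<Sum>l\<in>UNIV. dir_deriv (T (total_dir l (jet_dir l) \<xi>)) (F C l) (T \<xi>)) \<xi>"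
    unfolding fld_partial_def by (rule dir_deriv_cong[OF V u \<xi>]) (rule total_div_eq[OF C])
  also have "\<dots> = (\<Sum>l\<in>UNIV. dir_deriv (sym_unit a ms)
      (\<lambda>\<xi>. dir_deriv (T (total_dir l (jet_dir l) \<xi>)) (F C l) (T \<xi>)) \<xi>)"
    by (rule dir_deriv_of_sum[OF V smooth_total_div_summand[OF C] u \<xi>])
  also have "\<dots> = (\<Sum>l\<in>UNIV.
      dir_deriv (T (total_dir l (jet_dir l) \<xi>)) (dir_deriv (field_unit a ms) (F C l)) (T \<xi>) +
      dir_deriv (T (vertical_dir (jet_dir l) (sym_unit a ms))) (F C l) (T \<xi>))"
    by (rule sum.cong[OF refl]) (rule dir_deriv_total_derivative[OF V Dom_open[OF C] jk
        F_smooth[OF C] jet_coords_truncate jet_domain_truncate jet_coords_vertical u \<xi>])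
  finally show ?thesis by (simp add: sum.distrib)
qed

text \<open>A nonempty list corresponds to the pair of its last entry and the rest. The bound on ns
  excludes no rearrangement of ms, because the rest is one entry shorter than ms.\<close>

lemma sum_append_last:
  fixes g :: "'n list \<Rightarrow> 'n \<Rightarrow> real"
  assumes "ms \<noteq> []" "length ms \<le> k"
  shows "(\<Sum>l\<in>UNIV. \<Sum>ns | length ns < k. if mset (ns @ [l]) = mset ms then g ns l else 0) =
    (\<Sum>ks | mset ks = mset ms. g (butlast ks) (last ks))"
proof -
  let ?N = "{ns :: 'n list. length ns < k}"
  let ?A = "(UNIV :: 'n set) \<times> ?N"
  have fA: "finite ?A" by (simp add: finite_lists_below)
  have "(\<Sum>l\<in>UNIV. \<Sum>ns | length ns < k. if mset (ns @ [l]) = mset ms then g ns l else 0) =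
      (\<Sum>(l, ns)\<in>?A. if mset (ns @ [l]) = mset ms then g ns l else 0)"
    by (rule sum.cartesian_product)
  also have "\<dots> = (\<Sum>p\<in>?A. if mset (snd p @ [fst p]) = mset ms then g (snd p) (fst p) else 0)"
    by (simp only: case_prod_beta')
  also have "\<dots> = (\<Sum>p\<in>{p \<in> ?A. mset (snd p @ [fst p]) = mset ms}. g (snd p) (fst p))"
    by (rule sum.inter_filter[OF fA, symmetric])
  also have "\<dots> = (\<Sum>ks | mset ks = mset ms. g (butlast ks) (last ks))"
  proof (rule sum.reindex_bij_witness[where i = "\<lambda>ks. (last ks, butlast ks)" and j = "\<lambda>p. snd p @ [fst p]"])
    fix ks assume "ks \<in> {ks. mset ks = mset ms}"
    then have ks: "mset ks = mset ms" by simp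
    then have ne: "ks \<noteq> []" using assms(1) by auto
    have len: "length (butlast ks) < k" using mset_eq_length[OF ks] assms ne by (cases ks rule: rev_cases) auto
    have ap: "butlast ks @ [last ks] = ks" using ne by simp
    show "snd (last ks, butlast ks) @ [fst (last ks, butlast ks)] = ks" using ap by simp
    show "(last ks, butlast ks) \<in> {p \<in> ?A. mset (snd p @ [fst p]) = mset ms}"
      using len ap ks by (simp del: mset_append)
  qed auto
  finally show ?thesis .
qed

text \<open>At \<open>Fld a (ns @ [l])\<close> the symmetrised unit vector is 1/card if ns @ [l]
  rearranges ms and 0 otherwise. The sum is thus the average of the shift over all rearrangements,
  each split at its last index. For ms = [] there is no such splitting.\<close>

lemma sum_vertical_sym_unit:
  assumes C: "C \<in> adapted \<Phi>" and \<xi>: "\<xi> \<in> Dom\<^sub>k C" and ms: "length ms \<le> k"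
  shows "(\<Sum>l\<in>UNIV. dir_deriv (T (vertical_dir (jet_dir l) (sym_unit a ms))) (F C l) (T \<xi>)) =
    (if ms = [] then 0 else (\<Sum>\<pi> | \<pi> permutes {..<length ms}.
       shift_amount C a (butlast (permute_list \<pi> ms)) (last (permute_list \<pi> ms)) \<xi>) / fact (length ms))"
proof -
  let ?c = "real (card {ks. mset ks = mset ms})"
  have u: "sym_unit a ms \<in> jet_coords k" using ms by (rule sym_unit_in)
  have "(\<Sum>l\<in>UNIV. dir_deriv (T (vertical_dir (jet_dir l) (sym_unit a ms))) (F C l) (T \<xi>)) =
      (\<Sum>l\<in>UNIV. \<Sum>b\<in>UNIV. \<Sum>ns | length ns < k.
        sym_unit a ms (Fld b (ns @ [l])) * shift_amount C b ns l \<xi>)"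
    unfolding shift_amount_def
    by (rule sum.cong[OF refl]) (rule vertical_derivative_expand[OF coord_space_jet_coords adapted_rel_open[OF C]
          Dom_open[OF C] jk F_smooth[OF C] jet_coords_truncate jet_domain_truncate jet_coords_vertical F_smooth[OF C] jet_domain_truncate[OF \<xi>] u])
  also have "\<dots> = (\<Sum>l\<in>UNIV. \<Sum>ns | length ns < k.
      if mset (ns @ [l]) = mset ms then shift_amount C a ns l \<xi> / ?c else 0)"
  proof (rule sum.cong[OF refl])
    fix l
    have "(\<Sum>ns | length ns < k. sym_unit a ms (Fld b (ns @ [l])) * shift_amount C b ns l \<xi>) =
        (if b = a then (\<Sum>ns | length ns < k.
          if mset (ns @ [l]) = mset ms then shift_amount C a ns l \<xi> / ?c else 0) else 0)" for b
      by (auto simp: sym_unit_def intro!: sum.cong)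
    then show "(\<Sum>b\<in>UNIV. \<Sum>ns | length ns < k. sym_unit a ms (Fld b (ns @ [l])) * shift_amount C b ns l \<xi>) =
        (\<Sum>ns | length ns < k. if mset (ns @ [l]) = mset ms then shift_amount C a ns l \<xi> / ?c else 0)"
      by (simp del: mset_append)
  qed
  also have "\<dots> = (if ms = [] then 0 else (\<Sum>\<pi> | \<pi> permutes {..<length ms}.
       shift_amount C a (butlast (permute_list \<pi> ms)) (last (permute_list \<pi> ms)) \<xi>) / fact (length ms))"
  proof (cases "ms = []")
    case False
    then show ?thesis
      unfolding sum_append_last[OF False ms, of "\<lambda>ns l. shift_amount C a ns l \<xi> / ?c"]
      using sum_permutations_average[of "\<lambda>ks. shift_amount C a (butlast ks) (last ks) \<xi>" ms]
      by (simp add: sum_divide_distrib)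
  qed simp
  finally show ?thesis .
qed

lemma sym_mom_shift:
  assumes C: "C \<in> adapted_at \<Phi> (fst z)" and ms: "ms \<noteq> []" "length ms \<le> k"
  shows "sym_mom (shift s z) C a ms = sym_mom z C a ms + s * ((\<Sum>\<pi> | \<pi> permutes {..<length ms}.
       shift_amount C a (butlast (permute_list \<pi> ms)) (last (permute_list \<pi> ms)) (snd z C)) / fact (length ms))"
proof -
  \<comment> \<open>The last index is the one of the form component, so even a list of length k
    leaves fewer than k indices and the guard in the definition of the shift is satisfied.\<close>
  have len: "length (butlast (permute_list \<pi> ms)) < k" for \<pi>
  proof -
    have "0 < length ms" using ms(1) by simp
    then have "length ms - 1 < k" using ms(2) by linarith
    then show ?thesis by simp
  qed
  show ?thesis
    unfolding sym_mom_def
    by (simp add: C len sum.distrib add_divide_distrib sum_distrib_left del: length_butlast)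
qed

text \<open>Along a section, the momenta enter the Euler-Lagrange equations through their total
  symmetrisation and their divergence. Under the shift these change by exactly the two parts of the
  derivative of the total divergence.\<close>

lemma euler_lagrange_equations_shift:
  fixes L :: "('m, 'e, 'n, 'r) density"
  assumes L: "is_density \<Phi> k L"
    and \<sigma>: "phase_section U \<sigma>"
    and f: "smooth_section \<Phi> U f" and jf: "\<And>x. x \<in> U \<Longrightarrow> jet_part (\<sigma> x) = jet \<Phi> (k - 1) f x"
    and x: "x \<in> U" and C: "C \<in> adapted_at \<Phi> (f x)"
  defines "L' \<equiv> \<lambda>C \<xi>. L C \<xi> + total_div k (pull_back j F) C \<xi>"
    and "\<xi> \<equiv> snd (jet \<Phi> k f x) C"
  shows "length ms = k \<Longrightarrow> sym_mom (shift 1 (\<sigma> x)) C a ms - fld_partial a ms (L' C) \<xi> =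
      sym_mom (\<sigma> x) C a ms - fld_partial a ms (L C) \<xi>"
    and "1 \<le> length ms \<Longrightarrow> length ms \<le> k - 1 \<Longrightarrow>
      sym_mom (shift 1 (\<sigma> x)) C a ms - (fld_partial a ms (L' C) \<xi> -
        (\<Sum>l\<in>UNIV. coord_partial (shift 1 \<circ> \<sigma>) C (Mom a ms l) l x)) =
      sym_mom (\<sigma> x) C a ms - (fld_partial a ms (L C) \<xi> -
        (\<Sum>l\<in>UNIV. coord_partial \<sigma> C (Mom a ms l) l x))"
    and "fld_partial a [] (L' C) \<xi> - (\<Sum>l\<in>UNIV. coord_partial (shift 1 \<circ> \<sigma>) C (Mom a [] l) l x) =
      fld_partial a [] (L C) \<xi> - (\<Sum>l\<in>UNIV. coord_partial \<sigma> C (Mom a [] l) l x)"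
proof -
  have fst\<sigma>: "fst (\<sigma> x) = f x" if "x \<in> U" for x
    using arg_cong[OF jf[OF that], of fst] by simp
  have C': "C \<in> adapted \<Phi>" using C by (simp add: adapted_at_iff)
  have C\<sigma>: "C \<in> adapted_at \<Phi> (fst (\<sigma> x))" using C fst\<sigma>[OF x] by simp
  note V = coord_space_jet_coords adapted_rel_open[OF C']
  have \<xi>: "\<xi> \<in> Dom\<^sub>k C"
    unfolding \<xi>_def by (rule jet_coord_domain[OF base_atlas total_atlas f x C])
  have T\<sigma>: "T (snd (\<sigma> x) C) = T \<xi>"
    using truncate_jet_part[of "\<sigma> x" C] jet_truncate[where f = f and x = x, OF C, of j k]
      jet_truncate[where f = f and x = x, OF C j_le] jk
    by (simp add: jf[OF x] \<xi>_def)
  let ?z = "snd (first_jet \<Phi> \<sigma> x) C"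
  have Tz: "T ?z = T \<xi>"
  proof -
    have "T ?z = T (snd (\<sigma> x) C)"
      by (rule truncate_cong) (simp_all add: first_jet_coord[OF \<sigma> x C\<sigma>])
    then show ?thesis using T\<sigma> by simp
  qed
  note fD = smooth_sectionD[OF f]
  note sd = section_domain[OF C' fD(1,4,6)]
  have y0: "snd (fst C) x \<in> section_domain C U f"
    using sd(5)[OF x] C by (simp add: adapted_at_iff)
  \<comment> \<open>Holonomy. As \<open>jf\<close> holds on all of U it may be differentiated at x:
    derivatives of field coordinates of order at most j are partial derivatives of the local field
    of one order more, which is at most k. The index l arises in front and is moved to the end by
    symmetry.\<close>
  have dir: "T (total_dir l (\<lambda>b ns. DFld b ns l) ?z) = T (total_dir l (jet_dir l) \<xi>)" for l
  proof (rule truncate_cong)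
    show "total_dir l (\<lambda>b ns. DFld b ns l) ?z (Base \<mu>) = total_dir l (jet_dir l) \<xi> (Base \<mu>)" for \<mu>
      by (simp add: total_dir_coord)
    fix b :: 'r and ns :: "'n list" assume ns: "length ns \<le> j"
    let ?g = "local_field C f b" and ?y = "snd (fst C) x"
    note g = local_field_smooth[OF base_atlas total_atlas f C']
    have "coord_partial \<sigma> C (Fld b ns) l x = partial l (partials ns ?g) ?y"
      unfolding coord_partial_def
    proof (rule partial_cong[OF sd(1) y0, symmetric])
      show "partials ns ?g differentiable at ?y"
        by (rule smooth_onD(2)[OF smooth_on_partials[OF g] y0])
      fix y assume "y \<in> section_domain C U f"
      from sd(3)[OF this] obtain x' where x': "x' \<in> U" "f x' \<in> fst (snd C)"
        "y = snd (fst C) x'" "chart_inv (fst C) y = x'" by blast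
      have Cx': "C \<in> adapted_at \<Phi> (f x')" using x' C' by (simp add: adapted_at_iff)
      have "snd (\<sigma> x') C (Fld b ns) = snd (jet \<Phi> (k - 1) f x') C (Fld b ns)"
        using jf[OF x'(1)] jet_part_simps(3)[of "\<sigma> x'" C b ns] by simp
      also have "\<dots> = partials ns ?g y"
        using ns j_le by (simp add: jet_coord(2)[where f = f and x = x', OF Cx'] x'(3))
      finally show "partials ns ?g y = snd (\<sigma> (chart_inv (fst C) y)) C (Fld b ns)"
        using x'(4) by simp
    qed
    also have "\<dots> = partials (l # ns) ?g ?y" by (simp add: partials_def)
    also have "\<dots> = partials (ns @ [l]) ?g ?y"
      by (rule partials_mset[OF sd(1) g y0]) simp
    also have "\<dots> = \<xi> (Fld b (ns @ [l]))"
      using ns jk by (simp add: \<xi>_def jet_coord(2)[where f = f and x = x, OF C])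
    finally show "total_dir l (\<lambda>b ns. DFld b ns l) ?z (Fld b ns) = total_dir l (jet_dir l) \<xi> (Fld b ns)"
      by (simp add: total_dir_coord first_jet_coord[OF \<sigma> x C\<sigma>])
  qed
  define D where "D = (\<lambda>ms. \<Sum>l\<in>UNIV.
    dir_deriv (T (total_dir l (jet_dir l) \<xi>)) (dir_deriv (field_unit a ms) (F C l)) (T \<xi>))"
  define Y where "Y = (\<lambda>ms. (\<Sum>\<pi> | \<pi> permutes {..<length ms}.
       shift_amount C a (butlast (permute_list \<pi> ms)) (last (permute_list \<pi> ms)) \<xi>) / fact (length ms))"
  have fp: "fld_partial a ms (L' C) \<xi> = fld_partial a ms (L C) \<xi> + (D ms + (if ms = [] then 0 else Y ms))"
    if "length ms \<le> k" for ms
  proof -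
    have "fld_partial a ms (L' C) \<xi> = fld_partial a ms (L C) \<xi> + fld_partial a ms (total_div k (pull_back j F) C) \<xi>"
      unfolding L'_def fld_partial_def
      by (rule dir_deriv_plus[OF V _ smooth_total_div[OF C'] sym_unit_in[OF that] \<xi>])
        (use L C' in \<open>simp add: is_density_def\<close>)
    then show ?thesis
      unfolding fld_partial_total_div[OF C' \<xi> that] sum_vertical_sym_unit[OF C' \<xi> that] D_def Y_def .
  qed
  have cp: "(\<Sum>l\<in>UNIV. coord_partial (shift 1 \<circ> \<sigma>) C (Mom a ms l) l x) =
      (\<Sum>l\<in>UNIV. coord_partial \<sigma> C (Mom a ms l) l x) + D ms" if "length ms < k" for ms
    using that unfolding D_def coord_partial_shift[OF \<sigma> x C\<sigma>] shift_derivative_def dir Tz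
    by (simp add: sum.distrib)
  have sm: "sym_mom (shift 1 (\<sigma> x)) C a ms = sym_mom (\<sigma> x) C a ms + Y ms"
    if "ms \<noteq> []" "length ms \<le> k" for ms
    using sym_mom_shift[OF C\<sigma> that, of 1 a] unfolding Y_def by (simp add: shift_amount_truncate[OF T\<sigma>])
  show "length ms = k \<Longrightarrow> sym_mom (shift 1 (\<sigma> x)) C a ms - fld_partial a ms (L' C) \<xi> =
      sym_mom (\<sigma> x) C a ms - fld_partial a ms (L C) \<xi>"
  proof -
    assume ms: "length ms = k"
    then have ne: "ms \<noteq> []" using jk by auto
    \<comment> \<open>As k exceeds j, the unit vector of order k is truncated to zero. This removes
      the divergence part \<open>D\<close> in an equation that has no divergence to match
      it.\<close>
    have "field_unit a ms = (\<lambda>_. 0)" using ms jk by (simp add: truncate_sym_unit)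
    then have "dir_deriv (field_unit a ms) (F C l) = (\<lambda>_. 0)" for l
      by (simp only: dir_deriv_zero[abs_def])
    then have "D ms = 0" by (simp add: D_def dir_deriv_const)
    then show ?thesis using fp[of ms] sm[OF ne] ms ne by simp
  qed
  show "sym_mom (shift 1 (\<sigma> x)) C a ms - (fld_partial a ms (L' C) \<xi> -
        (\<Sum>l\<in>UNIV. coord_partial (shift 1 \<circ> \<sigma>) C (Mom a ms l) l x)) =
      sym_mom (\<sigma> x) C a ms - (fld_partial a ms (L C) \<xi> -
        (\<Sum>l\<in>UNIV. coord_partial \<sigma> C (Mom a ms l) l x))"
    if "1 \<le> length ms" "length ms \<le> k - 1"
  proof -
    have "ms \<noteq> []" "length ms < k" using that jk by auto
    then show ?thesis using fp[of ms] sm[of ms] cp[of ms] by simp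
  qed
  show "fld_partial a [] (L' C) \<xi> - (\<Sum>l\<in>UNIV. coord_partial (shift 1 \<circ> \<sigma>) C (Mom a [] l) l x) =
      fld_partial a [] (L C) \<xi> - (\<Sum>l\<in>UNIV. coord_partial \<sigma> C (Mom a [] l) l x)"
    using fp[of "[]"] cp[of "[]"] jk by simp
qed

lemma jet_part_shift: "jet_part (shift s z) = jet_part z"
  by (auto simp: jet_part_def fun_eq_iff split: coord.split)

lemma euler_lagrange_shift:
  fixes L :: "('m, 'e, 'n, 'r) density"
  assumes L: "is_density \<Phi> k L"
    and \<sigma>: "phase_section (carrier (base_atlas \<Phi>)) \<sigma>"
  shows "euler_lagrange \<Phi> k L \<sigma> \<longleftrightarrow>
    euler_lagrange \<Phi> k (\<lambda>C \<xi>. L C \<xi> + total_div k (pull_back j F) C \<xi>) (shift 1 \<circ> \<sigma>)"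
proof -
  let ?M = "carrier (base_atlas \<Phi>)"
  let ?L' = "\<lambda>C \<xi>. L C \<xi> + total_div k (pull_back j F) C \<xi>"
  define E where "E = (\<lambda>L \<sigma> f x C a.
    (\<forall>ms. length ms = k \<longrightarrow>
       sym_mom (\<sigma> x) C a ms = fld_partial a ms (L C) (snd (jet \<Phi> k f x) C)) \<and>
    (\<forall>ms. 1 \<le> length ms \<and> length ms \<le> k - 1 \<longrightarrow>
       sym_mom (\<sigma> x) C a ms = fld_partial a ms (L C) (snd (jet \<Phi> k f x) C)
         - (\<Sum>l\<in>UNIV. coord_partial \<sigma> C (Mom a ms l) l x)) \<and>
    0 = fld_partial a [] (L C) (snd (jet \<Phi> k f x) C)
         - (\<Sum>l\<in>UNIV. coord_partial \<sigma> C (Mom a [] l) l x))"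
  have E: "E ?L' (shift 1 \<circ> \<sigma>) f x C a \<longleftrightarrow> E L \<sigma> f x C a"
    if f: "smooth_section \<Phi> ?M f" and jf: "\<And>x. x \<in> ?M \<Longrightarrow> jet_part (\<sigma> x) = jet \<Phi> (k - 1) f x"
      and x: "x \<in> ?M" and C: "C \<in> adapted_at \<Phi> (f x)" for f x C a
  proof -
    note e = euler_lagrange_equations_shift[OF L \<sigma> f jf x C, where a = a]
    \<comment> \<open>Each Euler-Lagrange equation has the form p = q, and the preceding lemma shows
      that the difference of its two sides is unchanged.\<close>
    have iff: "(p' = q') \<longleftrightarrow> (p = q)" if "p' - q' = p - q" for p' q' p q :: real
      using that by auto
    show ?thesis
      unfolding E_def comp_apply
      by (intro conj_cong all_cong; rule iff) (use e in \<open>auto simp: comp_def\<close>)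
  qed
  have el: "euler_lagrange \<Phi> k L \<sigma> \<longleftrightarrow> phase_section ?M \<sigma> \<and>
     (\<exists>f. smooth_section \<Phi> ?M f \<and> (\<forall>x\<in>?M. jet_part (\<sigma> x) = jet \<Phi> (k - 1) f x \<and>
       (\<forall>C\<in>adapted_at \<Phi> (f x). \<forall>a. E L \<sigma> f x C a)))" for L \<sigma>
    unfolding euler_lagrange_def E_def ..
  show ?thesis
    unfolding el
  proof (rule conj_cong)
    show "phase_section ?M \<sigma> = phase_section ?M (shift 1 \<circ> \<sigma>)"
      using \<sigma> shift_bundle_section[OF \<sigma>] by blast
    show "(\<exists>f. smooth_section \<Phi> ?M f \<and> (\<forall>x\<in>?M. jet_part (\<sigma> x) = jet \<Phi> (k - 1) f x \<and>
       (\<forall>C\<in>adapted_at \<Phi> (f x). \<forall>a. E L \<sigma> f x C a))) \<longleftrightarrow>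
      (\<exists>f. smooth_section \<Phi> ?M f \<and> (\<forall>x\<in>?M. jet_part ((shift 1 \<circ> \<sigma>) x) = jet \<Phi> (k - 1) f x \<and>
       (\<forall>C\<in>adapted_at \<Phi> (f x). \<forall>a. E ?L' (shift 1 \<circ> \<sigma>) f x C a)))"
    proof (intro ex_cong1 conj_cong refl)
      fix f assume f: "smooth_section \<Phi> ?M f"
      show "(\<forall>x\<in>?M. jet_part (\<sigma> x) = jet \<Phi> (k - 1) f x \<and>
         (\<forall>C\<in>adapted_at \<Phi> (f x). \<forall>a. E L \<sigma> f x C a)) \<longleftrightarrow>
        (\<forall>x\<in>?M. jet_part ((shift 1 \<circ> \<sigma>) x) = jet \<Phi> (k - 1) f x \<and>
         (\<forall>C\<in>adapted_at \<Phi> (f x). \<forall>a. E ?L' (shift 1 \<circ> \<sigma>) f x C a))"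
      \<comment> \<open>The equivalence \<open>E\<close> differentiates along the section and so
        needs the jet condition on all of M at once; hence a case distinction on that condition
        instead of rewriting pointwise. If it fails, both sides are false.\<close>
      proof (cases "\<forall>x\<in>?M. jet_part (\<sigma> x) = jet \<Phi> (k - 1) f x")
        case True
        then have "E ?L' (shift 1 \<circ> \<sigma>) f x C a \<longleftrightarrow> E L \<sigma> f x C a"
          if "x \<in> ?M" "C \<in> adapted_at \<Phi> (f x)" for x C a
          using E[OF f _ that] by blast
        then show ?thesis by (simp add: jet_part_shift)
      next
        case False
        then show ?thesis by (auto simp: jet_part_shift)
      qed
    qed
  qed
qed

section \<open>The infinitesimal phase bundle\<close>


abbreviation "D\<^sub>P C \<equiv> coord_domain (pre_inf_coords k :: ('n, 'r) coords set) C"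
abbreviation "first_jet_dir n \<equiv> \<lambda>b ns. DFld b ns n"

text \<open>An identity between coordinates that holds along the section throughout the chart can be
  differentiated. In this way symmetry and vanishing pass from the momenta to the
  \<open>DMom\<close> coordinates.\<close>

lemma coord_partial_cong:
  assumes \<sigma>: "phase_section U \<sigma>" and x: "x \<in> U"
    and C: "C \<in> adapted_at \<Phi> (fst (\<sigma> x))"
    and eq: "\<And>x. x \<in> U \<Longrightarrow> C \<in> adapted_at \<Phi> (fst (\<sigma> x)) \<Longrightarrow> snd (\<sigma> x) C \<iota> = g (snd (\<sigma> x) C)"
  shows "coord_partial \<sigma> C \<iota> n x = partial n (\<lambda>y. g (snd (\<sigma> (chart_inv (fst C) y)) C)) (snd (fst C) x)"
  unfolding coord_partial_def
proof (rule partial_cong[OF section_chart(1)[OF \<sigma> chart_adapted[OF \<sigma> x C]] chart_point(1)[OF \<sigma> x C]])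
  show "(\<lambda>y. snd (\<sigma> (chart_inv (fst C) y)) C \<iota>) differentiable at (snd (fst C) x)"
    by (rule smooth_onD(2)[OF bundle_sectionD(7)[OF \<sigma> chart_adapted[OF \<sigma> x C]] chart_point(1)[OF \<sigma> x C]])
  fix y assume "y \<in> section_domain C U (\<lambda>x. fst (\<sigma> x))"
  from section_chart(2)[OF \<sigma> chart_adapted[OF \<sigma> x C] this] obtain x' where "x' \<in> U"
    "C \<in> adapted_at \<Phi> (fst (\<sigma> x'))" "chart_inv (fst C) y = x'" by blast
  then show "snd (\<sigma> (chart_inv (fst C) y)) C \<iota> = g (snd (\<sigma> (chart_inv (fst C) y)) C)"
    using eq by simp
qed

lemma partial_const: "partial n (\<lambda>_. c) y = 0"
  by (simp add: partial_def)

lemma pre_inf_phaseE: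
  assumes "z \<in> PI"
  obtains \<sigma> U x w where "z = first_jet \<Phi> \<sigma> x" "phase_section U \<sigma>" "x \<in> U"
    "w \<in> jet_bundle \<Phi> k" "fst w = fst z"
    "\<And>C a ms. C \<in> adapted_at \<Phi> (fst z) \<Longrightarrow> length ms < k \<Longrightarrow> snd z C (Fld a ms) = snd w C (Fld a ms)"
    "\<And>C a ms n. C \<in> adapted_at \<Phi> (fst z) \<Longrightarrow> length ms < k \<Longrightarrow> snd z C (DFld a ms n) = snd w C (Fld a (ms @ [n]))"
proof -
  note d = assms[unfolded pre_inf_phase_def mem_Collect_eq]
  obtain \<sigma> U x where s: "z = first_jet \<Phi> \<sigma> x" "phase_section U \<sigma>" "x \<in> U"
    using d[THEN conjunct1] by (auto simp: first_jets_phase_def)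
  obtain w where w0: "w \<in> jet_bundle \<Phi> k" "fst w = fst z" and
    w: "\<forall>C\<in>adapted_at \<Phi> (fst z). \<forall>a ms. length ms < k \<longrightarrow>
        snd z C (Fld a ms) = snd w C (Fld a ms) \<and>
        (\<forall>n. snd z C (DFld a ms n) = snd w C (Fld a (ms @ [n])))"
    using d[THEN conjunct2] by blast
  show ?thesis
    by (rule that[OF s w0]) (simp_all add: w[rule_format, THEN conjunct1] w[rule_format, THEN conjunct2, rule_format])
qed

lemma fst_first_jet [simp]: "fst (first_jet \<Phi> \<sigma> x) = fst (\<sigma> x)"
  by (simp add: first_jet_def)

lemma pre_inf_base_coord:
  assumes z: "z \<in> PI" and C: "C \<in> adapted_at \<Phi> (fst z)"
  shows "snd z C (Base \<mu>) = snd (fst C) (base_pt \<Phi> z) $ \<mu>"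
proof -
  obtain \<sigma> U x w where s: "z = first_jet \<Phi> \<sigma> x" "phase_section U \<sigma>" "x \<in> U"
    using z by (rule pre_inf_phaseE)
  then have "C \<in> adapted_at \<Phi> (fst (\<sigma> x))" using C by simp
  then show ?thesis
    using jet_bundle_base[OF phase_bundleD(1)[OF bundle_sectionD(3)[OF s(2,3)]], of C \<mu>]
    by (simp add: s(1) first_jet_coord[OF s(2,3)] base_pt_def)
qed

text \<open>The holonomic k-jet w is the witness for the field coordinates and their derivatives
  below order k. From order k on they vanish along the whole representing section, and the
  constraints on the momenta also hold along it, so they are inherited by the derivatives.\<close>

lemma pre_inf_coord_domain:
  assumes z: "z \<in> PI" and C: "C \<in> adapted_at \<Phi> (fst z)"
  shows "snd z C \<in> D\<^sub>P C"
proof -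
  obtain \<sigma> U x w where s: "z = first_jet \<Phi> \<sigma> x" "phase_section U \<sigma>" "x \<in> U"
    and w: "w \<in> jet_bundle \<Phi> k" "fst w = fst z"
    and w1: "\<And>C a ms. C \<in> adapted_at \<Phi> (fst z) \<Longrightarrow> length ms < k \<Longrightarrow> snd z C (Fld a ms) = snd w C (Fld a ms)"
    and w2: "\<And>C a ms n. C \<in> adapted_at \<Phi> (fst z) \<Longrightarrow> length ms < k \<Longrightarrow>
        snd z C (DFld a ms n) = snd w C (Fld a (ms @ [n]))"
    using z by (rule pre_inf_phaseE) (rule that)
  have C\<sigma>: "C \<in> adapted_at \<Phi> (fst (\<sigma> x))" using C s(1) by simp
  note ph = bundle_sectionD(3)[OF s(2)]
  note fj = first_jet_coord[OF s(2,3) C\<sigma>]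
  have high: "snd (\<sigma> x) C (Fld a ms) = 0"
    if "x \<in> U" "C \<in> adapted_at \<Phi> (fst (\<sigma> x))" "length ms \<ge> k" for x a ms
  proof -
    have "snd (jet_part (\<sigma> x)) C \<in> coord_domain (jet_coords (k - 1)) C"
      using jet_bundle_coord_domain[OF phase_bundleD(1)[OF ph[OF that(1)]], of C] that(2) by simp
    then have "snd (jet_part (\<sigma> x)) C \<in> jet_coords (k - 1)" by (simp add: coord_domain_def)
    from jet_coordsD(1)[OF this, of ms a] that(3) jk show ?thesis by simp
  qed
  have "snd w C \<in> coord_domain (jet_coords k) C"
    using jet_bundle_coord_domain[OF w(1)] C w(2) by simp
  then have \<eta>: "snd w C \<in> jet_coords k" by (simp add: coord_domain_def)
  have "snd z C \<in> pre_inf_coords k"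
  proof (rule pre_inf_coordsI[OF \<eta>])
    fix a :: 'r and ms :: "'n list" and n
    show "snd z C (Fld a ms) = (if length ms < k then snd w C (Fld a ms) else 0)"
      using w1[OF C] high[OF s(3) C\<sigma>] by (auto simp: s(1) fj)
    show "snd z C (DFld a ms n) = (if length ms < k then snd w C (Fld a (ms @ [n])) else 0)"
    proof (cases "length ms < k")
      case True then show ?thesis using w2[OF C True] by simp
    next
      case False
      then have "coord_partial \<sigma> C (Fld a ms) n x = partial n (\<lambda>y. 0) (snd (fst C) x)"
        by (intro coord_partial_cong[OF s(2,3) C\<sigma>, where g = "\<lambda>_. 0"] high) simp_all
      then show ?thesis using False by (simp add: s(1) fj partial_const)
    qed
  next
    fix a :: 'r and ms ns :: "'n list" and l n :: 'n assume ms: "mset ms = mset ns"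
    show "snd z C (Mom a ms l) = snd z C (Mom a ns l)"
      using phase_bundleD(4)[OF ph[OF s(3)] ms] by (simp add: s(1) fj)
    have "coord_partial \<sigma> C (Mom a ms l) n x =
        partial n (\<lambda>y. snd (\<sigma> (chart_inv (fst C) y)) C (Mom a ns l)) (snd (fst C) x)"
      by (rule coord_partial_cong[OF s(2,3) C\<sigma>]) (rule phase_bundleD(4)[OF ph ms])
    then show "snd z C (DMom a ms l n) = snd z C (DMom a ns l n)"
      by (simp add: s(1) fj) (simp add: coord_partial_def)
  next
    fix a :: 'r and ms :: "'n list" and l n :: 'n assume ms: "k \<le> length ms"
    show "snd z C (Mom a ms l) = 0"
      using phase_bundleD(3)[OF ph[OF s(3)] ms] by (simp add: s(1) fj)
    have "coord_partial \<sigma> C (Mom a ms l) n x = partial n (\<lambda>y. 0) (snd (fst C) x)"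
      by (rule coord_partial_cong[OF s(2,3) C\<sigma>, where g = "\<lambda>_. 0"]) (rule phase_bundleD(3)[OF ph ms])
    then show "snd z C (DMom a ms l n) = 0" by (simp add: s(1) fj partial_const)
  qed
  moreover have "snd (jet_part (\<sigma> x)) C \<in> coord_domain (jet_coords (k - 1)) C"
    using jet_bundle_coord_domain[OF phase_bundleD(1)[OF ph[OF s(3)]], of C] C\<sigma> by simp
  ultimately show ?thesis by (simp add: coord_domain_def s(1) fj)
qed

text \<open>The holonomic constraints involve only the point of \<Phi> and the field coordinates
  with their derivatives, all fixed by the shift; the rest is the shift of a representing
  section.\<close>

lemma jet_shift_pre_inf:
  assumes z: "z \<in> PI"
  shows "jet_shift s z \<in> PI"
proof -
  have "z \<in> first_jets_phase \<Phi> k" using z by (simp add: pre_inf_phase_def)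
  then obtain \<sigma> U x where s: "z = first_jet \<Phi> \<sigma> x" "phase_section U \<sigma>" "x \<in> U"
    by (auto simp: first_jets_phase_def)
  have "jet_shift s z = first_jet \<Phi> (shift s \<circ> \<sigma>) x" using first_jet_shift[OF s(2,3)] s(1) by simp
  then have "jet_shift s z \<in> first_jets_phase \<Phi> k"
    using shift_bundle_section[OF s(2), of s] s(3) unfolding first_jets_phase_def by blast
  then show ?thesis using z by (simp add: pre_inf_phase_def)
qed

lemma pre_inf_coords_truncate: "X \<in> pre_inf_coords k \<Longrightarrow> T X \<in> J"
  by (rule truncate_in_jet_coords) (rule pre_inf_coordsD(1))

lemma pre_inf_coords_vertical: "X \<in> pre_inf_coords k \<Longrightarrow> T (vertical_dir (first_jet_dir n) X) \<in> J"
  by (rule truncate_in_jet_coords) (simp only: vertical_dir_coord, rule pre_inf_coordsD(2))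

lemma first_jet_truncate: "\<xi> \<in> D\<^sub>P C \<Longrightarrow> T \<xi> \<in> Dom C"
  by (rule truncate_coord_domain) (auto simp: coord_domain_def intro: pre_inf_coords_truncate)

context
  fixes C assumes C: "C \<in> adapted \<Phi>"
begin

lemma first_jet_space:
  "coord_space (pre_inf_coords k :: ('n, 'r) coords set)"
  "rel_open (pre_inf_coords k) (D\<^sub>P C)"
  by (rule coord_space_pre_inf_coords adapted_rel_open[OF C])+

lemma smooth_shift_amount: "smooth_coords (pre_inf_coords k) (D\<^sub>P C) (shift_amount C a ms l)"
  unfolding shift_amount_def[abs_def]
  by (rule smooth_coords_compose_truncate[OF first_jet_space Dom_open[OF C] first_jet_truncate
        shift_amount_smooth[OF C]])

lemma smooth_shift_derivative:
  "smooth_coords (pre_inf_coords k) (D\<^sub>P C) (shift_derivative C a ms l n)"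
  unfolding shift_derivative_def[abs_def]
  by (rule smooth_total_derivative[OF first_jet_space Dom_open[OF C] jk shift_amount_smooth[OF C]
        pre_inf_coords_truncate first_jet_truncate pre_inf_coords_vertical])

lemma smooth_jet_shift_coords:
  "smooth_coords (pre_inf_coords k) (D\<^sub>P C) (\<lambda>\<xi>. jet_shift_coords s C \<xi> \<iota>)"
proof -
  note sc = smooth_coords_coord[OF first_jet_space] and sm = smooth_coords_cmult[OF first_jet_space]
    and pl = smooth_coords_add[OF first_jet_space]
  show ?thesis
  proof (cases \<iota>)
    case (Mom a ms l)
    show ?thesis
      by (cases "length ms < k") (simp_all add: jet_shift_coords_def Mom sc pl[OF sc sm[OF smooth_shift_amount]])
  next
    case (DMom a ms l n)
    show ?thesis
      by (cases "length ms < k") (simp_all add: jet_shift_coords_def DMom sc pl[OF sc sm[OF smooth_shift_derivative]])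
  qed (simp_all add: jet_shift_coords_def sc)
qed

lemma jet_shift_coords_domain:
  assumes \<xi>: "\<xi> \<in> D\<^sub>P C"
  shows "jet_shift_coords s C \<xi> \<in> D\<^sub>P C"
proof -
  have m: "\<xi> \<in> pre_inf_coords k" using \<xi> by (simp add: coord_domain_def)
  obtain \<eta> where \<eta>: "\<eta> \<in> jet_coords k"
      "\<And>a ms. \<xi> (Fld a ms) = (if length ms < k then \<eta> (Fld a ms) else 0)"
      "\<And>a ms n. \<xi> (DFld a ms n) = (if length ms < k then \<eta> (Fld a (ms @ [n])) else 0)"
    using m by (rule pre_inf_coordsE) (rule that)
  have "jet_shift_coords s C \<xi> \<in> pre_inf_coords k"
  proof (rule pre_inf_coordsI[OF \<eta>(1)])
    fix a :: 'r and ms ns :: "'n list" and l n :: 'n assume ms: "mset ms = mset ns"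
    show "jet_shift_coords s C \<xi> (Mom a ms l) = jet_shift_coords s C \<xi> (Mom a ns l)"
      using pre_inf_coordsD(3)[OF m ms] mset_eq_length[OF ms] shift_amount_mset[OF ms]
      by (simp add: jet_shift_coords_def)
    show "jet_shift_coords s C \<xi> (DMom a ms l n) = jet_shift_coords s C \<xi> (DMom a ns l n)"
      using pre_inf_coordsD(4)[OF m ms] mset_eq_length[OF ms] sym_unit_mset[OF ms, of a]
      by (simp add: jet_shift_coords_def shift_derivative_def)
  qed (simp_all add: jet_shift_coords_def \<eta>(2,3) pre_inf_coordsD(7,8)[OF m])
  then show ?thesis using \<xi> by (simp add: coord_domain_def jet_shift_coords_def)
qed

text \<open>The tangent map of the prolonged shift in coordinates. The two terms in the last formula
  come from \<open>dir_deriv_total_derivative\<close> with the derivative of F as H: the variation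
  of the point and that of the direction of the total derivative.\<close>

lemma dir_deriv_jet_shift_coords:
  assumes X: "X \<in> pre_inf_coords k" and \<xi>: "\<xi> \<in> D\<^sub>P C"
  shows "dir_deriv X (\<lambda>\<xi>. jet_shift_coords s C \<xi> (Base \<mu>)) \<xi> = X (Base \<mu>)"
    and "dir_deriv X (\<lambda>\<xi>. jet_shift_coords s C \<xi> (Fld a ms)) \<xi> = X (Fld a ms)"
    and "dir_deriv X (\<lambda>\<xi>. jet_shift_coords s C \<xi> (DFld a ms n)) \<xi> = X (DFld a ms n)"
    and "length ms < k \<Longrightarrow> dir_deriv X (\<lambda>\<xi>. jet_shift_coords s C \<xi> (Mom a ms l)) \<xi> =
      X (Mom a ms l) + s * dir_deriv (T X) (dir_deriv (field_unit a ms) (F C l)) (T \<xi>)"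
    and "length ms < k \<Longrightarrow> dir_deriv X (\<lambda>\<xi>. jet_shift_coords s C \<xi> (DMom a ms l n)) \<xi> =
      X (DMom a ms l n) + s * (
        dir_deriv (T (total_dir n (first_jet_dir n) \<xi>)) (dir_deriv (T X) (dir_deriv (field_unit a ms) (F C l))) (T \<xi>) +
        dir_deriv (T (vertical_dir (first_jet_dir n) X)) (dir_deriv (field_unit a ms) (F C l)) (T \<xi>))"
proof -
  show "dir_deriv X (\<lambda>\<xi>. jet_shift_coords s C \<xi> (Base \<mu>)) \<xi> = X (Base \<mu>)"
    and "dir_deriv X (\<lambda>\<xi>. jet_shift_coords s C \<xi> (Fld a ms)) \<xi> = X (Fld a ms)"
    and "dir_deriv X (\<lambda>\<xi>. jet_shift_coords s C \<xi> (DFld a ms n)) \<xi> = X (DFld a ms n)"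
    by (simp_all add: jet_shift_coords_def dir_deriv_coord)
  note sc = smooth_coords_coord[OF first_jet_space] and sm = smooth_coords_cmult[OF first_jet_space]
    and pl = dir_deriv_plus[OF first_jet_space _ _ X \<xi>]
    and mult = dir_deriv_mult[OF first_jet_space smooth_coords_const[OF first_jet_space] _ X \<xi>]
  assume ms: "length ms < k"
  have "dir_deriv X (shift_amount C a ms l) \<xi> =
      dir_deriv (T X) (dir_deriv (field_unit a ms) (F C l)) (T \<xi>)"
    unfolding shift_amount_def[abs_def] by (rule dir_deriv_truncate)
  then show "dir_deriv X (\<lambda>\<xi>. jet_shift_coords s C \<xi> (Mom a ms l)) \<xi> =
      X (Mom a ms l) + s * dir_deriv (T X) (dir_deriv (field_unit a ms) (F C l)) (T \<xi>)"
    using ms by (simp add: jet_shift_coords_def pl[OF sc sm[OF smooth_shift_amount]] mult[OF smooth_shift_amount] dir_deriv_coord dir_deriv_const)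
  have "dir_deriv X (shift_derivative C a ms l n) \<xi> =
        dir_deriv (T (total_dir n (first_jet_dir n) \<xi>)) (dir_deriv (T X) (dir_deriv (field_unit a ms) (F C l))) (T \<xi>) +
        dir_deriv (T (vertical_dir (first_jet_dir n) X)) (dir_deriv (field_unit a ms) (F C l)) (T \<xi>)"
    unfolding shift_derivative_def[abs_def]
    by (rule dir_deriv_total_derivative[OF first_jet_space Dom_open[OF C] jk shift_amount_smooth[OF C]
          pre_inf_coords_truncate first_jet_truncate pre_inf_coords_vertical X \<xi>])
  then show "dir_deriv X (\<lambda>\<xi>. jet_shift_coords s C \<xi> (DMom a ms l n)) \<xi> =
      X (DMom a ms l n) + s * (
        dir_deriv (T (total_dir n (first_jet_dir n) \<xi>)) (dir_deriv (T X) (dir_deriv (field_unit a ms) (F C l))) (T \<xi>) +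
        dir_deriv (T (vertical_dir (first_jet_dir n) X)) (dir_deriv (field_unit a ms) (F C l)) (T \<xi>))"
    using ms by (simp add: jet_shift_coords_def pl[OF sc sm[OF smooth_shift_derivative]] mult[OF smooth_shift_derivative] dir_deriv_coord dir_deriv_const)
qed

end

section \<open>Curves, leaves and the two-form\<close>

lemma fibre_curve_jet_shift:
  assumes \<gamma>: "PI_curve \<gamma>"
  shows "PI_curve (\<lambda>t. jet_shift s (\<gamma> t))"
  unfolding fibre_curve_def
proof (intro conjI ballI allI)
  have mem: "\<gamma> t \<in> PI" and bp: "base_pt \<Phi> (\<gamma> t) = base_pt \<Phi> (\<gamma> 0)" for t
    using \<gamma> by (auto simp: fibre_curve_def)
  show "jet_shift s (\<gamma> t) \<in> PI" for t by (rule jet_shift_pre_inf[OF mem])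
  show "base_pt \<Phi> (jet_shift s (\<gamma> t)) = base_pt \<Phi> (jet_shift s (\<gamma> 0))" for t
    using bp[of t] by (simp add: base_pt_def)
  show "continuous_on UNIV (\<lambda>t. fst (jet_shift s (\<gamma> t)))"
    using \<gamma> by (simp add: fibre_curve_def)
  fix C \<iota> assume C: "C \<in> adapted \<Phi>"
  let ?R = "{t. fst (\<gamma> t) \<in> fst (snd C)}"
  have oR: "open ?R"
  proof -
    have "open (fst (snd C))" using adaptedD(2)[OF C] by (simp add: is_chart_def)
    then have "open ((\<lambda>t. fst (\<gamma> t)) -` fst (snd C))"
      using \<gamma> by (intro open_vimage) (simp_all add: fibre_curve_def)
    then show ?thesis by (simp add: vimage_def)
  qed
  have "smooth_on ?R (\<lambda>t. jet_shift_coords s C (snd (\<gamma> t) C) \<iota>)"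
  proof (rule smooth_on_smooth_coords[OF first_jet_space[OF C] oR smooth_jet_shift_coords[OF C]])
    show "smooth_on ?R (\<lambda>t. snd (\<gamma> t) C \<iota>)" for \<iota> using \<gamma> C by (simp add: fibre_curve_def)
    show "snd (\<gamma> t) C \<in> D\<^sub>P C" if "t \<in> ?R" for t
      using that C by (intro pre_inf_coord_domain mem) (simp add: adapted_at_iff)
  qed
  then have "smooth_on ?R (\<lambda>t. snd (jet_shift s (\<gamma> t)) C \<iota>)"
    by (rule smooth_on_cong[OF oR]) (simp add: jet_shift_def adapted_at_iff C)
  then show "smooth_on {t. fst (jet_shift s (\<gamma> t)) \<in> fst (snd C)} (\<lambda>t. snd (jet_shift s (\<gamma> t)) C \<iota>)"
    by simp
qed

text \<open>The tangent map of \<open>jet_shift s\<close> at z through its coordinate expression, so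
  that no choice of a representing curve enters; \<open>velocity_jet_shift\<close> justifies the
  name.\<close>

definition push where
  "push s z X = (\<lambda>C \<iota>. if C \<in> adapted_at \<Phi> (fst z)
     then dir_deriv (X C) (\<lambda>\<xi>. jet_shift_coords s C \<xi> \<iota>) (snd z C) else 0)"

context
  fixes \<gamma> :: "real \<Rightarrow> ('m, 'e, 'n, 'r) point"
  assumes \<gamma>: "PI_curve \<gamma>"
begin

lemma curve_in: "\<gamma> t \<in> PI" and curve_base: "base_pt \<Phi> (\<gamma> t) = base_pt \<Phi> (\<gamma> 0)"
  using \<gamma> by (auto simp: fibre_curve_def)

lemma curve_eventually_DP:
  assumes C: "C \<in> adapted_at \<Phi> (fst (\<gamma> t))"
  shows "\<forall>\<^sub>F s in nhds t. snd (\<gamma> s) C \<in> D\<^sub>P C"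
  using fibre_curve_eventually_adapted(1)[OF \<gamma> C]
  by eventually_elim (rule pre_inf_coord_domain[OF curve_in])

lemma velocity_jet_shift: "velocity \<Phi> (\<lambda>t. jet_shift s (\<gamma> t)) t = push s (\<gamma> t) (velocity \<Phi> \<gamma> t)"
proof -
  have "velocity \<Phi> (\<lambda>t. jet_shift s (\<gamma> t)) t C \<iota> = push s (\<gamma> t) (velocity \<Phi> \<gamma> t) C \<iota>" for C \<iota>
  proof (cases "C \<in> adapted_at \<Phi> (fst (\<gamma> t))")
    case False
    then show ?thesis by (simp add: velocity_def push_def)
  next
    case True
    then have C: "C \<in> adapted \<Phi>" by (simp add: adapted_at_iff)
    have "((\<lambda>t. jet_shift_coords s C (snd (\<gamma> t) C) \<iota>) has_real_derivative
        dir_deriv (velocity \<Phi> \<gamma> t C) (\<lambda>\<xi>. jet_shift_coords s C \<xi> \<iota>) (snd (\<gamma> t) C)) (at t)"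
      by (rule smooth_coords_chain_real(2)[OF first_jet_space[OF C] smooth_jet_shift_coords[OF C]
            curve_eventually_DP[OF True] fibre_curve_DERIV[OF \<gamma> True]])
    moreover have "\<forall>\<^sub>F t in nhds t. jet_shift_coords s C (snd (\<gamma> t) C) \<iota> = snd (jet_shift s (\<gamma> t)) C \<iota>"
      using fibre_curve_eventually_adapted(1)[OF \<gamma> True] by eventually_elim (simp add: jet_shift_def)
    ultimately have "((\<lambda>t. snd (jet_shift s (\<gamma> t)) C \<iota>) has_real_derivative
        dir_deriv (velocity \<Phi> \<gamma> t C) (\<lambda>\<xi>. jet_shift_coords s C \<xi> \<iota>) (snd (\<gamma> t) C)) (at t)"
      by (rule eventually_eq_DERIV)
    then show ?thesis using True by (simp add: velocity_def push_def DERIV_imp_deriv)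
  qed
  then show ?thesis by (simp add: fun_eq_iff)
qed

lemma velocity_in:
  assumes C: "C \<in> adapted_at \<Phi> (fst (\<gamma> t))"
  shows "velocity \<Phi> \<gamma> t C \<in> pre_inf_coords k" and "velocity \<Phi> \<gamma> t C (Base \<mu>) = 0"
proof -
  have C': "C \<in> adapted \<Phi>" using C by (simp add: adapted_at_iff)
  show "velocity \<Phi> \<gamma> t C \<in> pre_inf_coords k"
    \<comment> \<open>Only the membership part of the chain rule is wanted here, so it is applied to
      the constant function 0.\<close>
    by (rule smooth_coords_chain_real(1)[OF first_jet_space[OF C'] smooth_coords_const[OF first_jet_space[OF C'], of 0]
            curve_eventually_DP[OF C] fibre_curve_DERIV[OF \<gamma> C]])
  have "\<forall>\<^sub>F s in nhds t. snd (fst C) (base_pt \<Phi> (\<gamma> 0)) $ \<mu> = snd (\<gamma> s) C (Base \<mu>)"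
    using fibre_curve_eventually_adapted(1)[OF \<gamma> C]
  proof eventually_elim
    case (elim s)
    show ?case using pre_inf_base_coord[OF curve_in elim] curve_base[of s] by simp
  qed
  from eventually_eq_DERIV[OF DERIV_const this] fibre_curve_DERIV[OF \<gamma> C]
  show "velocity \<Phi> \<gamma> t C (Base \<mu>) = 0" by (rule DERIV_unique[symmetric])
qed

end

lemma tangent_vectors_push:
  assumes "X \<in> PI_tangent z"
  shows "push s z X \<in> PI_tangent (jet_shift s z)"
proof -
  obtain \<gamma> where \<gamma>: "PI_curve \<gamma>" "\<gamma> 0 = z" "X = velocity \<Phi> \<gamma> 0"
    using assms by (auto simp: tangent_vectors_def)
  show ?thesis
    unfolding tangent_vectors_def mem_Collect_eq
    by (rule exI[of _ "\<lambda>t. jet_shift s (\<gamma> t)"])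
      (simp add: \<gamma>(2,3) fibre_curve_jet_shift[OF \<gamma>(1)] velocity_jet_shift[OF \<gamma>(1)])
qed

text \<open>A curve through the shifted point is carried back by the opposite shift. This is needed
  for degeneracy, which is tested against all tangent vectors at the shifted point.\<close>

lemma tangent_vectors_push_surj:
  assumes "Y \<in> PI_tangent (jet_shift s z)"
  shows "\<exists>X\<in>PI_tangent z. Y = push s z X"
proof -
  obtain \<gamma> where \<gamma>: "PI_curve \<gamma>" "\<gamma> 0 = jet_shift s z" "Y = velocity \<Phi> \<gamma> 0"
    using assms by (auto simp: tangent_vectors_def)
  let ?\<gamma> = "\<lambda>t. jet_shift (- s) (\<gamma> t)"
  have f: "PI_curve ?\<gamma>" by (rule fibre_curve_jet_shift[OF \<gamma>(1)])
  have z: "?\<gamma> 0 = z" using \<gamma>(2) by (simp add: jet_shift_inverse)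
  have "velocity \<Phi> ?\<gamma> 0 \<in> PI_tangent z"
    unfolding tangent_vectors_def using f z by blast
  moreover have "Y = push s z (velocity \<Phi> ?\<gamma> 0)"
    using velocity_jet_shift[OF f, of s 0] unfolding z \<gamma>(3) jet_shift_inverse' .
  ultimately show ?thesis by blast
qed

lemma commute_last:
  assumes D: "rel_open J D" and H: "smooth_coords J D H"
    and u: "u \<in> J" "v \<in> J" "w \<in> J" and \<eta>: "\<eta> \<in> D"
  shows "dir_deriv u (dir_deriv v (dir_deriv w H)) \<eta> = dir_deriv w (dir_deriv u (dir_deriv v H)) \<eta>"
proof -
  note com = dir_deriv_commute[OF coord_space_jet_coords D]
  have "dir_deriv u (dir_deriv v (dir_deriv w H)) \<eta> = dir_deriv u (dir_deriv w (dir_deriv v H)) \<eta>"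
    by (rule dir_deriv_cong[OF coord_space_jet_coords D u(1) \<eta>]) (rule com[OF H u(2,3)])
  also have "\<dots> = dir_deriv w (dir_deriv u (dir_deriv v H)) \<eta>"
    by (rule com[OF smooth_coordsD(3)[OF H u(2)] u(1,3) \<eta>])
  finally show ?thesis .
qed

text \<open>The shift changes the two-form by a sum over l of third and second derivatives of
  \<^term>\<open>F C l\<close> which is symmetric in the two vectors, hence drops out.\<close>

lemma pre_omega_push:
  assumes X: "X \<in> PI_tangent z"
    and Y: "Y \<in> PI_tangent z"
  shows "pre_omega k (push s z X) (push s z Y) = pre_omega k X Y"
proof
  fix C
  obtain \<gamma> where \<gamma>: "PI_curve \<gamma>" "\<gamma> 0 = z" "X = velocity \<Phi> \<gamma> 0"
    using X by (auto simp: tangent_vectors_def)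
  obtain \<delta> where \<delta>: "PI_curve \<delta>" "\<delta> 0 = z" "Y = velocity \<Phi> \<delta> 0"
    using Y by (auto simp: tangent_vectors_def)
  show "pre_omega k (push s z X) (push s z Y) C = pre_omega k X Y C"
  proof (cases "C \<in> adapted_at \<Phi> (fst z)")
    case False
    then have "X C = (\<lambda>_. 0)" "push s z X C = (\<lambda>_. 0)" "Y C = (\<lambda>_. 0)" "push s z Y C = (\<lambda>_. 0)"
      using \<gamma> \<delta> by (auto simp: velocity_def push_def)
    then show ?thesis by (simp add: pre_omega_def)
  next
    case True
    then have C: "C \<in> adapted \<Phi>" by (simp add: adapted_at_iff)
    have x: "X C \<in> pre_inf_coords k" "\<And>\<mu>. X C (Base \<mu>) = 0"
      using velocity_in[OF \<gamma>(1), of C 0] True \<gamma> by simp_all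
    have y: "Y C \<in> pre_inf_coords k" "\<And>\<mu>. Y C (Base \<mu>) = 0"
      using velocity_in[OF \<delta>(1), of C 0] True \<delta> by simp_all
    have \<xi>: "snd z C \<in> D\<^sub>P C" using pre_inf_coord_domain[OF curve_in[OF \<gamma>(1)], of C 0] True \<gamma>(2) by simp
    define \<eta> where "\<eta> = T (snd z C)"
    have \<eta>: "\<eta> \<in> Dom C" unfolding \<eta>_def by (rule first_jet_truncate[OF \<xi>])
    have mC: "snd z C \<in> pre_inf_coords k" using \<xi> by (simp add: coord_domain_def)
    define w where "w = (\<lambda>l. T (total_dir l (first_jet_dir l) (snd z C)))"
    have w: "w l \<in> J" for l
      unfolding w_def by (rule truncate_total_dir_in[OF pre_inf_coords_vertical[OF mC]])
    define V where "V = (\<lambda>l x. T (vertical_dir (first_jet_dir l) x))"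
    \<comment> \<open>\<open>A\<close> and \<open>B\<close> are the coefficients of s in the changes
      of the \<open>DMom\<close> and \<open>Mom\<close> components, and \<open>q\<close> pairs them
      with the field components of y. \<open>Q x y l\<close> is the second derivative, in the
      directions x and y, of the total derivative of \<open>F C l\<close> in direction l.\<close>
    define A where "A = (\<lambda>x a ms l. dir_deriv (w l) (dir_deriv (T x) (dir_deriv (field_unit a ms) (F C l))) \<eta> +
        dir_deriv (V l x) (dir_deriv (field_unit a ms) (F C l)) \<eta>)"
    define B where "B = (\<lambda>x a ms l. dir_deriv (T x) (dir_deriv (field_unit a ms) (F C l)) \<eta>)"
    define q where "q = (\<lambda>x y a ms l. A x a ms l * y (Fld a ms) + B x a ms l * y (DFld a ms l))"
    define Q where "Q = (\<lambda>x y l. dir_deriv (T y) (dir_deriv (w l) (dir_deriv (T x) (F C l))) \<eta> +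
        dir_deriv (T y) (dir_deriv (V l x) (F C l)) \<eta> + dir_deriv (V l y) (dir_deriv (T x) (F C l)) \<eta>)"
    note D = Dom_open[OF C]
    note S = smooth_coordsD(3)[OF F_smooth[OF C]] and S2 = smooth_coordsD(3)[OF smooth_coordsD(3)[OF F_smooth[OF C]]]
    note com = dir_deriv_commute[OF coord_space_jet_coords D F_smooth[OF C] _ _ \<eta>]
    \<comment> \<open>Commuting brings \<open>field_unit\<close> to the outside; the sums over a and
      ms then reassemble derivatives in the directions \<open>T y\<close> and \<open>V l y\<close>.
      No base term arises since both directions are vertical.\<close>
    have q: "(\<Sum>a\<in>UNIV. \<Sum>ms | length ms < k. q x y a ms l) = Q x y l"
      if x: "x \<in> pre_inf_coords k" and y: "y \<in> pre_inf_coords k" "\<And>\<mu>. y (Base \<mu>) = 0" for x y l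
    proof -
      have Vx: "V l x \<in> J" and Vy: "V l y \<in> J"
        unfolding V_def by (rule pre_inf_coords_vertical[OF x] pre_inf_coords_vertical[OF y(1)])+
      have A: "A x a ms l = dir_deriv (field_unit a ms) (dir_deriv (w l) (dir_deriv (T x) (F C l))) \<eta> +
          dir_deriv (field_unit a ms) (dir_deriv (V l x) (F C l)) \<eta>" for a ms
        unfolding A_def
        by (simp add: commute_last[OF D F_smooth[OF C] w pre_inf_coords_truncate[OF x] truncate_sym_unit_in \<eta>]
            com[OF Vx truncate_sym_unit_in])
      have B: "B x a ms l = dir_deriv (field_unit a ms) (dir_deriv (T x) (F C l)) \<eta>" for a ms
        unfolding B_def by (rule com[OF pre_inf_coords_truncate[OF x] truncate_sym_unit_in])
      have y1: "dir_deriv (T y) G \<eta> = (\<Sum>a\<in>UNIV. \<Sum>ms | length ms < k. y (Fld a ms) * dir_deriv (field_unit a ms) G \<eta>)"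
        if "smooth_coords J (Dom C) G" for G
        using dir_deriv_truncate_sum[OF D that \<eta> pre_inf_coords_truncate[OF y(1)] jk] by (simp add: y(2))
      have y2: "dir_deriv (V l y) G \<eta> = (\<Sum>a\<in>UNIV. \<Sum>ms | length ms < k. y (DFld a ms l) * dir_deriv (field_unit a ms) G \<eta>)"
        if "smooth_coords J (Dom C) G" for G
        unfolding V_def
        using dir_deriv_truncate_sum[OF D that \<eta> pre_inf_coords_vertical[OF y(1)] jk]
        by (simp add: vertical_dir_coord)
      have "Q x y l = (\<Sum>a\<in>UNIV. \<Sum>ms | length ms < k.
          y (Fld a ms) * dir_deriv (field_unit a ms) (dir_deriv (w l) (dir_deriv (T x) (F C l))) \<eta>) +
          (\<Sum>a\<in>UNIV. \<Sum>ms | length ms < k. y (Fld a ms) * dir_deriv (field_unit a ms) (dir_deriv (V l x) (F C l)) \<eta>) +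
          (\<Sum>a\<in>UNIV. \<Sum>ms | length ms < k. y (DFld a ms l) * dir_deriv (field_unit a ms) (dir_deriv (T x) (F C l)) \<eta>)"
        unfolding Q_def y1[OF S2[OF pre_inf_coords_truncate[OF x] w]] y1[OF S[OF Vx]] y2[OF S[OF pre_inf_coords_truncate[OF x]]] ..
      also have "\<dots> = (\<Sum>a\<in>UNIV. \<Sum>ms | length ms < k. q x y a ms l)"
        unfolding q_def A B by (simp add: sum.distrib[symmetric] algebra_simps)
      finally show ?thesis by simp
    qed
    have Qsym: "Q (X C) (Y C) l = Q (Y C) (X C) l" for l
    proof -
      have V: "V l (X C) \<in> J" "V l (Y C) \<in> J"
        unfolding V_def by (rule pre_inf_coords_vertical[OF x(1)] pre_inf_coords_vertical[OF y(1)])+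
      note TX = pre_inf_coords_truncate[OF x(1)] and TY = pre_inf_coords_truncate[OF y(1)]
      have "dir_deriv (T (X C)) (dir_deriv (w l) (dir_deriv (T (Y C)) (F C l))) \<eta> =
          dir_deriv (T (Y C)) (dir_deriv (T (X C)) (dir_deriv (w l) (F C l))) \<eta>"
        by (rule commute_last[OF D F_smooth[OF C] TX w TY \<eta>])
      also have "\<dots> = dir_deriv (T (Y C)) (dir_deriv (w l) (dir_deriv (T (X C)) (F C l))) \<eta>"
        by (rule dir_deriv_cong[OF coord_space_jet_coords D TY \<eta>])
          (rule dir_deriv_commute[OF coord_space_jet_coords D F_smooth[OF C] TX w])
      finally show ?thesis
        unfolding Q_def using com[OF TX V(2)] com[OF TY V(1)] by simp
    qed
    \<comment> \<open>The symmetry holds for each l after summation over a and ms, not term by term,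
      so the sum over l has to be outermost.\<close>
    have flip: "(\<Sum>a\<in>UNIV. \<Sum>ms | length ms < k. \<Sum>l\<in>UNIV. t a ms l) =
        (\<Sum>l\<in>UNIV. \<Sum>a\<in>UNIV. \<Sum>ms | length ms < k. t a ms l)" for t :: "'r \<Rightarrow> 'n list \<Rightarrow> 'n \<Rightarrow> real"
    proof -
      have "(\<Sum>a\<in>UNIV. \<Sum>ms | length ms < k. \<Sum>l\<in>UNIV. t a ms l) =
          (\<Sum>a\<in>UNIV. \<Sum>l\<in>UNIV. \<Sum>ms | length ms < k. t a ms l)"
        by (rule sum.cong[OF refl]) (rule sum.swap)
      also have "\<dots> = (\<Sum>l\<in>UNIV. \<Sum>a\<in>UNIV. \<Sum>ms | length ms < k. t a ms l)" by (rule sum.swap)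
      finally show ?thesis .
    qed
    define p where "p = (\<lambda>a ms l. (X C (DMom a ms l l) * Y C (Fld a ms) - Y C (DMom a ms l l) * X C (Fld a ms)) +
      (X C (Mom a ms l) * Y C (DFld a ms l) - Y C (Mom a ms l) * X C (DFld a ms l)))"
    have pu: "push s z X C \<iota> = dir_deriv (X C) (\<lambda>\<xi>. jet_shift_coords s C \<xi> \<iota>) (snd z C)"
      "push s z Y C \<iota> = dir_deriv (Y C) (\<lambda>\<xi>. jet_shift_coords s C \<xi> \<iota>) (snd z C)" for \<iota>
      using True by (simp_all add: push_def)
    have "pre_omega k (push s z X) (push s z Y) C = (\<Sum>a\<in>UNIV. \<Sum>ms | length ms < k. \<Sum>l\<in>UNIV.
        p a ms l + s * (q (X C) (Y C) a ms l - q (Y C) (X C) a ms l))"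
      unfolding pre_omega_def
    proof (intro sum.cong refl)
      fix a ms l assume "ms \<in> {ms :: 'n list. length ms < k}"
      then have ms: "length ms < k" by simp
      note dx = dir_deriv_jet_shift_coords[OF C x(1) \<xi>] and dy = dir_deriv_jet_shift_coords[OF C y(1) \<xi>]
      show "(push s z X C (DMom a ms l l) * push s z Y C (Fld a ms) - push s z Y C (DMom a ms l l) * push s z X C (Fld a ms)) +
        (push s z X C (Mom a ms l) * push s z Y C (DFld a ms l) - push s z Y C (Mom a ms l) * push s z X C (DFld a ms l)) =
        p a ms l + s * (q (X C) (Y C) a ms l - q (Y C) (X C) a ms l)"
        unfolding pu dx(2,3) dx(4,5)[OF ms] dy(2,3) dy(4,5)[OF ms]
        unfolding p_def q_def A_def B_def w_def V_def \<eta>_def by (simp add: algebra_simps)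
    qed
    also have "\<dots> = (\<Sum>a\<in>UNIV. \<Sum>ms | length ms < k. \<Sum>l\<in>UNIV. p a ms l) +
        s * ((\<Sum>a\<in>UNIV. \<Sum>ms | length ms < k. \<Sum>l\<in>UNIV. q (X C) (Y C) a ms l) -
          (\<Sum>a\<in>UNIV. \<Sum>ms | length ms < k. \<Sum>l\<in>UNIV. q (Y C) (X C) a ms l))"
      by (simp only: sum.distrib sum_distrib_left[symmetric] sum_subtractf)
    also have "\<dots> = (\<Sum>a\<in>UNIV. \<Sum>ms | length ms < k. \<Sum>l\<in>UNIV. p a ms l)"
      unfolding flip[of "q _ _"] q[OF x(1) y] q[OF y(1) x] Qsym by simp
    also have "\<dots> = pre_omega k X Y C" by (simp add: pre_omega_def p_def)
    finally show ?thesis .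
  qed
qed

lemma degeneracy_push:
  assumes "X \<in> degeneracy \<Phi> k z"
  shows "push s z X \<in> degeneracy \<Phi> k (jet_shift s z)"
proof -
  have X: "X \<in> PI_tangent z"
    and 0: "\<And>Y C. Y \<in> PI_tangent z \<Longrightarrow> pre_omega k X Y C = 0"
    using assms unfolding degeneracy_def by blast+
  have "pre_omega k (push s z X) Y C = 0"
    if Y: "Y \<in> PI_tangent (jet_shift s z)" for Y C
  proof -
    obtain Y' where Y': "Y' \<in> PI_tangent z" "Y = push s z Y'"
      using tangent_vectors_push_surj[OF Y] by blast
    show ?thesis unfolding Y'(2) pre_omega_push[OF X Y'(1)] by (rule 0[OF Y'(1)])
  qed
  then show ?thesis using tangent_vectors_push[OF X] unfolding degeneracy_def by blast
qed

lemma degenerate_path_jet_shift: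
  assumes "degenerate_path \<Phi> k z w"
  shows "degenerate_path \<Phi> k (jet_shift s z) (jet_shift s w)"
proof -
  obtain \<gamma> where \<gamma>: "PI_curve \<gamma>" "\<gamma> 0 = z" "\<gamma> 1 = w"
    "\<forall>t. velocity \<Phi> \<gamma> t \<in> degeneracy \<Phi> k (\<gamma> t)"
    using assms by (auto simp: degenerate_path_def)
  show ?thesis
    unfolding degenerate_path_def
    by (rule exI[of _ "\<lambda>t. jet_shift s (\<gamma> t)"])
      (simp add: \<gamma>(2,3) fibre_curve_jet_shift[OF \<gamma>(1)] velocity_jet_shift[OF \<gamma>(1)]
        degeneracy_push[OF \<gamma>(4)[rule_format]])
qed

section \<open>Leaves and the induced map\<close>

lemma leaf_jet_shift_subset: "jet_shift s ` leaf \<Phi> k z \<subseteq> leaf \<Phi> k (jet_shift s z)"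
proof
  fix v assume "v \<in> jet_shift s ` leaf \<Phi> k z"
  then obtain w where w: "(degenerate_path \<Phi> k)\<^sup>*\<^sup>* z w" "v = jet_shift s w" by (auto simp: leaf_def)
  from w(1) have "(degenerate_path \<Phi> k)\<^sup>*\<^sup>* (jet_shift s z) (jet_shift s w)"
    by (induction rule: rtranclp_induct) (auto intro: rtranclp.rtrancl_into_rtrancl degenerate_path_jet_shift)
  then show "v \<in> leaf \<Phi> k (jet_shift s z)" by (simp add: leaf_def w(2))
qed

text \<open>The converse inclusion is the one already shown, for the opposite shift at the shifted
  point.\<close>

lemma leaf_jet_shift: "leaf \<Phi> k (jet_shift s z) = jet_shift s ` leaf \<Phi> k z"
proof
  show "leaf \<Phi> k (jet_shift s z) \<subseteq> jet_shift s ` leaf \<Phi> k z"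
  proof
    fix v assume "v \<in> leaf \<Phi> k (jet_shift s z)"
    then have "jet_shift (- s) v \<in> leaf \<Phi> k z"
      using leaf_jet_shift_subset[of "- s" "jet_shift s z"] by (auto simp: jet_shift_inverse)
    then show "v \<in> jet_shift s ` leaf \<Phi> k z" using jet_shift_inverse'[of s v] by force
  qed
qed (rule leaf_jet_shift_subset)

lemma leaf_subset:
  assumes "z \<in> PI" "w \<in> leaf \<Phi> k z"
  shows "w \<in> PI" and "base_pt \<Phi> w = base_pt \<Phi> z"
proof -
  have "(degenerate_path \<Phi> k)\<^sup>*\<^sup>* z w" using assms(2) by (simp add: leaf_def)
  then have "w \<in> PI \<and> base_pt \<Phi> w = base_pt \<Phi> z"
  proof (induction rule: rtranclp_induct)
    case (step y w)
    then obtain \<gamma> where "PI_curve \<gamma>" "\<gamma> 0 = y" "\<gamma> 1 = w"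
      by (auto simp: degenerate_path_def)
    then have "w \<in> PI" "base_pt \<Phi> w = base_pt \<Phi> y"
      using curve_in[of \<gamma> 1] curve_base[of \<gamma> 1] by simp_all
    then show ?case using step.IH by simp
  qed (simp add: assms(1))
  then show "w \<in> PI" and "base_pt \<Phi> w = base_pt \<Phi> z" by simp_all
qed

text \<open>Every section with the given first jet yields the same value by
  \<open>first_jet_shift\<close>, so the definite description has a unique solution.\<close>

lemma prolongation_shift:
  assumes "phase_section U \<sigma>" "x \<in> U"
  shows "prolongation \<Phi> k (shift s) (first_jet \<Phi> \<sigma> x) = jet_shift s (first_jet \<Phi> \<sigma> x)"
  unfolding prolongation_def
proof (rule the_equality)
  show "\<exists>\<tau> U y. phase_section U \<tau> \<and> y \<in> U \<and>
     first_jet \<Phi> \<tau> y = first_jet \<Phi> \<sigma> x \<and> jet_shift s (first_jet \<Phi> \<sigma> x) = first_jet \<Phi> (shift s \<circ> \<tau>) y"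
    using assms first_jet_shift[OF assms] by metis
  fix w assume "\<exists>\<tau> U y. phase_section U \<tau> \<and> y \<in> U \<and>
     first_jet \<Phi> \<tau> y = first_jet \<Phi> \<sigma> x \<and> w = first_jet \<Phi> (shift s \<circ> \<tau>) y"
  then obtain \<tau> U y where "phase_section U \<tau>" "y \<in> U"
     "first_jet \<Phi> \<tau> y = first_jet \<Phi> \<sigma> x" "w = first_jet \<Phi> (shift s \<circ> \<tau>) y" by blast
  then show "w = jet_shift s (first_jet \<Phi> \<sigma> x)" using first_jet_shift by simp
qed

lemma induced_map_leaf:
  assumes z: "z \<in> PI"
  shows "induced_map \<Phi> k (shift s) (leaf \<Phi> k z) = leaf \<Phi> k (jet_shift s z)"
  unfolding induced_map_def leaf_jet_shift
proof (rule image_cong[OF refl])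
  fix w assume "w \<in> leaf \<Phi> k z"
  then have "w \<in> first_jets_phase \<Phi> k" using leaf_subset(1)[OF z] by (simp add: pre_inf_phase_def)
  then show "prolongation \<Phi> k (shift s) w = jet_shift s w"
    by (auto simp: first_jets_phase_def prolongation_shift)
qed

abbreviation "\<F> \<equiv> induced_map \<Phi> k (shift 1)"
abbreviation "\<G> \<equiv> induced_map \<Phi> k (shift (- 1))"

lemma induced_map_inverse:
  assumes "K \<in> inf_phase \<Phi> k"
  shows "\<G> (\<F> K) = K" "\<F> (\<G> K) = K" "\<F> K \<in> inf_phase \<Phi> k" "\<G> K \<in> inf_phase \<Phi> k"
proof -
  obtain z where z: "z \<in> PI" "K = leaf \<Phi> k z" using assms by (auto simp: inf_phase_def)
  note p = jet_shift_pre_inf[OF z(1)]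
  show "\<G> (\<F> K) = K" "\<F> (\<G> K) = K" "\<F> K \<in> inf_phase \<Phi> k" "\<G> K \<in> inf_phase \<Phi> k"
    using p jet_shift_inverse[of 1 z] jet_shift_inverse'[of 1 z]
    by (auto simp: z(2) induced_map_leaf[OF z(1)] induced_map_leaf[OF p] inf_phase_def)
qed

lemma bij_induced: "bij_betw \<F> (inf_phase \<Phi> k) (inf_phase \<Phi> k)"
  by (rule bij_betw_byWitness[where f' = \<G>]) (use induced_map_inverse in auto)

lemma inv_induced: "K \<in> inf_phase \<Phi> k \<Longrightarrow> inv_into (inf_phase \<Phi> k) \<F> K = \<G> K"
  using inv_into_f_f[OF bij_betw_imp_inj_on[OF bij_induced] induced_map_inverse(4)] induced_map_inverse(2) by metis

text \<open>A coordinate representative h of H becomes h composed with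
  \<open>jet_shift_coords\<close>. The map f is kept general so that the induced map and its inverse
  are both covered, with s = 1 and s = - 1.\<close>

lemma smooth_on_inf_phase_jet_shift:
  assumes H: "smooth_on_inf_phase \<Phi> k H"
    and f: "\<And>z. z \<in> PI \<Longrightarrow> f (leaf \<Phi> k z) = leaf \<Phi> k (jet_shift s z)"
  shows "smooth_on_inf_phase \<Phi> k (\<lambda>K. H (f K))"
  unfolding smooth_on_inf_phase_def
proof
  fix C assume C: "C \<in> adapted \<Phi>"
  obtain h where h: "smooth_coords (pre_inf_coords k) (D\<^sub>P C) h"
    and hH: "\<forall>z\<in>PI. C \<in> adapted_at \<Phi> (fst z) \<longrightarrow> H (leaf \<Phi> k z) = h (snd z C)"
    using H C unfolding smooth_on_inf_phase_def by blast
  have "smooth_coords (pre_inf_coords k) (D\<^sub>P C) (\<lambda>\<xi>. h (jet_shift_coords s C \<xi>))"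
    by (rule smooth_coords_compose[OF first_jet_space[OF C] first_jet_space[OF C] h smooth_jet_shift_coords[OF C]
          jet_shift_coords_domain[OF C]])
  moreover have "H (f (leaf \<Phi> k z)) = h (jet_shift_coords s C (snd z C))"
    if "z \<in> PI" "C \<in> adapted_at \<Phi> (fst z)" for z
    using f[OF that(1)] hH[rule_format, OF jet_shift_pre_inf[OF that(1)], of s] that(2)
    by (simp add: jet_shift_def)
  ultimately show "\<exists>h. smooth_coords (pre_inf_coords k) (D\<^sub>P C) h \<and>
     (\<forall>z\<in>PI. C \<in> adapted_at \<Phi> (fst z) \<longrightarrow> H (f (leaf \<Phi> k z)) = h (snd z C))"
    by blast
qed

text \<open>Shifting lifts forward and backward are mutually inverse operations. The existence of a
  lift guarantees that every \<open>c t\<close> is a leaf of the bundle, where \<open>\<G>\<close>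
  is known to undo \<open>\<F>\<close>.\<close>

lemma lifts_induced:
  assumes c: "lifts \<Phi> k c \<noteq> {}"
  shows "lifts \<Phi> k (\<lambda>t. \<F> (c t)) = (\<lambda>\<gamma> t. jet_shift 1 (\<gamma> t)) ` lifts \<Phi> k c"
proof (intro equalityI subsetI)
  obtain \<gamma>0 where \<gamma>0: "PI_curve \<gamma>0" "\<And>t. c t = leaf \<Phi> k (\<gamma>0 t)"
    using c by (auto simp: lifts_def)
  fix \<gamma> assume "\<gamma> \<in> lifts \<Phi> k (\<lambda>t. \<F> (c t))"
  then have \<gamma>: "PI_curve \<gamma>" "\<And>t. \<F> (c t) = leaf \<Phi> k (\<gamma> t)"
    by (auto simp: lifts_def)
  have "c t = leaf \<Phi> k (jet_shift (- 1) (\<gamma> t))" for t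
  proof -
    have "c t \<in> inf_phase \<Phi> k" using \<gamma>0(2) curve_in[OF \<gamma>0(1)] by (simp add: inf_phase_def)
    then have "c t = \<G> (\<F> (c t))" by (simp add: induced_map_inverse)
    also have "\<dots> = leaf \<Phi> k (jet_shift (- 1) (\<gamma> t))"
      unfolding \<gamma>(2) by (rule induced_map_leaf[OF curve_in[OF \<gamma>(1)]])
    finally show ?thesis .
  qed
  then have m: "(\<lambda>t. jet_shift (- 1) (\<gamma> t)) \<in> lifts \<Phi> k c"
    using fibre_curve_jet_shift[OF \<gamma>(1)] by (simp add: lifts_def)
  show "\<gamma> \<in> (\<lambda>\<gamma> t. jet_shift 1 (\<gamma> t)) ` lifts \<Phi> k c"
    by (rule image_eqI[OF _ m]) (simp add: jet_shift_inverse')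
next
  fix \<gamma>' assume "\<gamma>' \<in> (\<lambda>\<gamma> t. jet_shift 1 (\<gamma> t)) ` lifts \<Phi> k c"
  then obtain \<gamma> where \<gamma>: "\<gamma>' = (\<lambda>t. jet_shift 1 (\<gamma> t))" "PI_curve \<gamma>"
    "\<And>t. c t = leaf \<Phi> k (\<gamma> t)" by (auto simp: lifts_def)
  show "\<gamma>' \<in> lifts \<Phi> k (\<lambda>t. \<F> (c t))"
    using fibre_curve_jet_shift[OF \<gamma>(2)] induced_map_leaf[OF curve_in[OF \<gamma>(2)]]
    by (simp add: lifts_def \<gamma>(1,3))
qed

text \<open>Under the correspondence of lifts the conditions on \<alpha> in the two definite
  descriptions are equivalent: common starting points are preserved because the shift is injective,
  and the values of the form by \<open>pre_omega_push\<close>. Hence the described values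
  coincide.\<close>

lemma inf_omega_induced:
  assumes c: "lifts \<Phi> k c \<noteq> {}" and d: "lifts \<Phi> k d \<noteq> {}"
  shows "inf_omega \<Phi> k (\<lambda>t. \<F> (c t)) (\<lambda>t. \<F> (d t)) = inf_omega \<Phi> k c d"
proof -
  have "(\<exists>\<gamma>\<in>lifts \<Phi> k (\<lambda>t. \<F> (c t)). \<exists>\<delta>\<in>lifts \<Phi> k (\<lambda>t. \<F> (d t)). \<gamma> 0 = \<delta> 0 \<and>
      \<alpha> = pre_omega k (velocity \<Phi> \<gamma> 0) (velocity \<Phi> \<delta> 0)) \<longleftrightarrow>
    (\<exists>\<gamma>\<in>lifts \<Phi> k c. \<exists>\<delta>\<in>lifts \<Phi> k d. \<gamma> 0 = \<delta> 0 \<and>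
      \<alpha> = pre_omega k (velocity \<Phi> \<gamma> 0) (velocity \<Phi> \<delta> 0))" for \<alpha>
    unfolding lifts_induced[OF c] lifts_induced[OF d] bex_simps
  proof (intro bex_cong refl conj_cong)
    fix \<gamma> \<delta> assume "\<gamma> \<in> lifts \<Phi> k c" "\<delta> \<in> lifts \<Phi> k d"
    then have \<gamma>: "PI_curve \<gamma>" and \<delta>: "PI_curve \<delta>"
      by (simp_all add: lifts_def)
    show "jet_shift 1 (\<gamma> 0) = jet_shift 1 (\<delta> 0) \<longleftrightarrow> \<gamma> 0 = \<delta> 0"
      using jet_shift_inverse[of 1] by metis
    assume 0: "\<gamma> 0 = \<delta> 0"
    have "velocity \<Phi> \<gamma> 0 \<in> PI_tangent (\<gamma> 0)"
      "velocity \<Phi> \<delta> 0 \<in> PI_tangent (\<gamma> 0)"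
      using \<gamma> \<delta> 0 unfolding tangent_vectors_def by auto
    from pre_omega_push[OF this]
    show "(\<alpha> = pre_omega k (velocity \<Phi> (\<lambda>t. jet_shift 1 (\<gamma> t)) 0) (velocity \<Phi> (\<lambda>t. jet_shift 1 (\<delta> t)) 0)) \<longleftrightarrow>
      (\<alpha> = pre_omega k (velocity \<Phi> \<gamma> 0) (velocity \<Phi> \<delta> 0))"
      by (simp add: velocity_jet_shift[OF \<gamma>] velocity_jet_shift[OF \<delta>] 0)
  qed
  then show ?thesis unfolding inf_omega_def by simp
qed

lemma symplectomorphism_induced: "symplectomorphism_inf_phase \<Phi> k \<F>"
  unfolding symplectomorphism_inf_phase_def
proof (intro conjI ballI allI impI)
  show "bij_betw \<F> (inf_phase \<Phi> k) (inf_phase \<Phi> k)" by (rule bij_induced)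
  show "base_pt \<Phi> w = base_pt \<Phi> z" if K: "K \<in> inf_phase \<Phi> k" and z: "z \<in> K" and w: "w \<in> \<F> K" for K z w
  proof -
    obtain v where v: "v \<in> PI" "K = leaf \<Phi> k v" using K by (auto simp: inf_phase_def)
    have "w \<in> leaf \<Phi> k (jet_shift 1 v)" using w v induced_map_leaf[OF v(1)] by simp
    from leaf_subset(2)[OF jet_shift_pre_inf[OF v(1)] this] leaf_subset(2)[OF v(1)] z v(2)
    show ?thesis by (simp add: base_pt_def)
  qed
  fix H assume H: "smooth_on_inf_phase \<Phi> k H"
  show "smooth_on_inf_phase \<Phi> k (\<lambda>K. H (\<F> K))"
    by (rule smooth_on_inf_phase_jet_shift[OF H induced_map_leaf])
  show "smooth_on_inf_phase \<Phi> k (\<lambda>K. H (inv_into (inf_phase \<Phi> k) \<F> K))"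
  proof (rule smooth_on_inf_phase_jet_shift[OF H])
    fix z assume z: "z \<in> PI"
    then have "leaf \<Phi> k z \<in> inf_phase \<Phi> k" by (simp add: inf_phase_def)
    then show "inv_into (inf_phase \<Phi> k) \<F> (leaf \<Phi> k z) = leaf \<Phi> k (jet_shift (- 1) z)"
      by (simp add: inv_induced induced_map_leaf[OF z])
  qed
next
  fix c d assume "lifts \<Phi> k c \<noteq> {} \<and> lifts \<Phi> k d \<noteq> {} \<and> c 0 = d 0"
  then have c: "lifts \<Phi> k c \<noteq> {}" and d: "lifts \<Phi> k d \<noteq> {}" by simp_all
  show "lifts \<Phi> k (\<lambda>t. \<F> (c t)) \<noteq> {}" "lifts \<Phi> k (\<lambda>t. \<F> (d t)) \<noteq> {}"
    using c d by (simp_all add: lifts_induced)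
  show "inf_omega \<Phi> k (\<lambda>t. \<F> (c t)) (\<lambda>t. \<F> (d t)) = inf_omega \<Phi> k c d"
    by (rule inf_omega_induced[OF c d])
qed

end

theorem theorem6:
  fixes \<Phi> :: "('m::{t2_space,second_countable_topology},
                'e::{t2_space,second_countable_topology}, 'n::finite, 'r::finite) fib_bundle"
    and Q :: "('q::{t2_space,second_countable_topology}, real^'r) chart set"
    and k l :: nat
    and L :: "('m, 'e, 'n, 'r) density"
    and F :: "('m, 'e, 'n, 'r) current"
  assumes "fibre_bundle \<Phi> Q"
    and "1 \<le> l" and "l \<le> k"
    and "is_density \<Phi> k L"
    and "is_current \<Phi> (l - 1) F"
  shows "symplectomorphism_inf_phase \<Phi> k
           (induced_map \<Phi> k (momentum_shift \<Phi> k (pull_back (l - 1) F)))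
       \<and> (\<forall>\<sigma>. bundle_section \<Phi> (phase_bundle \<Phi> k) (carrier (base_atlas \<Phi>)) \<sigma> \<longrightarrow>
            (euler_lagrange \<Phi> k L \<sigma> \<longleftrightarrow>
             euler_lagrange \<Phi> k (\<lambda>C \<xi>. L C \<xi> + total_div k (pull_back (l - 1) F) C \<xi>)
               (momentum_shift \<Phi> k (pull_back (l - 1) F) \<circ> \<sigma>)))"
proof -
  \<comment> \<open>Subtraction on naturals is truncated; 1 \<le> l makes l - 1 the true
    predecessor, so l \<le> k gives l - 1 < k.\<close>
  interpret current_on_jets \<Phi> k "l - 1" F
    using assms by unfold_locales (auto simp: fibre_bundle_def)
  show ?thesis
    unfolding momentum_shift_eq
    using symplectomorphism_induced euler_lagrange_shift[OF assms(4)] by blast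
qed

end
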